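(* Let $(x,\Phi)$ be a minimizer of the Crisanti–Sommers functional $\mathscr C$ with constraint $Q$, and let $\mu_P$ be the measure with $\mu_P([0,t])=x(t)$. For any $u_0\in\mathrm{supp}\,\mu_P$, if $$\langle\xi''(Q),\Phi'(u_0)^{\circ2}\rangle<\langle Q^{-1}\Phi'(u_0),Q^{-1}\Phi'(u_0)\rangle,$$ then the Parisi measure $\mu_P$ has a jump discontinuity at $u_0$, i.e. $\mu_P(\{u_0\})>0$.
   Context: Fix $m\ge1$. For each $p\ge2$ let $\vec\beta_p\in\mathbb R^m$, with $\vec\beta_p=0$ for odd $p$ and $\sum_{p\ge2}2^p\vec\beta_p(j)^2<\infty$ for every $1\le j\le m$; let $\vec h\in\mathbb R^m$. (The inverse temperature is absorbed into $\xi$ and $\vec h$.) $\odot$ is the entrywise product, $A^{\circ p}$ the entrywise $p$-th power, $|A|$ the determinant, and $\langle A,B\rangle=\mathrm{Trace}(AB)$, which is the Frobenius inner product on symmetric matrices; in particular $\langle Q^{-1}\Phi',Q^{-1}\Phi'\rangle=\langle Q^{-1}\Phi'Q^{-1},\Phi'\rangle$. $\vec\beta_p\otimes\vec\beta_p=(\vec\beta_p(i)\vec\beta_p(j))_{i,j}$, $\xi(A)=\sum_p(\vec\beta_p\otimes\vec\beta_p)\odot A^{\circ p}$, $\xi'(A)=\sum_pp(\vec\beta_p\otimes\vec\beta_p)\odot A^{\circ(p-1)}$, $\xi''(A)=\sum_pp(p-1)(\vec\beta_p\otimes\vec\beta_p)\odot A^{\circ(p-2)}$. $\mathbb S^m_+$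 is the set of symmetric positive semidefinite $m\times m$ matrices. $Q\in\mathbb S^m_+$ has entries in $[-1,1]$ and diagonal entries $1$. Admissible pairs $(x,\Phi)$: $x:[0,m]\to[0,1]$ is right-continuous and nondecreasing with $x(0^-)=0$, $x(m)=1$, with associated probability measure $\mu_P([0,t])=x(t)$; $\Phi\in\mathscr M$, i.e. $\Phi:[0,m]\to\mathbb S^m_+$ is a continuously differentiable, Lipschitz, monotone (Loewner-nondecreasing) path with Lipschitz derivative, $\Phi(0)=0$, $\Phi(m)=Q$, and $\mathrm{Trace}(\Phi(t))=t$ for $t\in\mathrm{supp}\,\mu_P$; and $|Q-\Phi(t_x)|>0$ where $t_x=\inf\{t:x(t)=1\}$ (in particular $Q$ is invertible when an admissible pair exists). Put $\hat\Phi(t)=\int_t^mx(s)\Phi'(s)ds$. For $\hat T\in(t_x,m)$ with $|Q-\Phi(\hat T)|>0$ (the value does not depend on $\hat T$), $$\mathscr C(x,\Phi)=\tfrac12\Big[\int_0^mx(t)\langle\xi'(\Phi(t))+\vec h\vec h^T,\Phi'(t)\rangle dt+\log|\Phi(m)-\Phi(\hat T)|+\int_0^{\hat T}\langle\hat\Phi(t)^{-1},\Phi'(t)\rangle dt\Big].$$ A minimizer is a pair minimizing $\mathscr C$ over all admissible pairs. *)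

theory Defs
  imports "HOL-Probability.Probability"
begin

section \<open>Matrices\<close>

definition psd :: "real^'n^'n \<Rightarrow> bool" where
  "psd A \<longleftrightarrow> transpose A = A \<and> (\<forall>v. 0 \<le> v \<bullet> (A *v v))"

definition frob :: "real^'n^'n \<Rightarrow> real^'n^'n \<Rightarrow> real" where
  "frob A B = trace (A ** B)"

definition outer :: "real^'n \<Rightarrow> real^'n \<Rightarrow> real^'n^'n" where
  "outer v w = (\<chi> i j. v $ i * w $ j)"

definition hadamard_power :: "real^'n^'n \<Rightarrow> nat \<Rightarrow> real^'n^'n" where
  "hadamard_power A p = (\<chi> i j. (A $ i $ j) ^ p)"

section \<open>The mixture\<close>

text \<open>Only the indices \<open>p \<ge> 2\<close> of a coefficient sequence \<open>\<beta>\<close> are ever used.\<close>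

definition mixture :: "(nat \<Rightarrow> real^'n) \<Rightarrow> bool" where
  "mixture \<beta> \<longleftrightarrow> (\<forall>p\<ge>2. odd p \<longrightarrow> \<beta> p = 0) \<and>
     (\<forall>j. (\<lambda>p. 2 ^ p * (\<beta> p $ j)\<^sup>2) summable_on {2..})"

text \<open>The sums over \<open>p\<close> are entrywise; they converge absolutely when \<open>\<beta>\<close> is a mixture and
  the entries of \<open>A\<close> lie in \<open>[-1,1]\<close>.\<close>

definition xi' :: "(nat \<Rightarrow> real^'n) \<Rightarrow> real^'n^'n \<Rightarrow> real^'n^'n" where
  "xi' \<beta> A = (\<chi> i j. \<Sum>\<^sub>\<infinity>p\<in>{2..}.
     real p * outer (\<beta> p) (\<beta> p) $ i $ j * hadamard_power A (p - 1) $ i $ j)"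

definition xi'' :: "(nat \<Rightarrow> real^'n) \<Rightarrow> real^'n^'n \<Rightarrow> real^'n^'n" where
  "xi'' \<beta> A = (\<chi> i j. \<Sum>\<^sub>\<infinity>p\<in>{2..}.
     real p * real (p - 1) * outer (\<beta> p) (\<beta> p) $ i $ j * hadamard_power A (p - 2) $ i $ j)"

definition constraint :: "real^'n^'n \<Rightarrow> bool" where
  "constraint Q \<longleftrightarrow> psd Q \<and> (\<forall>i j. Q $ i $ j \<in> {-1..1}) \<and> (\<forall>i. Q $ i $ i = 1)"

section \<open>Order parameters\<close>

text \<open>A function on \<open>[0,m]\<close> is represented by a function on all reals whose values outside
  \<open>[0,m]\<close> are ignored.\<close>

definition order_param :: "real \<Rightarrow> (real \<Rightarrow> real) \<Rightarrow> bool" where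
  "order_param m x \<longleftrightarrow> (\<forall>t\<in>{0..m}. x t \<in> {0..1}) \<and> mono_on {0..m} x \<and>
     (\<forall>t\<in>{0..<m}. continuous (at_right t) x) \<and> x m = 1"

text \<open>The distribution function on the whole line; its value \<open>0\<close> on the negative axis is the
  convention \<open>x(0-) = 0\<close>, so that \<open>x 0\<close> is the mass of the point \<open>0\<close>.\<close>

definition param_cdf :: "real \<Rightarrow> (real \<Rightarrow> real) \<Rightarrow> real \<Rightarrow> real" where
  "param_cdf m x t = (if t < 0 then 0 else x (min t m))"

definition parisi_measure :: "real \<Rightarrow> (real \<Rightarrow> real) \<Rightarrow> real measure" where
  "parisi_measure m x = interval_measure (param_cdf m x)"

definition supp :: "real measure \<Rightarrow> real set" where
  "supp M = {t. \<forall>U. open U \<and> t \<in> U \<longrightarrow> emeasure M U > 0}"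

definition t_top :: "real \<Rightarrow> (real \<Rightarrow> real) \<Rightarrow> real" where
  "t_top m x = Inf {t \<in> {0..m}. x t = 1}"

section \<open>Admissible pairs and the Crisanti--Sommers functional\<close>

text \<open>The right end point \<open>m\<close> of the time interval is the dimension \<open>CARD('n)\<close>.
  Derivatives are taken within \<open>[0,m]\<close>, hence one-sided at the end points.\<close>

definition path_deriv :: "(real \<Rightarrow> real^'n^'n) \<Rightarrow> real \<Rightarrow> real^'n^'n" where
  "path_deriv \<Phi> t = vector_derivative \<Phi> (at t within {0..real CARD('n)})"

definition admissible_path :: "(real \<Rightarrow> real^'n^'n) \<Rightarrow> bool" where
  "admissible_path \<Phi> \<longleftrightarrow>
     (\<forall>t\<in>{0..real CARD('n)}. psd (\<Phi> t)) \<and>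
     (\<forall>t\<in>{0..real CARD('n)}. \<Phi> differentiable (at t within {0..real CARD('n)})) \<and>
     continuous_on {0..real CARD('n)} (path_deriv \<Phi>) \<and>
     (\<exists>L. L-lipschitz_on {0..real CARD('n)} \<Phi>) \<and>
     (\<exists>L. L-lipschitz_on {0..real CARD('n)} (path_deriv \<Phi>)) \<and>
     (\<forall>s\<in>{0..real CARD('n)}. \<forall>t\<in>{0..real CARD('n)}. s \<le> t \<longrightarrow> psd (\<Phi> t - \<Phi> s))"

definition admissible :: "real^'n^'n \<Rightarrow> (real \<Rightarrow> real) \<Rightarrow> (real \<Rightarrow> real^'n^'n) \<Rightarrow> bool" where
  "admissible Q x \<Phi> \<longleftrightarrow>
     order_param (real CARD('n)) x \<and>
     admissible_path \<Phi> \<and> \<Phi> 0 = 0 \<and> \<Phi> (real CARD('n)) = Q \<and>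
     (\<forall>t\<in>supp (parisi_measure (real CARD('n)) x). trace (\<Phi> t) = t) \<and>
     det (Q - \<Phi> (t_top (real CARD('n)) x)) > 0"

definition hat_path ::
    "(real \<Rightarrow> real) \<Rightarrow> (real \<Rightarrow> real^'n^'n) \<Rightarrow> real \<Rightarrow> real^'n^'n" where
  "hat_path x \<Phi> t = integral {t..real CARD('n)} (\<lambda>s. x s *\<^sub>R path_deriv \<Phi> s)"

definition crisanti_sommers_at ::
    "real \<Rightarrow> (nat \<Rightarrow> real^'n) \<Rightarrow> real^'n \<Rightarrow> (real \<Rightarrow> real) \<Rightarrow> (real \<Rightarrow> real^'n^'n) \<Rightarrow> real" where
  "crisanti_sommers_at T \<beta> h x \<Phi> = 1/2 *
     (integral {0..real CARD('n)} (\<lambda>t. x t * frob (xi' \<beta> (\<Phi> t) + outer h h) (path_deriv \<Phi> t))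
      + ln (det (\<Phi> (real CARD('n)) - \<Phi> T))
      + integral {0..T} (\<lambda>t. frob (matrix_inv (hat_path x \<Phi> t)) (path_deriv \<Phi> t)))"

text \<open>For an admissible pair a cutoff \<open>T\<close> as below exists, by continuity of \<open>\<Phi>\<close>, and the value
  does not depend on it; the choice operator picks one.\<close>

definition crisanti_sommers ::
    "(nat \<Rightarrow> real^'n) \<Rightarrow> real^'n \<Rightarrow> (real \<Rightarrow> real) \<Rightarrow> (real \<Rightarrow> real^'n^'n) \<Rightarrow> real" where
  "crisanti_sommers \<beta> h x \<Phi> = crisanti_sommers_at
     (SOME T. T \<in> {t_top (real CARD('n)) x<..<real CARD('n)} \<and>
              det (\<Phi> (real CARD('n)) - \<Phi> T) > 0) \<beta> h x \<Phi>"

definition cs_minimizer ::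
    "(nat \<Rightarrow> real^'n) \<Rightarrow> real^'n \<Rightarrow> real^'n^'n \<Rightarrow> (real \<Rightarrow> real) \<Rightarrow> (real \<Rightarrow> real^'n^'n) \<Rightarrow> bool" where
  "cs_minimizer \<beta> h Q x \<Phi> \<longleftrightarrow> admissible Q x \<Phi> \<and>
     (\<forall>y \<Psi>. admissible Q y \<Psi> \<longrightarrow> crisanti_sommers \<beta> h x \<Phi> \<le> crisanti_sommers \<beta> h y \<Psi>)"

section \<open>The measure of an order parameter\<close>

lemma
  assumes m: "0 < m" and x: "order_param m x"
  shows prob_space_parisi_measure: "prob_space (parisi_measure m x)"
    and measure_parisi_measure_Icc:
      "\<And>t. t \<in> {0..m} \<Longrightarrow> measure (parisi_measure m x) {0..t} = x t"
proof -
  let ?F = "param_cdf m x"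
  have x01: "0 \<le> x t \<and> x t \<le> 1" if "t \<in> {0..m}" for t
    using x that by (auto simp: order_param_def)
  have nondec: "?F a \<le> ?F b" if "a \<le> b" for a b
    using that x x01[of "min b m"] m
    by (auto simp: param_cdf_def order_param_def mono_on_def)
  have rc: "continuous (at_right a) ?F" for a
  proof -
    consider "a < 0" | "a \<in> {0..<m}" | "m \<le> a" by fastforce
    then show ?thesis
    proof cases
      case 1
      have "\<forall>\<^sub>F t in at_right a. ?F t = 0"
        using 1 unfolding eventually_at_right_field
        by (intro exI[of _ 0]) (auto simp: param_cdf_def)
      then show ?thesis
        using 1 by (auto simp: continuous_within param_cdf_def[of _ _ a] intro: tendsto_eventually)
    next
      case 2
      have "\<forall>\<^sub>F t in at_right a. ?F t = x t"
        using 2 unfolding eventually_at_right_field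
        by (intro exI[of _ m]) (auto simp: param_cdf_def min_def)
      moreover have "(x \<longlongrightarrow> x a) (at_right a)"
        using 2 x by (auto simp: order_param_def continuous_within)
      moreover have "?F a = x a" using 2 by (auto simp: param_cdf_def)
      ultimately show ?thesis
        by (simp add: continuous_within tendsto_cong)
    next
      case 3
      have "\<forall>\<^sub>F t in at_right a. ?F t = x m"
        using 3 m unfolding eventually_at_right_field
        by (intro exI[of _ "a + 1"]) (auto simp: param_cdf_def)
      moreover have "?F a = x m" using 3 m by (auto simp: param_cdf_def)
      ultimately show ?thesis
        by (auto simp: continuous_within intro: tendsto_eventually)
    qed
  qed
  have bot: "(?F \<longlongrightarrow> 0) at_bot"
    by (rule tendsto_eventually, unfold eventually_at_bot_dense)
       (auto simp: param_cdf_def intro!: exI[of _ 0])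
  have top: "(?F \<longlongrightarrow> 1) at_top"
    using x m by (intro tendsto_eventually, unfold eventually_at_top_linorder)
       (auto simp: param_cdf_def order_param_def intro!: exI[of _ m])
  interpret real_distribution "parisi_measure m x"
    unfolding parisi_measure_def
    by (rule real_distribution_interval_measure[OF nondec rc bot top])
  show "prob_space (parisi_measure m x)" by unfold_locales
  have cdf: "cdf (parisi_measure m x) = ?F"
    unfolding parisi_measure_def by (rule cdf_interval_measure[OF nondec rc bot])
  have "(?F \<longlongrightarrow> 0) (at_left 0)"
    by (rule tendsto_eventually, unfold eventually_at_left_field)
       (auto simp: param_cdf_def intro!: exI[of _ "-1"])
  then have neg: "measure (parisi_measure m x) {..<0} = 0"
    using cdf_at_left[of 0] tendsto_unique[of "at_left (0::real)"] unfolding cdf by force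
  fix t assume t: "t \<in> {0..m}"
  have "measure (parisi_measure m x) ({..<0} \<union> {0..t})
      = measure (parisi_measure m x) {..<0} + measure (parisi_measure m x) {0..t}"
    by (rule finite_measure_Union) auto
  moreover have "{..<0} \<union> {0..t} = {..t}" using t by auto
  ultimately show "measure (parisi_measure m x) {0..t} = x t"
    using neg fun_cong[OF cdf, of t] t by (simp add: cdf_def param_cdf_def)
qed

end

theory Submission
  imports Defs
begin

text \<open>
  Only the path is varied. For a direction \<open>\<Psi>\<close> vanishing at both ends, twice the derivative of
  the functional at \<open>(x, \<Phi> + \<epsilon>\<Psi>)\<close> is \<open>\<integral> x d\<langle>M, \<Psi>\<rangle> = - \<integral> \<langle>M, \<Psi>\<rangle> d\<mu>\<close>, where
  \<open>M = \<xi>'(\<Phi>) + h h\<^sup>T - N\<close> and \<open>N(t) = \<integral>\<^sub>0\<^sup>t R \<Phi>' R\<close> with \<open>R\<close> the inverse of the hat path.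
  The trace constraint on the support is no restriction, because the functional is invariant under
  changes of time. Monotone competitors arise by removing increments \<open>\<Phi>'\<close> near a time \<open>r\<close> and
  inserting their sum near another time \<open>a\<close>; in the limit \<open>\<Psi>\<close> is \<open>\<plusminus>\<Phi>'(r)\<close> between \<open>r\<close> and \<open>a\<close>
  and zero elsewhere, so minimality gives
  \<open>\<integral> \<langle>M, \<Phi>'(r)\<rangle> d\<mu> \<ge> 0\<close> over \<open>(r, a)\<close> if \<open>r < a\<close>, and \<open>\<le> 0\<close> over \<open>(a, r)\<close> if \<open>a < r\<close>.

  Suppose that \<open>u\<^sub>0\<close> is no atom; then the support accumulates at \<open>u\<^sub>0\<close>, say from the right.
  Taking \<open>a = u\<^sub>0\<close> and letting \<open>r\<close> decrease to \<open>u\<^sub>0\<close> gives \<open>\<langle>M(u\<^sub>0), \<Phi>'(u\<^sub>0)\<rangle> \<le> 0\<close>. The derivative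
  of \<open>\<langle>M, \<Phi>'(u\<^sub>0)\<rangle>\<close> at \<open>u\<^sub>0\<close> is
  \<open>\<langle>\<xi>''(\<Phi>), \<Phi>' \<odot> \<Phi>'\<rangle> - \<langle>R \<Phi>' R, \<Phi>'\<rangle>\<close>, which is negative by the hypothesis, since \<open>\<Phi>\<close> and the hat
  path are dominated by \<open>Q\<close>, \<open>\<xi>''\<close> is monotone by Schur's product theorem and inversion is
  antitone. Hence \<open>\<langle>M, \<Phi>'(u\<^sub>0)\<rangle> < 0\<close> just after \<open>u\<^sub>0\<close>, which contradicts the inequality with
  \<open>r = u\<^sub>0\<close>. Accumulation from the left is the mirror image.
\<close>

subsection \<open>Positive semidefinite matrices\<close>

text \<open>\<open>\<Phi>\<close> must stay Loewner-monotone while \<open>\<Phi>'\<close> may be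
  degenerate: from \<open>\<Phi>' t\<close> only multiples of itself are subtracted, whereas any
  positive semidefinite matrix may be added. Directions are not reversible, and minimality yields
  inequalities instead of Euler-Lagrange equations. A competitor needs a Lipschitz derivative, so
  removal and insertion are spread out by bump functions of positive width. Each transport then
  gives \<open>(x d2 - x d1) * \<kappa> \<le> \<eta>\<close>: the gain \<open>\<kappa>\<close> on an
  interval, weighted by its mass, is at most the worst error \<open>\<eta>\<close> elsewhere. In the
  decisive step the width of the removal is chosen last, which makes \<open>\<eta>\<close> small
  while \<open>d1\<close>, \<open>d2\<close> and \<open>\<kappa>\<close> are fixed. All changes stay
  below \<open>t_top\<close>, so the cutoff and the log-determinant are common to all competitors,
  and their hat paths on \<open>[0,T]\<close> still dominate the invertible
  \<open>Q - \<Phi> T\<close>. As \<open>x\<close> may jump, derivatives of hat paths are available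
  only off a countable set, and integrals against the Parisi measure are handled by the second mean
  value theorem.\<close>

lemma inner_matrix_entries: "A \<bullet> B = (\<Sum>i\<in>UNIV. \<Sum>j\<in>UNIV. A$i$j * B$i$j)"
  for A B :: "real^'n^'n"
  by (simp add: inner_vec_def)

lemma frob_eq_inner: "frob A B = A \<bullet> transpose B"
  by (simp add: frob_def trace_def matrix_matrix_mult_def transpose_def inner_matrix_entries)

lemma frob_symmetric_eq_inner: "transpose B = B \<Longrightarrow> frob A B = A \<bullet> B"
  by (simp add: frob_eq_inner)

lemma psd_symmetric: "psd A \<Longrightarrow> transpose A = A"
  by (simp add: psd_def)

lemma symmetric_entries: "transpose A = A \<Longrightarrow> A$i$j = A$j$i"
  by (metis transpose_def vec_lambda_beta)

lemma psd_entries_sym: "psd A \<Longrightarrow> A$i$j = A$j$i"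
  using psd_symmetric symmetric_entries by blast

lemma inner_symmetric_matrix: "transpose A = A \<Longrightarrow> v \<bullet> (A *v w) = w \<bullet> (A *v v)" for A :: "real^'n^'n"
  by (metis dot_lmul_matrix inner_commute vector_transpose_matrix)

text \<open>Discriminant of the quadratic form along the line \<open>v + t *\<^sub>R w\<close>. The
  matrix may be degenerate, so a vanishing leading coefficient is a case of its own.\<close>

lemma psd_Cauchy_Schwarz:
  assumes "psd A"
  shows "(v \<bullet> (A *v w))\<^sup>2 \<le> (v \<bullet> (A *v v)) * (w \<bullet> (A *v w))"
proof -
  define a b c where "a = v \<bullet> (A *v v)" and "b = v \<bullet> (A *v w)" and "c = w \<bullet> (A *v w)"
  have b': "w \<bullet> (A *v v) = b"
    using assms by (metis b_def inner_symmetric_matrix psd_symmetric)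
  have *: "0 \<le> a + 2 * t * b + t\<^sup>2 * c" for t
  proof -
    have "0 \<le> (v + t *\<^sub>R w) \<bullet> (A *v (v + t *\<^sub>R w))"
      using assms by (simp add: psd_def)
    also have "\<dots> = a + 2 * t * b + t\<^sup>2 * c"
      using b' by (simp add: a_def b_def c_def matrix_vector_right_distrib
          inner_add_left inner_add_right scaleR_matrix_vector_assoc[symmetric] matrix_vector_mult_scaleR algebra_simps power2_eq_square)
    finally show ?thesis .
  qed
  have c0: "0 \<le> c" using assms by (simp add: psd_def c_def)
  show ?thesis
  proof (cases "c = 0")
    case True
    have "b = 0"
    proof (rule ccontr)
      assume "b \<noteq> 0"
      \<comment> \<open>For \<open>c = 0\<close> the polynomial is affine in \<open>t\<close>; at
        this \<open>t\<close> its value is \<open>-1\<close>.\<close>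
      then show False using *[of "- (a + 1) / (2 * b)"] True by (simp add: field_simps)
    qed
    then show ?thesis using True by (simp add: a_def b_def c_def)
  next
    case False
    \<comment> \<open>The quadratic is smallest at \<open>t = - b / c\<close>.\<close>
    then have "0 \<le> a - b\<^sup>2 / c"
      using *[of "- b / c"] by (simp add: power2_eq_square field_simps)
    then show ?thesis using False c0 by (simp add: a_def b_def c_def field_simps)
  qed
qed

lemma inner_axis_matrix: "axis i 1 \<bullet> (A *v axis j 1) = A$i$j" for A :: "real^'n^'n"
  by (simp add: inner_axis' matrix_vector_mul_component inner_axis)

lemma psd_diag_nonneg: "psd A \<Longrightarrow> 0 \<le> A$i$i"
  using inner_axis_matrix[of i A i] by (metis psd_def)

lemma psd_entry_le: "psd A \<Longrightarrow> (A$i$j)\<^sup>2 \<le> A$i$i * A$j$j"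
  using psd_Cauchy_Schwarz[of A "axis i 1" "axis j 1"] by (simp add: inner_axis_matrix)

lemma outer_mult_vec: "outer v w *v u = (w \<bullet> u) *\<^sub>R v"
  by (simp add: outer_def matrix_vector_mult_def vec_eq_iff inner_vec_def sum_distrib_left mult_ac)

lemma psd_add: "psd A \<Longrightarrow> psd B \<Longrightarrow> psd (A + B)"
  by (simp add: psd_def matrix_vector_mult_add_rdistrib inner_add_right transpose_def vec_eq_iff)

lemma psd_scaleR: "psd A \<Longrightarrow> 0 \<le> c \<Longrightarrow> psd (c *\<^sub>R A)"
  by (simp add: psd_def scaleR_matrix_vector_assoc[symmetric] transpose_def vec_eq_iff)

lemma psd_zero [simp]: "psd 0"
  by (simp add: psd_def) (simp add: transpose_def vec_eq_iff)

text \<open>Symmetric Gaussian elimination: subtracting the rank-one matrix of a row with nonzero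
  diagonal entry clears that row and keeps cleared rows cleared.\<close>

lemma psd_sum_outer:
  assumes "psd A"
  obtains vs where "A = (\<Sum>v\<leftarrow>vs. outer v v)"
proof -
  have "\<exists>vs. A = (\<Sum>v\<leftarrow>vs. outer v v)"
    using assms
  proof (induction "card {i. A$i$i \<noteq> 0}" arbitrary: A rule: less_induct)
    case less
    note A = less.prems
    show ?case
    proof (cases "\<forall>i. A$i$i = 0")
      case True
      then have "A$i$j = 0" for i j
        using psd_entry_le[OF A, of i j] by simp
      then have "A = 0" by (simp add: vec_eq_iff)
      then show ?thesis by (intro exI[of _ "[]"]) simp
    next
      case False
      then obtain i where i: "A$i$i \<noteq> 0" by blast
      then have pos: "0 < A$i$i" using psd_diag_nonneg[OF A, of i] by simp
      define a where "a = (1 / sqrt (A$i$i)) *\<^sub>R A$i"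
      define B where "B = A - outer a a"
      have Bkl: "B$k$l = A$k$l - A$i$k * A$i$l / A$i$i" for k l
        using pos by (simp add: B_def a_def outer_def field_simps)
      have "transpose B = B"
        using psd_entries_sym[OF A] by (simp add: transpose_def vec_eq_iff Bkl mult.commute)
      \<comment> \<open>Nonnegativity of the Schur complement is Cauchy-Schwarz for \<open>v\<close>
        and the \<open>i\<close>-th unit vector.\<close>
      moreover have "0 \<le> v \<bullet> (B *v v)" for v
      proof -
        have "A *v axis i 1 = A$i"
          using psd_entries_sym[OF A]
          by (simp add: vec_eq_iff matrix_vector_mul_component inner_axis)
        then have "(v \<bullet> A$i)\<^sup>2 \<le> (v \<bullet> (A *v v)) * A$i$i"
          using psd_Cauchy_Schwarz[OF A, of v "axis i 1"] by (simp add: inner_axis_matrix inner_axis')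
        moreover have "v \<bullet> (B *v v) = v \<bullet> (A *v v) - (v \<bullet> A$i)\<^sup>2 / A$i$i"
          using pos by (simp add: B_def a_def matrix_vector_mult_diff_rdistrib inner_diff_right
              outer_mult_vec inner_commute power2_eq_square)
        ultimately have "0 \<le> A$i$i * (v \<bullet> (B *v v))" using pos by (simp add: field_simps)
        then show ?thesis using pos by (simp add: zero_le_mult_iff)
      qed
      ultimately have B: "psd B" by (simp add: psd_def)
      \<comment> \<open>A zero diagonal entry of \<open>A\<close> forces \<open>A$i$k = 0\<close>,
        so nothing is subtracted there.\<close>
      have "B$k$k = 0" if "A$k$k = 0" for k
        using that psd_entry_le[OF A, of i k] by (simp add: Bkl)
      moreover have "B$i$i = 0" using pos by (simp add: Bkl)
      ultimately have "{k. B$k$k \<noteq> 0} \<subset> {k. A$k$k \<noteq> 0}" using i by blast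
      then have "card {k. B$k$k \<noteq> 0} < card {k. A$k$k \<noteq> 0}"
        by (intro psubset_card_mono) auto
      from less.hyps[OF this B] obtain vs where "B = (\<Sum>v\<leftarrow>vs. outer v v)" by blast
      then have "A = (\<Sum>v\<leftarrow>a # vs. outer v v)" by (simp add: B_def algebra_simps)
      then show ?thesis by blast
    qed
  qed
  with that show ?thesis by blast
qed

lemma sum_list_inner: "(\<Sum>v\<leftarrow>vs. f v) \<bullet> B = (\<Sum>v\<leftarrow>vs. f v \<bullet> B)" for B :: "'a::real_inner"
  by (induction vs) (simp_all add: inner_add_left)

lemma inner_outer: "outer v w \<bullet> B = v \<bullet> (B *v w)" for B :: "real^'n^'n"
  by (simp add: inner_matrix_entries outer_def inner_vec_def matrix_vector_mult_def
      sum_distrib_left mult_ac)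

text \<open>The cone lies in its own dual: on a rank-one summand of \<open>A\<close> the pairing is
  the quadratic form of \<open>B\<close>.\<close>

lemma psd_inner_nonneg:
  fixes A B :: "real^'n^'n"
  assumes "psd A" "psd B"
  shows "0 \<le> A \<bullet> B"
proof -
  obtain vs where "A = (\<Sum>v\<leftarrow>vs. outer v v)" using psd_sum_outer[OF assms(1)] .
  then show ?thesis
    using assms(2) by (auto simp: sum_list_inner inner_outer psd_def intro!: sum_list_nonneg)
qed

section \<open>Hadamard products and Schur's product theorem\<close>

definition hadamard :: "real^'n^'n \<Rightarrow> real^'n^'n \<Rightarrow> real^'n^'n" where
  "hadamard A B = (\<chi> i j. A$i$j * B$i$j)"

lemma psd_outer: "psd (outer v v)"
  by (simp add: psd_def outer_mult_vec inner_commute) (simp add: outer_def transpose_def mult.commute)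

text \<open>For a rank-one \<open>outer v v\<close> the Hadamard product is the congruence of
  \<open>B\<close> by the diagonal matrix of \<open>v\<close>; the general case is a sum of
  these.\<close>

lemma psd_hadamard:
  assumes "psd A" "psd B"
  shows "psd (hadamard A B)"
proof -
  obtain vs where vs: "A = (\<Sum>v\<leftarrow>vs. outer v v)" using psd_sum_outer[OF assms(1)] .
  have 1: "psd (hadamard (outer v v) B)" for v
  proof -
    have "u \<bullet> (hadamard (outer v v) B *v u) = (\<chi> i. v$i * u$i) \<bullet> (B *v (\<chi> i. v$i * u$i))" for u
      by (simp add: inner_vec_def matrix_vector_mult_def hadamard_def outer_def sum_distrib_left mult_ac)
    moreover have "transpose (hadamard (outer v v) B) = hadamard (outer v v) B"
      using psd_entries_sym[OF assms(2)] by (simp add: transpose_def hadamard_def outer_def vec_eq_iff mult.commute)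
    ultimately show ?thesis using assms(2) by (simp add: psd_def)
  qed
  have "psd (hadamard (\<Sum>v\<leftarrow>vs. outer v v) B)" for vs
  proof (induction vs)
    case Nil
    have "hadamard 0 B = 0" by (simp add: hadamard_def vec_eq_iff)
    then show ?case by simp
  next
    case (Cons v vs)
    have "hadamard (C + D) B = hadamard C B + hadamard D B" for C D
      by (simp add: hadamard_def vec_eq_iff algebra_simps)
    then show ?case using Cons 1 by (simp add: psd_add)
  qed
  then show ?thesis by (simp add: vs)
qed

lemma hadamard_power_Suc: "hadamard_power A (Suc k) = hadamard A (hadamard_power A k)"
  by (simp add: hadamard_power_def hadamard_def)

lemma psd_hadamard_power: "psd A \<Longrightarrow> psd (hadamard_power A k)"
proof (induction k)
  case 0
  \<comment> \<open>Since \<open>0 ^ 0 = 1\<close>, the zeroth power is the all-ones matrix, which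
    has rank one.\<close>
  have "hadamard_power A 0 = outer 1 1" by (simp add: hadamard_power_def outer_def vec_eq_iff)
  then show ?case by (simp add: psd_outer)
next
  case (Suc k) then show ?case by (simp add: hadamard_power_Suc psd_hadamard)
qed

text \<open>Telescoping as for scalar powers: replace one factor \<open>A\<close> by
  \<open>B\<close> at a time, each difference being positive by Schur's theorem.\<close>

lemma psd_hadamard_power_mono:
  assumes "psd A" "psd B" "psd (B - A)"
  shows "psd (hadamard_power B k - hadamard_power A k)"
proof (induction k)
  case 0
  then show ?case by (simp add: hadamard_power_def)
next
  case (Suc k)
  have "hadamard_power B (Suc k) - hadamard_power A (Suc k) =
      hadamard B (hadamard_power B k - hadamard_power A k) + hadamard (B - A) (hadamard_power A k)"
    by (simp add: hadamard_power_Suc hadamard_def vec_eq_iff algebra_simps)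
  then show ?case using Suc assms by (simp add: psd_add psd_hadamard psd_hadamard_power)
qed

text \<open>A two by two minor bounds each entry by the diagonal. For paths below \<open>Q\<close>
  this keeps the entries well inside the disc of radius 2 on which the mixture converges.\<close>

lemma psd_le_diag_one:
  assumes "psd A" "psd (Q - A)" "\<And>i. Q$i$i = 1"
  shows "\<bar>A$i$j\<bar> \<le> 1"
proof -
  have "0 \<le> A$k$k \<and> A$k$k \<le> 1" for k
    using psd_diag_nonneg[OF assms(1)] psd_diag_nonneg[OF assms(2), of k] assms(3) by simp
  then have "A$i$i * A$j$j \<le> 1" by (simp add: mult_le_one)
  then have "(A$i$j)\<^sup>2 \<le> 1" using psd_entry_le[OF assms(1)] order_trans by blast
  then show ?thesis by (simp add: abs_square_le_1)
qed

lemma closed_psd: "closed (Collect (psd :: real^'n^'n \<Rightarrow> bool))"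
proof -
  have "Collect (psd :: real^'n^'n \<Rightarrow> bool) =
      (\<Inter>i. \<Inter>j. {A. A$i$j = A$j$i}) \<inter> (\<Inter>v. {A. 0 \<le> outer v v \<bullet> A})"
    by (auto simp: psd_def inner_outer transpose_def vec_eq_iff)
  moreover have "closed {A :: real^'n^'n. A$i$j = A$j$i}" for i j
    by (intro closed_Collect_eq continuous_intros)
  moreover have "closed {A :: real^'n^'n. 0 \<le> outer v v \<bullet> A}" for v
    by (intro closed_Collect_le continuous_intros)
  ultimately show ?thesis by (simp add: closed_INT closed_Int)
qed

subsection \<open>Positive definite matrices and inverses\<close>

text \<open>If \<open>A *v v\<close> is nonzero, Cauchy-Schwarz for \<open>A *v v\<close> and
  \<open>v\<close> bounds its norm to the fourth power by a multiple of
  \<open>v \<bullet> (A *v v)\<close>, which therefore cannot vanish.\<close>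

lemma posdef_iff:
  fixes A :: "real^'n^'n"
  assumes "psd A"
  shows "det A \<noteq> 0 \<longleftrightarrow> (\<forall>v. v \<noteq> 0 \<longrightarrow> 0 < v \<bullet> (A *v v))"
proof
  assume det: "det A \<noteq> 0"
  show "\<forall>v. v \<noteq> 0 \<longrightarrow> 0 < v \<bullet> (A *v v)"
  proof (intro allI impI)
    fix v :: "real^'n" assume "v \<noteq> 0"
    then have "A *v v \<noteq> 0"
      using det inj_matrix_vector_mult[of A] by (metis injD invertible_det_nz matrix_vector_mult_0_right)
    then have "0 < ((A *v v) \<bullet> (A *v v))\<^sup>2" by simp
    also have "\<dots> \<le> ((A *v v) \<bullet> (A *v (A *v v))) * (v \<bullet> (A *v v))"
      using psd_Cauchy_Schwarz[OF assms, of "A *v v" v] by simp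
    finally have "v \<bullet> (A *v v) \<noteq> 0" by auto
    then show "0 < v \<bullet> (A *v v)" using assms by (simp add: psd_def less_le)
  qed
next
  assume *: "\<forall>v. v \<noteq> 0 \<longrightarrow> 0 < v \<bullet> (A *v v)"
  have "A *v v = 0 \<Longrightarrow> v = 0" for v using * by force
  then show "det A \<noteq> 0"
    by (metis invertible_det_nz invertible_left_inverse matrix_left_invertible_ker)
qed

lemma posdef_mono:
  fixes A B :: "real^'n^'n"
  assumes "psd A" "det A \<noteq> 0" "psd (B - A)"
  shows "psd B" and "det B \<noteq> 0"
proof -
  show B: "psd B" using psd_add[OF assms(1,3)] by simp
  have "v \<bullet> (A *v v) \<le> v \<bullet> (B *v v)" for v
    using assms(3) by (simp add: psd_def matrix_vector_mult_diff_rdistrib inner_diff_right)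
  then show "det B \<noteq> 0"
    using assms(1,2) unfolding posdef_iff[OF B] posdef_iff[OF assms(1)] by (meson less_le_trans)
qed

lemma matrix_inv_mult:
  fixes A :: "real^'n^'n"
  assumes "det A \<noteq> 0"
  shows "A ** matrix_inv A = mat 1" "matrix_inv A ** A = mat 1"
proof -
  have "\<exists>B. A ** B = mat 1 \<and> B ** A = mat 1"
    using assms invertible_det_nz[of A] by (simp add: invertible_def)
  then have "A ** matrix_inv A = mat 1 \<and> matrix_inv A ** A = mat 1"
    unfolding matrix_inv_def by (rule someI_ex)
  then show "A ** matrix_inv A = mat 1" "matrix_inv A ** A = mat 1" by auto
qed

lemma transpose_matrix_inv:
  fixes A :: "real^'n^'n"
  assumes "det A \<noteq> 0" "transpose A = A"
  shows "transpose (matrix_inv A) = matrix_inv A"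
proof -
  have "transpose (matrix_inv A) ** A = mat 1"
    by (metis assms matrix_inv_mult(1) matrix_transpose_mul transpose_mat)
  then have "transpose (matrix_inv A) ** (A ** matrix_inv A) = matrix_inv A"
    by (simp add: matrix_mul_assoc)
  then show ?thesis by (simp add: matrix_inv_mult[OF assms(1)])
qed

text \<open>The form of the inverse of \<open>A\<close> at \<open>w\<close> is the maximum over
  \<open>v\<close> of \<open>2 * (v \<bullet> w) - v \<bullet> (A *v v)\<close>. It is tested at
  \<open>v = matrix_inv B *v w\<close>, where \<open>v \<bullet> (A *v v)\<close> is at most
  \<open>v \<bullet> (B *v v) = v \<bullet> w\<close>.\<close>

lemma psd_matrix_inv_antimono:
  fixes A B :: "real^'n^'n"
  assumes A: "psd A" "det A \<noteq> 0" and BA: "psd (B - A)"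
  shows "psd (matrix_inv A - matrix_inv B)"
proof -
  have B: "psd B" "det B \<noteq> 0" using posdef_mono[OF A BA] by auto
  have sym: "transpose (matrix_inv A) = matrix_inv A" "transpose (matrix_inv B) = matrix_inv B"
    using transpose_matrix_inv A B psd_symmetric by blast+
  have "0 \<le> w \<bullet> ((matrix_inv A - matrix_inv B) *v w)" for w
  proof -
    define v u where "v = matrix_inv B *v w" and "u = matrix_inv A *v w"
    have Bv: "B *v v = w" and Au: "A *v u = w"
      by (simp_all add: v_def u_def matrix_vector_mul_assoc matrix_inv_mult A B)
    have "0 \<le> (v - u) \<bullet> (A *v (v - u))" using A by (simp add: psd_def)
    also have "\<dots> = v \<bullet> (A *v v) - 2 * (v \<bullet> w) + u \<bullet> w"
      using inner_symmetric_matrix[OF psd_symmetric[OF A(1)], of u v]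
      by (simp add: matrix_vector_mult_diff_distrib inner_diff_left inner_diff_right Au)
    also have "v \<bullet> (A *v v) \<le> v \<bullet> w"
    proof -
      have "0 \<le> v \<bullet> ((B - A) *v v)" using BA by (simp add: psd_def)
      then show ?thesis by (simp add: matrix_vector_mult_diff_rdistrib inner_diff_right Bv)
    qed
    finally have "0 \<le> u \<bullet> w - v \<bullet> w" by simp
    then show ?thesis
      by (simp add: matrix_vector_mult_diff_rdistrib inner_diff_right inner_commute flip: u_def v_def)
  qed
  moreover have "transpose (matrix_inv A - matrix_inv B) = matrix_inv A - matrix_inv B"
    using sym by (simp add: transpose_def vec_eq_iff)
  ultimately show ?thesis by (simp add: psd_def)
qed

lemma psd_congruence:
  fixes X P :: "real^'n^'n"
  assumes "psd X" "transpose P = P"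
  shows "psd (P ** X ** P)"
proof -
  have "v \<bullet> (P ** X ** P *v v) = (P *v v) \<bullet> (X *v (P *v v))" for v
    using assms(2) by (metis inner_commute inner_symmetric_matrix matrix_vector_mul_assoc)
  moreover have "transpose (P ** X ** P) = P ** X ** P"
    using assms by (simp add: psd_def matrix_transpose_mul matrix_mul_assoc)
  ultimately show ?thesis using assms(1) by (simp add: psd_def)
qed

lemma inner_matrix_mult_sym:
  fixes X P B :: "real^'n^'n"
  assumes "transpose X = X"
  shows "(X ** P) \<bullet> B = P \<bullet> (X ** B)" "(P ** X) \<bullet> B = P \<bullet> (B ** X)"
proof -
  have "(X ** P) \<bullet> B = frob (transpose B ** X) P" 
    by (metis frob_def frob_eq_inner inner_commute matrix_mul_assoc trace_mul_sym transpose_transpose)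
  also have "\<dots> = P \<bullet> (X ** B)"
    using assms by (metis frob_eq_inner inner_commute matrix_transpose_mul transpose_transpose
      frob_def trace_mul_sym)
  finally show "(X ** P) \<bullet> B = P \<bullet> (X ** B)" .
  have "(P ** X) \<bullet> B = frob P (X ** transpose B)"
    by (metis frob_def frob_eq_inner matrix_mul_assoc transpose_transpose)
  also have "\<dots> = P \<bullet> (B ** X)"
    using assms by (simp add: frob_eq_inner matrix_transpose_mul)
  finally show "(P ** X) \<bullet> B = P \<bullet> (B ** X)" .
qed

text \<open>The form is quadratic in the inverse, so antimonotonicity of inversion alone does not
  give it. With \<open>X\<close> and \<open>Y\<close> the two inverses, the difference factors like
  a difference of squares, as the pairing of \<open>X - Y\<close> with
  \<open>P ** (X + Y) ** P\<close>; the mixed terms cancel by cyclicity of the trace.\<close>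

lemma inverse_form_antimono:
  fixes A B P :: "real^'n^'n"
  assumes A: "psd A" "det A \<noteq> 0" and BA: "psd (B - A)" and P: "transpose P = P"
  shows "(matrix_inv B ** P ** matrix_inv B) \<bullet> P \<le> (matrix_inv A ** P ** matrix_inv A) \<bullet> P"
proof -
  define X Y where "X = matrix_inv A" and "Y = matrix_inv B"
  have B: "psd B" "det B \<noteq> 0" using posdef_mono[OF A BA] by auto
  have sX: "transpose X = X" and sY: "transpose Y = Y"
    unfolding X_def Y_def using transpose_matrix_inv A B psd_symmetric by blast+
  have XY: "psd (X - Y)" unfolding X_def Y_def by (rule psd_matrix_inv_antimono[OF A BA])
  have "psd (X - 0)" "psd Y"
  proof -
    have *: "psd (matrix_inv C)" if "psd C" "det C \<noteq> 0" for C :: "real^'n^'n"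
    proof -
      \<comment> \<open>The inverse is a congruence of \<open>C\<close> itself, hence
        positive.\<close>
      have "matrix_inv C = matrix_inv C ** C ** matrix_inv C" by (simp add: matrix_inv_mult that)
      then show ?thesis
        using psd_congruence[OF that(1) transpose_matrix_inv[OF that(2) psd_symmetric[OF that(1)]]] by simp
    qed
    show "psd (X - 0)" "psd Y" using * A B by (auto simp: X_def Y_def)
  qed
  then have X: "psd X" and Y: "psd Y" by auto
  have "(X ** P ** X) \<bullet> P - (Y ** P ** Y) \<bullet> P = (X - Y) \<bullet> (P ** X ** P) + (X - Y) \<bullet> (P ** Y ** P)"
  proof -
    have 1: "(Z ** P ** W) \<bullet> P = Z \<bullet> (P ** W ** P)" if "transpose W = W" for Z W
      using inner_matrix_mult_sym(2)[OF that, of "Z ** P" P] inner_matrix_mult_sym(2)[OF P, of Z "P ** W"]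
      by simp
    have "X \<bullet> (P ** Y ** P) = Y \<bullet> (P ** X ** P)"
      using inner_matrix_mult_sym[OF P, of X] inner_matrix_mult_sym[OF P, of _ Y]
      by (metis inner_commute matrix_mul_assoc)
    then show ?thesis by (simp add: 1 sX sY inner_diff_left)
  qed
  moreover have "0 \<le> (X - Y) \<bullet> (P ** X ** P)" "0 \<le> (X - Y) \<bullet> (P ** Y ** P)"
    by (intro psd_inner_nonneg XY psd_congruence X Y P)+
  ultimately show ?thesis by (simp add: X_def Y_def)
qed

section \<open>Continuity and derivative of the matrix inverse\<close>

lemma bounded_bilinear_matrix_mult: "bounded_bilinear ((**) :: real^'n^'n \<Rightarrow> real^'n^'n \<Rightarrow> real^'n^'n)"
  unfolding bilinear_conv_bounded_bilinear[symmetric] bilinear_def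
  by (auto intro!: linearI simp: matrix_matrix_mult_def vec_eq_iff algebra_simps sum.distrib sum_distrib_left)

lemmas continuous_on_matrix_mult [continuous_intros] = bounded_bilinear.continuous_on[OF bounded_bilinear_matrix_mult]

lemma continuous_on_det [continuous_intros]:
  fixes f :: "'a::topological_space \<Rightarrow> real^'n^'n"
  shows "continuous_on S f \<Longrightarrow> continuous_on S (\<lambda>x. det (f x))"
  unfolding det_def by (intro continuous_intros)

text \<open>By Cramer's rule the entries of the inverse are polynomials in the entries divided by
  the determinant.\<close>

lemma continuous_on_matrix_inv:
  fixes f :: "'a::topological_space \<Rightarrow> real^'n^'n"
  assumes f: "continuous_on S f" and det: "\<And>x. x \<in> S \<Longrightarrow> det (f x) \<noteq> 0"
  shows "continuous_on S (\<lambda>x. matrix_inv (f x))"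
proof -
  define g where "g x = (\<chi> i j. det (\<chi> k l. if l = i then axis j 1 $ k else f x $ k $ l) / det (f x))"
    for x
  have "matrix_inv (f x) = g x" if "x \<in> S" for x
  proof -
    have "matrix_inv (f x) *v axis j 1 = (\<chi> i. det (\<chi> k l. if l = i then axis j 1 $ k else f x $ k $ l) / det (f x))" for j
      using matrix_inv_mult[OF det[OF that]] det[OF that]
      by (subst cramer[symmetric]) (auto simp: matrix_vector_mul_assoc)
    then show ?thesis
      by (simp add: vec_eq_iff g_def matrix_vector_mul_component inner_axis)
  qed
  moreover have "continuous_on S g"
    unfolding g_def
  proof (intro continuous_intros f)
    fix i j k l
    show "continuous_on S (\<lambda>x. if l = i then axis j 1 $ k else f x $ k $ l)"
      by (cases "l = i") (auto intro!: continuous_intros f)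
  qed (use det in auto)
  ultimately show ?thesis by (simp add: continuous_on_eq)
qed

text \<open>The resolvent identity; divided by the time increment it turns into the derivative of
  the inverse.\<close>

lemma matrix_inv_diff:
  fixes A B :: "real^'n^'n"
  assumes "det A \<noteq> 0" "det B \<noteq> 0"
  shows "matrix_inv B - matrix_inv A = - (matrix_inv B ** (B - A) ** matrix_inv A)"
proof -
  have "matrix_inv B ** (B - A) ** matrix_inv A =
      matrix_inv B ** B ** matrix_inv A - matrix_inv B ** (A ** matrix_inv A)"
    by (simp add: matrix_mul_assoc bounded_bilinear.diff_left[OF bounded_bilinear_matrix_mult]
       bounded_bilinear.diff_right[OF bounded_bilinear_matrix_mult])
  then show ?thesis by (simp add: matrix_inv_mult assms)
qed

text \<open>With the derivative as a limit of slopes, bilinear products, entrywise limits and closed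
  sets of matrices can be used directly.\<close>

lemma has_vector_derivative_iff_slope:
  "(f has_vector_derivative D) (at t within S) \<longleftrightarrow>
     ((\<lambda>s. (1 / (s - t)) *\<^sub>R (f s - f t)) \<longlongrightarrow> D) (at t within S)"
proof -
  have "norm (f s - f t - (s - t) *\<^sub>R D) / norm (s - t) = norm ((1 / (s - t)) *\<^sub>R (f s - f t) - D)"
    if "s \<noteq> t" for s
  proof -
    have "(1 / (s - t)) *\<^sub>R (f s - f t) - D = (1 / (s - t)) *\<^sub>R (f s - f t - (s - t) *\<^sub>R D)"
      using that by (simp add: scaleR_right_diff_distrib)
    then show ?thesis by simp
  qed
  then have "((\<lambda>s. norm (f s - f t - (s - t) *\<^sub>R D) / norm (s - t)) \<longlongrightarrow> 0) (at t within S) \<longleftrightarrow>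
      ((\<lambda>s. norm ((1 / (s - t)) *\<^sub>R (f s - f t) - D)) \<longlongrightarrow> 0) (at t within S)"
    by (intro Lim_cong_within) auto
  also have "\<dots> \<longleftrightarrow> ((\<lambda>s. (1 / (s - t)) *\<^sub>R (f s - f t)) \<longlongrightarrow> D) (at t within S)"
    unfolding tendsto_norm_zero_iff by (rule LIM_zero_iff)
  finally show ?thesis
    unfolding has_vector_derivative_def has_derivative_iff_norm
    by (simp add: bounded_linear_scaleR_left)
qed

lemma has_vector_derivative_matrix_inv:
  fixes X :: "real \<Rightarrow> real^'n^'n"
  assumes X: "(X has_vector_derivative X') (at t within S)" and t: "t \<in> S"
    and det: "\<And>s. s \<in> S \<Longrightarrow> det (X s) \<noteq> 0" and cont: "continuous_on S X"
  shows "((\<lambda>s. matrix_inv (X s)) has_vector_derivative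
     - (matrix_inv (X t) ** X' ** matrix_inv (X t))) (at t within S)"
proof -
  interpret bb: bounded_bilinear "(**) :: real^'n^'n \<Rightarrow> real^'n^'n \<Rightarrow> real^'n^'n"
    by (rule bounded_bilinear_matrix_mult)
  have "((\<lambda>s. matrix_inv (X s)) \<longlongrightarrow> matrix_inv (X t)) (at t within S)"
    using continuous_on_matrix_inv[OF cont det] t by (auto simp: continuous_on_def)
  moreover have "((\<lambda>s. (1 / (s - t)) *\<^sub>R (X s - X t)) \<longlongrightarrow> X') (at t within S)"
    using X by (simp add: has_vector_derivative_iff_slope)
  ultimately have "((\<lambda>s. - (matrix_inv (X s) ** ((1 / (s - t)) *\<^sub>R (X s - X t)) ** matrix_inv (X t))) \<longlongrightarrow>
     - (matrix_inv (X t) ** X' ** matrix_inv (X t))) (at t within S)"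
    by (intro tendsto_minus bb.tendsto tendsto_const)
  moreover have "- (matrix_inv (X s) ** ((1 / (s - t)) *\<^sub>R (X s - X t)) ** matrix_inv (X t)) =
      (1 / (s - t)) *\<^sub>R (matrix_inv (X s) - matrix_inv (X t))" if "s \<in> S" for s
    unfolding matrix_inv_diff[OF det[OF t] det[OF that]]
    by (simp add: bb.scaleR_left bb.scaleR_right)
  ultimately show ?thesis
    unfolding has_vector_derivative_iff_slope
    by (subst Lim_cong_within) auto
qed

subsection \<open>Integrals with monotone weights\<close>

text \<open>A monotone weight is bounded and measurable. Absolute integrability is stated because
  the change of time asks for it.\<close>

lemma mono_scaleR_continuous_absolutely_integrable:
  fixes g :: "real \<Rightarrow> 'a::euclidean_space"
  assumes x: "mono_on {a..b} x" and g: "continuous_on {a..b} g"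
  shows "(\<lambda>t. x t *\<^sub>R g t) absolutely_integrable_on {a..b}"
proof (rule absolutely_integrable_bounded_measurable_product[where h = "(*\<^sub>R)"])
  show "bilinear ((*\<^sub>R) :: real \<Rightarrow> 'a \<Rightarrow> 'a)"
    by (simp add: bilinear_conv_bounded_bilinear bounded_bilinear_scaleR)
  show "x \<in> borel_measurable (lebesgue_on {a..b})"
  proof -
    have "(\<lambda>t. indicator {a..b} t *\<^sub>R x t) \<in> borel_measurable borel"
      using borel_measurable_mono_on_fnc[OF x] by (simp add: borel_measurable_restrict_space_iff)
    then have "(\<lambda>t. indicator {a..b} t *\<^sub>R x t) \<in> borel_measurable lebesgue"
      by (intro measurable_completion) simp
    then show ?thesis by (simp add: borel_measurable_restrict_space_iff)
  qed
  show "bounded (x ` {a..b})"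
  proof (rule boundedI)
    fix y assume "y \<in> x ` {a..b}"
    then obtain t where t: "t \<in> {a..b}" "y = x t" by blast
    then have "x a \<le> x t" "x t \<le> x b" using x by (auto simp: mono_on_def)
    then show "norm y \<le> \<bar>x a\<bar> + \<bar>x b\<bar>" using t by auto
  qed
  show "g absolutely_integrable_on {a..b}"
    using g absolutely_integrable_continuous_real by blast
qed auto

lemma mono_scaleR_continuous_integrable:
  fixes g :: "real \<Rightarrow> 'a::euclidean_space"
  assumes "mono_on {a..b} x" and "continuous_on {a..b} g"
  shows "(\<lambda>t. x t *\<^sub>R g t) integrable_on {a..b}"
  using mono_scaleR_continuous_absolutely_integrable[OF assms] set_lebesgue_integral_eq_integral(1) by blast

lemma mono_mult_continuous_integrable:
  fixes g :: "real \<Rightarrow> real"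
  assumes "mono_on {a..b} x" and "continuous_on {a..b} g"
  shows "(\<lambda>t. x t * g t) integrable_on {a..b}"
  using mono_scaleR_continuous_integrable[OF assms] by simp

text \<open>This replaces integration by parts against the Stieltjes measure of \<open>x\<close>.\<close>

lemma mono_weight_mean_value:
  fixes F :: "real \<Rightarrow> real"
  assumes "p \<le> q" and x: "mono_on {p..q} x"
    and F: "\<And>t. t \<in> {p..q} \<Longrightarrow> (F has_vector_derivative F' t) (at t within {p..q})"
  obtains c where "c \<in> {p..q}"
    "integral {p..q} (\<lambda>t. x t * F' t) = x q * F q - x p * F p - (x q - x p) * F c"
proof -
  have ftc: "(F' has_integral F v - F u) {u..v}" if "p \<le> u" "u \<le> v" "v \<le> q" for u v
    using that by (intro fundamental_theorem_of_calculus)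
      (auto intro: has_vector_derivative_within_subset[OF F])
  have "F' integrable_on {p..q}" using ftc[of p q] assms(1) by auto
  moreover have "x u \<le> x v" if "p \<le> u" "u \<le> v" "v \<le> q" for u v
    using x that by (auto simp: mono_on_def)
  ultimately obtain c where c: "c \<in> {p..q}"
    "integral {p..q} (\<lambda>t. x t * F' t) = x p * integral {p..c} F' + x q * integral {c..q} F'"
    using second_mean_value_theorem[of F' p q x] assms(1) by blast
  moreover have "integral {p..c} F' = F c - F p" "integral {c..q} F' = F q - F c"
    using c(1) ftc by (auto intro!: integral_unique)
  ultimately show ?thesis using that by (simp add: algebra_simps)
qed

text \<open>On each of the three pieces the mean value identity replaces the Stieltjes integral of
  \<open>F\<close> by one value of \<open>F\<close> times the increment of \<open>x\<close>. The
  boundary terms telescope and vanish at the ends. The middle piece contributes at most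
  \<open>- (x d2 - x d1) * \<kappa>\<close>, the outer ones at most \<open>\<eta>\<close>, as their
  total increment is at most 1.\<close>

lemma mono_weight_integral_upper:
  fixes F :: "real \<Rightarrow> real"
  assumes x: "mono_on {0..m} x" "x 0 \<ge> 0" "x m \<le> 1"
    and F: "\<And>t. t \<in> {0..m} \<Longrightarrow> (F has_vector_derivative F' t) (at t within {0..m})"
    and F': "continuous_on {0..m} F'"
    and ends: "F 0 = 0" "F m = 0" and d: "0 \<le> d1" "d1 \<le> d2" "d2 \<le> m"
    and lower: "\<And>t. t \<in> {0..m} \<Longrightarrow> - \<eta> \<le> F t" and lower': "\<And>t. t \<in> {d1..d2} \<Longrightarrow> \<kappa> \<le> F t"
    and \<eta>: "0 \<le> \<eta>"
  shows "integral {0..m} (\<lambda>t. x t * F' t) \<le> \<eta> - (x d2 - x d1) * \<kappa>"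
proof -
  have piece: "\<exists>c\<in>{p..q}. integral {p..q} (\<lambda>t. x t * F' t) = x q * F q - x p * F p - (x q - x p) * F c"
    if "0 \<le> p" "p \<le> q" "q \<le> m" for p q
  proof -
    have "mono_on {p..q} x" using x(1) that by (auto simp: mono_on_def)
    moreover have "(F has_vector_derivative F' t) (at t within {p..q})" if "t \<in> {p..q}" for t
      using that \<open>0 \<le> p\<close> \<open>q \<le> m\<close> by (intro has_vector_derivative_within_subset[OF F]) auto
    ultimately show ?thesis using mono_weight_mean_value[of p q x F F'] that(2) by metis
  qed
  have int: "(\<lambda>t. x t * F' t) integrable_on {0..m}"
    by (rule mono_mult_continuous_integrable[OF x(1) F'])
  have split: "integral {0..m} (\<lambda>t. x t * F' t) = integral {0..d1} (\<lambda>t. x t * F' t)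
      + integral {d1..d2} (\<lambda>t. x t * F' t) + integral {d2..m} (\<lambda>t. x t * F' t)"
  proof -
    have "integral {0..d1} (\<lambda>t. x t * F' t) + integral {d1..m} (\<lambda>t. x t * F' t) = integral {0..m} (\<lambda>t. x t * F' t)"
      using d int by (intro Henstock_Kurzweil_Integration.integral_combine) auto
    moreover have "integral {d1..d2} (\<lambda>t. x t * F' t) + integral {d2..m} (\<lambda>t. x t * F' t) = integral {d1..m} (\<lambda>t. x t * F' t)"
      using d by (intro Henstock_Kurzweil_Integration.integral_combine integrable_subinterval_real[OF int]) auto
    ultimately show ?thesis by simp
  qed
  obtain c1 c2 c3 where c: "c1 \<in> {0..d1}" "c2 \<in> {d1..d2}" "c3 \<in> {d2..m}"
    "integral {0..d1} (\<lambda>t. x t * F' t) = x d1 * F d1 - x 0 * F 0 - (x d1 - x 0) * F c1"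
    "integral {d1..d2} (\<lambda>t. x t * F' t) = x d2 * F d2 - x d1 * F d1 - (x d2 - x d1) * F c2"
    "integral {d2..m} (\<lambda>t. x t * F' t) = x m * F m - x d2 * F d2 - (x m - x d2) * F c3"
    using piece[of 0 d1] piece[of d1 d2] piece[of d2 m] d by auto
  have mono: "x 0 \<le> x d1" "x d1 \<le> x d2" "x d2 \<le> x m" using x(1) d by (auto simp: mono_on_def)
  have "(x d1 - x 0) * F c1 \<ge> (x d1 - x 0) * - \<eta>" "(x d2 - x d1) * F c2 \<ge> (x d2 - x d1) * \<kappa>"
    "(x m - x d2) * F c3 \<ge> (x m - x d2) * - \<eta>"
    using mono c(1-3) lower[of c1] lower[of c3] lower'[of c2] d by (intro mult_left_mono; simp)+
  moreover have "((x d1 - x 0) + (x m - x d2)) * \<eta> \<le> 1 * \<eta>"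
    using x mono \<eta> by (intro mult_right_mono) auto
  ultimately show ?thesis using split c(4-6) ends by (simp add: algebra_simps)
qed

section \<open>Derivatives that may fail on a countable set\<close>

text \<open>If \<open>f b < f a\<close>, some level \<open>y\<close> in between is missed by the
  countable image of \<open>S\<close>. At the last time at which \<open>f\<close> equals
  \<open>y\<close> the derivative is positive, so \<open>f\<close> rises above \<open>y\<close> and
  has to cross it once more on the way down to \<open>f b\<close>.\<close>

lemma increasing_of_deriv_pos_off_countable:
  fixes f :: "real \<Rightarrow> real"
  assumes "countable S" "a < b" and f: "continuous_on {a..b} f"
    and deriv: "\<And>t. t \<in> {a<..<b} - S \<Longrightarrow> \<exists>D>0. (f has_real_derivative D) (at t)"
  shows "f a \<le> f b"
proof (rule ccontr)
  assume "\<not> f a \<le> f b"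
  then have "uncountable {f b<..<f a}" by (simp add: uncountable_open_interval)
  then obtain y where y: "f b < y" "y < f a" "y \<notin> f ` S"
    using \<open>countable S\<close> by (metis countable_image countable_subset greaterThanLessThan_iff subsetI)
  define Z where "Z = {t\<in>{a..b}. f t = y}"
  have "\<exists>t. a \<le> t \<and> t \<le> b \<and> f t = y"
    using IVT2'[of f b y a] y f \<open>a < b\<close> by simp
  then have "Z \<noteq> {}" by (auto simp: Z_def)
  have "closed Z"
    unfolding Z_def using f by (intro continuous_closed_preimage_constant) auto
  moreover have "bdd_above Z" unfolding Z_def by (auto simp: bdd_above_def)
  ultimately have cZ: "Sup Z \<in> Z" using \<open>Z \<noteq> {}\<close> closed_contains_Sup by blast
  define c where "c = Sup Z"
  have c: "a \<le> c" "c \<le> b" "f c = y" using cZ by (auto simp: Z_def c_def)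
  then have "c \<in> {a<..<b} - S" using y by (cases "c = a"; cases "c = b"; auto)
  then obtain D where "D > 0" "(f has_real_derivative D) (at c)" using deriv by blast
  then obtain d where d: "d > 0" "\<And>h. 0 < h \<Longrightarrow> h < d \<Longrightarrow> f c < f (c + h)"
    using DERIV_pos_inc_right by blast
  define h where "h = min (d / 2) ((b - c) / 2)"
  have h: "0 < h" "h < d" "c + h < b" using d \<open>c \<in> {a<..<b} - S\<close> by (auto simp: h_def min_def field_simps)
  have "\<exists>t. c + h \<le> t \<and> t \<le> b \<and> f t = y"
    using IVT2'[of f b y "c + h"] y d(2)[OF h(1,2)] c h continuous_on_subset[OF f, of "{c + h..b}"]
    by auto
  then obtain t where t: "c + h \<le> t" "t \<in> Z" using c h by (auto simp: Z_def)
  then have "t \<le> c" unfolding c_def using \<open>bdd_above Z\<close> by (intro cSup_upper)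
  then show False using t h by simp
qed

lemma constant_of_deriv_zero_off_countable:
  fixes f :: "real \<Rightarrow> real"
  assumes S: "countable S" and "a < b" and f: "continuous_on {a..b} f"
    and deriv: "\<And>t. t \<in> {a<..<b} - S \<Longrightarrow> (f has_real_derivative 0) (at t)"
  shows "f a = f b"
proof -
  have "g a \<le> g b" if g: "continuous_on {a..b} g"
    "\<And>t. t \<in> {a<..<b} - S \<Longrightarrow> (g has_real_derivative 0) (at t)" for g :: "real \<Rightarrow> real"
  proof (rule field_le_epsilon)
    fix e :: real assume "0 < e"
    \<comment> \<open>A tilt of slope \<open>k\<close> makes the derivative positive and costs only
      \<open>e\<close> over the whole interval.\<close>
    define k where "k = e / (b - a)"
    have "0 < k" using \<open>0 < e\<close> \<open>a < b\<close> by (simp add: k_def)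
    have "g a + k * a \<le> g b + k * b"
    proof (rule increasing_of_deriv_pos_off_countable[OF S \<open>a < b\<close>, of "\<lambda>t. g t + k * t"])
      show "continuous_on {a..b} (\<lambda>t. g t + k * t)" by (intro continuous_intros g)
      fix t assume "t \<in> {a<..<b} - S"
      then have "((\<lambda>t. g t + k * t) has_real_derivative k) (at t)"
        by (auto intro!: derivative_eq_intros g(2))
      then show "\<exists>D>0. ((\<lambda>t. g t + k * t) has_real_derivative D) (at t)" using \<open>0 < k\<close> by blast
    qed
    moreover have "k * (b - a) = e" using \<open>a < b\<close> by (simp add: k_def)
    ultimately show "g a \<le> g b + e" by (simp add: algebra_simps)
  qed
  from this[of f] this[of "\<lambda>t. - f t"] show ?thesis
    using f deriv by (force intro!: continuous_intros derivative_eq_intros)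
qed

text \<open>Used for the integration by parts with hat paths, whose derivatives are available only
  where \<open>x\<close> is continuous. Subtracting the indefinite integral leaves a function with
  derivative zero off \<open>S\<close>.\<close>

lemma integral_deriv_off_countable:
  fixes f :: "real \<Rightarrow> real"
  assumes S: "countable S" and ab: "a \<le> b" and f: "continuous_on {a..b} f"
    and deriv: "\<And>t. t \<in> {a<..<b} - S \<Longrightarrow> (f has_real_derivative f' t) (at t)"
    and int: "f' integrable_on {a..b}" and cont: "\<And>t. t \<in> {a<..<b} - S \<Longrightarrow> isCont f' t"
  shows "integral {a..b} f' = f b - f a"
proof (cases "a = b")
  case False
  then have "a < b" using ab by simp
  define g where "g t = f t - integral {a..t} f'" for t
  have "g a = g b"
  proof (rule constant_of_deriv_zero_off_countable[OF S \<open>a < b\<close>])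
    show "continuous_on {a..b} g"
      unfolding g_def by (intro continuous_intros f indefinite_integral_continuous_1 int)
    fix t assume t: "t \<in> {a<..<b} - S"
    have "((\<lambda>u. integral {a..u} f') has_vector_derivative f' t) (at t within ({a..b} - {}))"
      using t cont[OF t] by (intro integral_has_vector_derivative_continuous_at int)
        (auto simp: continuous_at_imp_continuous_at_within)
    moreover have "at t within {a..b} = at t" using t by (intro at_within_interior) auto
    ultimately show "(g has_real_derivative 0) (at t)"
      unfolding g_def using deriv[OF t]
      by (auto intro!: derivative_eq_intros simp: has_real_derivative_iff_has_vector_derivative)
  qed
  then show ?thesis by (simp add: g_def)
qed simp

lemma integral_mono_weight_deriv:
  fixes g :: "real \<Rightarrow> 'a::euclidean_space"
  assumes x: "mono_on {a..b} x" and g: "continuous_on {a..b} g"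
    and t: "t \<in> {a<..<b}" and cont: "continuous (at t within {a..b}) x"
  shows "((\<lambda>s. integral {s..b} (\<lambda>r. x r *\<^sub>R g r)) has_vector_derivative - (x t *\<^sub>R g t)) (at t)"
proof -
  have int: "(\<lambda>r. x r *\<^sub>R g r) integrable_on {a..b}"
    by (rule mono_scaleR_continuous_integrable[OF x g])
  have "((\<lambda>s. integral {a..s} (\<lambda>r. x r *\<^sub>R g r)) has_vector_derivative x t *\<^sub>R g t) (at t within ({a..b} - {}))"
    using t g cont by (intro integral_has_vector_derivative_continuous_at[OF int])
      (auto simp: continuous_on_eq_continuous_within intro!: continuous_intros)
  moreover have "at t within {a..b} = at t" using t by (intro at_within_interior) auto
  ultimately have "((\<lambda>s. integral {a..b} (\<lambda>r. x r *\<^sub>R g r) - integral {a..s} (\<lambda>r. x r *\<^sub>R g r))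
      has_vector_derivative - (x t *\<^sub>R g t)) (at t)"
    by (auto intro!: derivative_eq_intros)
  then show ?thesis
  proof (rule has_vector_derivative_transform_within_open[of _ _ _ "{a<..<b}"])
    fix s assume s: "s \<in> {a<..<b}"
    have "integral {a..s} (\<lambda>r. x r *\<^sub>R g r) + integral {s..b} (\<lambda>r. x r *\<^sub>R g r) = integral {a..b} (\<lambda>r. x r *\<^sub>R g r)"
      using s int by (intro Henstock_Kurzweil_Integration.integral_combine) auto
    then show "integral {a..b} (\<lambda>r. x r *\<^sub>R g r) - integral {a..s} (\<lambda>r. x r *\<^sub>R g r) = integral {s..b} (\<lambda>r. x r *\<^sub>R g r)"
      by (simp add: algebra_simps)
  qed (use t in auto)
qed

lemma integral_mono_weight_continuous:
  fixes g :: "real \<Rightarrow> 'a::euclidean_space"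
  assumes x: "mono_on {a..b} x" and g: "continuous_on {a..b} g"
  shows "continuous_on {a..b} (\<lambda>s. integral {s..b} (\<lambda>r. x r *\<^sub>R g r))"
  by (intro indefinite_integral_continuous_1' mono_scaleR_continuous_integrable[OF x g])

text \<open>The integrand will contain the weight \<open>x\<close> and may jump, so this rests on
  the change of variables for absolutely integrable functions; positivity of \<open>g'\<close>
  removes the modulus of the Jacobian.\<close>

lemma integral_substitution_increasing:
  fixes f :: "real \<Rightarrow> 'a::euclidean_space"
  assumes f: "f absolutely_integrable_on {g a..g b}"
    and g: "\<And>t. t \<in> {a..b} \<Longrightarrow> (g has_real_derivative g' t) (at t)"
    and pos: "\<And>t. t \<in> {a..b} \<Longrightarrow> 0 < g' t" and ab: "a \<le> b"
  shows "integral {a..b} (\<lambda>t. g' t *\<^sub>R f (g t)) = integral {g a..g b} f"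
proof -
  have mono: "g u < g v" if "a \<le> u" "u < v" "v \<le> b" for u v
  proof (rule DERIV_pos_imp_increasing[OF that(2)])
    fix t assume "u \<le> t" "t \<le> v"
    then have "t \<in> {a..b}" using that by simp
    then show "\<exists>D. (g has_real_derivative D) (at t) \<and> 0 < D" using g pos by blast
  qed
  have cont: "continuous_on {a..b} g"
    using g by (meson DERIV_continuous_on has_field_derivative_at_within)
  have img: "g ` {a..b} = {g a..g b}"
  proof
    have "g u \<le> g v" if "a \<le> u" "u \<le> v" "v \<le> b" for u v
      using mono[of u v] that by (cases "u = v") auto
    then show "g ` {a..b} \<subseteq> {g a..g b}" by auto
    show "{g a..g b} \<subseteq> g ` {a..b}" using IVT'[of g a _ b] cont ab by fastforce
  qed
  have "inj_on g {a..b}"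
    by (rule linorder_inj_onI) (metis atLeastAtMost_iff less_irrefl mono, auto)
  then have "(\<lambda>t. \<bar>g' t\<bar> *\<^sub>R f (g t)) absolutely_integrable_on {a..b} \<and>
      integral {a..b} (\<lambda>t. \<bar>g' t\<bar> *\<^sub>R f (g t)) = integral {g a..g b} f"
    using has_absolute_integral_change_of_variables_real[of "{a..b}" g g' f "integral {g a..g b} f"]
      f g img by (auto intro: has_field_derivative_at_within)
  moreover have "integral {a..b} (\<lambda>t. \<bar>g' t\<bar> *\<^sub>R f (g t)) = integral {a..b} (\<lambda>t. g' t *\<^sub>R f (g t))"
  proof (rule integral_cong)
    fix t assume "t \<in> {a..b}"
    then show "\<bar>g' t\<bar> *\<^sub>R f (g t) = g' t *\<^sub>R f (g t)" using pos[of t] by simp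
  qed
  ultimately show ?thesis by simp
qed

text \<open>Differentiation under the integral sign where the integrand is jointly continuous only up
  to a bounded weight, which the library version does not allow.\<close>

lemma weighted_leibniz_rule:
  fixes a a' :: "real \<Rightarrow> real \<Rightarrow> real" and w :: "real \<Rightarrow> real"
  assumes e0: "0 < e0" and c: "0 \<le> c"
    and d: "\<And>e t. e \<in> {0..e0} \<Longrightarrow> t \<in> {0..c} \<Longrightarrow>
       ((\<lambda>e. a e t) has_real_derivative a' e t) (at e within {0..e0})"
    and cont: "continuous_on ({0..e0} \<times> {0..c}) (\<lambda>(e,t). a' e t)"
    and w: "\<And>t. t \<in> {0..c} \<Longrightarrow> \<bar>w t\<bar> \<le> 1"
    and int: "\<And>e. e \<in> {0..e0} \<Longrightarrow> (\<lambda>t. w t * a e t) integrable_on {0..c}"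
    and int': "(\<lambda>t. w t * a' 0 t) integrable_on {0..c}"
  shows "((\<lambda>e. integral {0..c} (\<lambda>t. w t * a e t)) has_real_derivative
      integral {0..c} (\<lambda>t. w t * a' 0 t)) (at 0 within {0..e0})"
  unfolding has_real_derivative_iff_has_vector_derivative has_vector_derivative_iff_slope
proof (rule tendstoI)
  define I where "I e = integral {0..c} (\<lambda>t. w t * a e t)" for e
  define D where "D = integral {0..c} (\<lambda>t. w t * a' 0 t)"
  fix \<eta> :: real assume "0 < \<eta>"
  \<comment> \<open>The pointwise error is integrated over length \<open>c\<close>;
    \<open>c + 1\<close> also covers \<open>c = 0\<close>.\<close>
  define \<eta>' where "\<eta>' = \<eta> / (c + 1)"
  have "0 < \<eta>'" using \<open>0 < \<eta>\<close> c by (simp add: \<eta>'_def)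
  have "uniformly_continuous_on ({0..e0} \<times> {0..c}) (\<lambda>(e,t). a' e t)"
    using cont by (intro compact_uniformly_continuous compact_Times) auto
  then obtain \<delta> where "0 < \<delta>" and \<delta>: "\<And>p q. p \<in> {0..e0} \<times> {0..c} \<Longrightarrow> q \<in> {0..e0} \<times> {0..c} \<Longrightarrow>
      dist q p < \<delta> \<Longrightarrow> dist ((\<lambda>(e,t). a' e t) q) ((\<lambda>(e,t). a' e t) p) < \<eta>'"
    using \<open>0 < \<eta>'\<close> unfolding uniformly_continuous_on_def by metis
  have close: "\<bar>a' e t - a' 0 t\<bar> < \<eta>'" if "e \<in> {0..e0}" "t \<in> {0..c}" "e < \<delta>" for e t
    using \<delta>[of "(0,t)" "(e,t)"] that e0 by (simp add: dist_Pair_Pair dist_real_def)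
  have est: "\<bar>I e - I 0 - e * D\<bar> \<le> \<eta>' * e * c" if e: "e \<in> {0..e0}" "e < \<delta>" "0 < e" for e
  proof -
    have "\<bar>a e t - a 0 t - e * a' 0 t\<bar> \<le> \<eta>' * e" if t: "t \<in> {0..c}" for t
    proof -
      \<comment> \<open>The intermediate \<open>z\<close> depends on \<open>t\<close>, but
        \<open>close\<close> bounds \<open>a' z t - a' 0 t\<close> uniformly in
        \<open>t\<close>.\<close>
      have "\<exists>z\<in>{0<..<e}. a e t - a 0 t = (\<lambda>h. a' z t * h) (e - 0)"
      proof (rule mvt_simple[OF e(3), of "\<lambda>e. a e t" "\<lambda>z h. a' z t * h"])
        fix z assume "0 \<le> z" "z \<le> e"
        then have "((\<lambda>e. a e t) has_real_derivative a' z t) (at z within {0..e})"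
          using e by (intro DERIV_subset[OF d[OF _ t]]) auto
        then show "((\<lambda>e. a e t) has_derivative (\<lambda>h. a' z t * h)) (at z within {0..e})"
          by (simp add: has_field_derivative_def)
      qed
      then obtain z where z: "0 < z" "z < e" "a e t - a 0 t = a' z t * e" by auto
      then have "a e t - a 0 t - e * a' 0 t = (a' z t - a' 0 t) * e"
        by (simp add: algebra_simps)
      then have "\<bar>a e t - a 0 t - e * a' 0 t\<bar> = \<bar>a' z t - a' 0 t\<bar> * e"
        using e by (simp add: abs_mult)
      also have "\<dots> \<le> \<eta>' * e"
        using close[of z t] z e t by (intro mult_right_mono) auto
      finally show ?thesis .
    qed
    then have bd: "\<bar>w t * (a e t - a 0 t - e * a' 0 t)\<bar> \<le> \<eta>' * e" if "t \<in> {0..c}" for t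
      using w[OF that] that mult_mono[of "\<bar>w t\<bar>" 1] by (force simp: abs_mult)
    have eq: "((\<lambda>t. w t * (a e t - a 0 t - e * a' 0 t)) has_integral I e - I 0 - e * D) {0..c}"
      unfolding I_def D_def right_diff_distrib
      using has_integral_mult_right[OF integrable_integral[OF int'], of e] e e0
      by (intro has_integral_diff integrable_integral int) (auto simp: algebra_simps)
    have "norm (I e - I 0 - e * D) \<le> \<eta>' * e * measure lborel (cbox 0 c)"
      using eq bd e \<open>0 < \<eta>'\<close> by (intro has_integral_bound[where f="\<lambda>t. w t * (a e t - a 0 t - e * a' 0 t)"]) auto
    then show ?thesis using c by simp
  qed
  have "\<forall>\<^sub>F e in at 0 within {0..e0}. e \<in> {0..e0} \<and> e < \<delta> \<and> 0 < e"
    unfolding eventually_at using \<open>0 < \<delta>\<close> by (intro exI[of _ \<delta>]) (auto simp: dist_real_def)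
  then show "\<forall>\<^sub>F e in at 0 within {0..e0}. dist ((1 / (e - 0)) *\<^sub>R
      (integral {0..c} (\<lambda>t. w t * a e t) - integral {0..c} (\<lambda>t. w t * a 0 t)))
      (integral {0..c} (\<lambda>t. w t * a' 0 t)) < \<eta>"
  proof eventually_elim
    case (elim e)
    have "dist ((1 / (e - 0)) *\<^sub>R (I e - I 0)) D = \<bar>I e - I 0 - e * D\<bar> / e"
    proof -
      have "(1 / (e - 0)) *\<^sub>R (I e - I 0) - D = (I e - I 0 - e * D) / e"
        using elim by (simp add: diff_divide_distrib)
      then show ?thesis using elim by (simp add: dist_real_def abs_divide)
    qed
    also have "\<dots> \<le> \<eta>' * c"
      using est[of e] elim by (simp add: pos_divide_le_eq mult.commute mult.left_commute)
    also have "\<dots> < \<eta>" using c \<open>0 < \<eta>\<close> by (simp add: \<eta>'_def field_simps)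
    finally show ?case by (simp add: I_def D_def)
  qed
qed

subsection \<open>The mixture as a power series\<close>

text \<open>The entry \<open>(i,j)\<close> of the mixture is a power series in \<open>A$i$j\<close>
  with these coefficients. Zeros below index 2 let the series start at 0, so that
  \<open>diffs\<close> differentiates it termwise.\<close>

definition mix_coeff :: "(nat \<Rightarrow> real^'n) \<Rightarrow> 'n \<Rightarrow> 'n \<Rightarrow> nat \<Rightarrow> real" where
  "mix_coeff \<beta> i j n = (if 2 \<le> n then \<beta> n $ i * \<beta> n $ j else 0)"

definition dxi :: "(nat \<Rightarrow> real^'n) \<Rightarrow> 'n \<Rightarrow> 'n \<Rightarrow> real \<Rightarrow> real" where
  "dxi \<beta> i j a = (\<Sum>n. diffs (mix_coeff \<beta> i j) n * a ^ n)"

definition ddxi :: "(nat \<Rightarrow> real^'n) \<Rightarrow> 'n \<Rightarrow> 'n \<Rightarrow> real \<Rightarrow> real" where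
  "ddxi \<beta> i j a = (\<Sum>n. diffs (diffs (mix_coeff \<beta> i j)) n * a ^ n)"

text \<open>The hypothesis controls squares of single components; a mixed product is at most the sum
  of two squares. This gives radius of convergence at least 2, a margin beyond the entries in
  \<open>[-1,1]\<close>.\<close>

lemma mix_coeff_summable:
  assumes "mixture \<beta>"
  shows "summable (\<lambda>n. mix_coeff \<beta> i j n * 2 ^ n)"
proof -
  define b where "b k n = (if 2 \<le> n then 2 ^ n * (\<beta> n $ k)\<^sup>2 else 0)" for k n
  have b: "summable (b k)" for k
  proof -
    have "(\<lambda>n. 2 ^ n * (\<beta> n $ k)\<^sup>2) summable_on {2..}" using assms by (simp add: mixture_def)
    then have "b k summable_on UNIV"
      by (rule summable_on_cong_neutral[THEN iffD1, rotated -1]) (auto simp: b_def)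
    then show ?thesis by (rule summable_on_imp_summable)
  qed
  show ?thesis
  proof (rule summable_comparison_test')
    show "summable (\<lambda>n. b i n + b j n)" by (intro summable_add b)
    fix n :: nat
    have "\<bar>\<beta> n $ i * \<beta> n $ j\<bar> \<le> (\<beta> n $ i)\<^sup>2 + (\<beta> n $ j)\<^sup>2"
    proof -
      have "0 \<le> (\<bar>\<beta> n $ i\<bar> - \<bar>\<beta> n $ j\<bar>)\<^sup>2" by simp
      then have "2 * \<bar>\<beta> n $ i * \<beta> n $ j\<bar> \<le> (\<beta> n $ i)\<^sup>2 + (\<beta> n $ j)\<^sup>2"
        by (simp add: power2_diff abs_mult)
      then show ?thesis by linarith
    qed
    then have "\<bar>\<beta> n $ i * \<beta> n $ j\<bar> * 2 ^ n \<le> ((\<beta> n $ i)\<^sup>2 + (\<beta> n $ j)\<^sup>2) * 2 ^ n"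
      by (rule mult_right_mono) simp
    then show "norm (mix_coeff \<beta> i j n * 2 ^ n) \<le> b i n + b j n"
      by (simp add: mix_coeff_def b_def abs_mult algebra_simps)
  qed
qed

lemma mix_powser_summable:
  assumes "mixture \<beta>" "\<bar>a\<bar> < 2"
  shows "summable (\<lambda>n. mix_coeff \<beta> i j n * a ^ n)"
    and "summable (\<lambda>n. diffs (mix_coeff \<beta> i j) n * a ^ n)"
    and "summable (\<lambda>n. diffs (diffs (mix_coeff \<beta> i j)) n * a ^ n)"
proof -
  have 0: "summable (\<lambda>n. mix_coeff \<beta> i j n * a ^ n)" if "norm a < 2" for a
    using powser_inside[OF mix_coeff_summable[OF assms(1)], of a] that by simp
  have 1: "summable (\<lambda>n. diffs (mix_coeff \<beta> i j) n * a ^ n)" if "norm a < 2" for a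
    using that 0 by (rule termdiff_converges)
  have 2: "summable (\<lambda>n. diffs (diffs (mix_coeff \<beta> i j)) n * a ^ n)" if "norm a < 2" for a
    using that 1 by (rule termdiff_converges)
  show "summable (\<lambda>n. mix_coeff \<beta> i j n * a ^ n)"
    "summable (\<lambda>n. diffs (mix_coeff \<beta> i j) n * a ^ n)"
    "summable (\<lambda>n. diffs (diffs (mix_coeff \<beta> i j)) n * a ^ n)"
    using assms(2) by (auto intro: 0 1 2)
qed

lemma has_field_derivative_dxi:
  assumes "mixture \<beta>" "\<bar>a\<bar> < 2"
  shows "(dxi \<beta> i j has_real_derivative ddxi \<beta> i j a) (at a)"
  unfolding dxi_def[abs_def] ddxi_def
  by (rule termdiffs_strong'[where K = 2]) (use assms mix_powser_summable in auto)

lemma isCont_ddxi: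
  assumes "mixture \<beta>" "\<bar>a\<bar> < 2"
  shows "isCont (ddxi \<beta> i j) a"
proof -
  have "(ddxi \<beta> i j has_real_derivative (\<Sum>n. diffs (diffs (diffs (mix_coeff \<beta> i j))) n * a ^ n)) (at a)"
    unfolding ddxi_def[abs_def]
    by (rule termdiffs_strong'[where K = 2]) (use assms mix_powser_summable in auto)
  then show ?thesis by (rule DERIV_isCont)
qed

text \<open>The sums over \<open>p\<close> in \<open>xi'\<close> and \<open>xi''\<close> are
  unordered, whereas \<open>diffs\<close> produces ordered series. Absolute convergence identifies
  them; it comes from convergence at the midpoint of \<open>\<bar>a\<bar>\<close> and 2.\<close>

lemma powser_has_sum:
  fixes c :: "nat \<Rightarrow> real"
  assumes "\<And>a. \<bar>a\<bar> < 2 \<Longrightarrow> summable (\<lambda>n. c n * a ^ n)" "\<bar>a\<bar> < 2"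
  shows "((\<lambda>n. c n * a ^ n) has_sum (\<Sum>n. c n * a ^ n)) UNIV"
proof (rule norm_summable_imp_has_sum)
  have "summable (\<lambda>n. c n * ((\<bar>a\<bar> + 2) / 2) ^ n)" using assms by (intro assms(1)) (auto simp: abs_if)
  then show "summable (\<lambda>n. norm (c n * a ^ n))"
    by (rule powser_insidea) (use assms(2) in auto)
  show "(\<lambda>n. c n * a ^ n) sums (\<Sum>n. c n * a ^ n)"
    using assms by (intro summable_sums) auto
qed

lemma xi'_entry:
  assumes "mixture \<beta>" "\<bar>A$i$j\<bar> < 2"
  shows "xi' \<beta> A $ i $ j = dxi \<beta> i j (A$i$j)"
proof -
  define g where "g p = real p * mix_coeff \<beta> i j p * (A$i$j) ^ (p - 1)" for p
  have "((\<lambda>n. diffs (mix_coeff \<beta> i j) n * (A$i$j) ^ n) has_sum dxi \<beta> i j (A$i$j)) UNIV"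
    unfolding dxi_def using assms mix_powser_summable by (intro powser_has_sum) auto
  also have "(\<lambda>n. diffs (mix_coeff \<beta> i j) n * (A$i$j) ^ n) = g \<circ> Suc"
    by (simp add: g_def diffs_def fun_eq_iff)
  finally have "(g has_sum dxi \<beta> i j (A$i$j)) (range Suc)"
    by (subst has_sum_reindex) (auto simp: comp_def)
  also have "?this \<longleftrightarrow> ((\<lambda>p. real p * outer (\<beta> p) (\<beta> p) $ i $ j * hadamard_power A (p - 1) $ i $ j)
      has_sum dxi \<beta> i j (A$i$j)) {2..}"
  \<comment> \<open>The index sets differ only in \<open>p = 1\<close>, where the coefficient is
    zero.\<close>
  proof (rule has_sum_cong_neutral)
    show "g p = 0" if "p \<in> range Suc - {2..}" for p
      using that by (simp add: g_def mix_coeff_def)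
    show "real p * outer (\<beta> p) (\<beta> p) $ i $ j * hadamard_power A (p - 1) $ i $ j = 0"
      if "p \<in> {2..} - range Suc" for p
      using that by (cases p) auto
  qed (auto simp: g_def mix_coeff_def outer_def hadamard_power_def)
  finally show ?thesis by (simp add: xi'_def infsumI)
qed

lemma xi''_entry:
  assumes "mixture \<beta>" "\<bar>A$i$j\<bar> < 2"
  shows "xi'' \<beta> A $ i $ j = ddxi \<beta> i j (A$i$j)"
proof -
  define g where "g p = real p * real (p - 1) * mix_coeff \<beta> i j p * (A$i$j) ^ (p - 2)" for p
  have "((\<lambda>n. diffs (diffs (mix_coeff \<beta> i j)) n * (A$i$j) ^ n) has_sum ddxi \<beta> i j (A$i$j)) UNIV"
    unfolding ddxi_def using assms mix_powser_summable by (intro powser_has_sum) auto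
  also have "(\<lambda>n. diffs (diffs (mix_coeff \<beta> i j)) n * (A$i$j) ^ n) = g \<circ> (\<lambda>n. n + 2)"
    by (simp add: g_def diffs_def fun_eq_iff)
  finally have "(g has_sum ddxi \<beta> i j (A$i$j)) (range (\<lambda>n. n + 2))"
    by (subst has_sum_reindex) (auto simp: inj_on_def comp_def)
  also have "range (\<lambda>n. n + 2) = {2::nat..}"
    by (auto simp: image_iff) (metis le_add_diff_inverse2 add_2_eq_Suc')
  also have "(g has_sum ddxi \<beta> i j (A$i$j)) {2..} \<longleftrightarrow>
      ((\<lambda>p. real p * real (p - 1) * outer (\<beta> p) (\<beta> p) $ i $ j * hadamard_power A (p - 2) $ i $ j)
      has_sum ddxi \<beta> i j (A$i$j)) {2..}"
    by (rule has_sum_cong) (simp add: g_def mix_coeff_def outer_def hadamard_power_def)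
  finally show ?thesis by (simp add: xi''_def infsumI)
qed

text \<open>Written as a series of Hadamard products with \<open>n = p - 2\<close>, so that Schur's
  theorem applies to every term.\<close>

lemma xi''_inner_eq_suminf:
  fixes \<beta> :: "nat \<Rightarrow> real^'n"
  assumes "mixture \<beta>" "\<And>i j. \<bar>A$i$j\<bar> < 2"
  shows "(\<lambda>n. (real (n + 1) * real (n + 2)) *
      (hadamard (outer (\<beta> (n + 2)) (\<beta> (n + 2))) (hadamard_power A n) \<bullet> W)) sums (xi'' \<beta> A \<bullet> W)"
proof -
  have "(\<lambda>n. \<Sum>i\<in>UNIV. \<Sum>j\<in>UNIV. diffs (diffs (mix_coeff \<beta> i j)) n * (A$i$j) ^ n * W$i$j) sums
      (\<Sum>i\<in>UNIV. \<Sum>j\<in>UNIV. ddxi \<beta> i j (A$i$j) * W$i$j)"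
    unfolding ddxi_def
    by (intro sums_sum sums_mult2 summable_sums mix_powser_summable assms)
  moreover have "(\<Sum>i\<in>UNIV. \<Sum>j\<in>UNIV. diffs (diffs (mix_coeff \<beta> i j)) n * (A$i$j) ^ n * W$i$j) =
      (real (n + 1) * real (n + 2)) *
      (hadamard (outer (\<beta> (n + 2)) (\<beta> (n + 2))) (hadamard_power A n) \<bullet> W)" for n
    by (simp add: inner_matrix_entries hadamard_def outer_def hadamard_power_def diffs_def mix_coeff_def
        sum_distrib_left mult_ac)
  ultimately show ?thesis
    using assms by (simp add: inner_matrix_entries xi''_entry)
qed

text \<open>Termwise comparison: the Hadamard powers are monotone, the rank-one factor of
  \<open>\<beta>\<close> preserves the order by Schur's theorem, and pairing with the positive
  \<open>W\<close> does so by self-duality.\<close>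

lemma xi''_inner_mono:
  fixes \<beta> :: "nat \<Rightarrow> real^'n"
  assumes \<beta>: "mixture \<beta>" and A: "psd A" "psd (Q - A)" and Q: "psd Q" "\<And>i. Q$i$i = 1" and W: "psd W"
  shows "xi'' \<beta> A \<bullet> W \<le> xi'' \<beta> Q \<bullet> W"
proof (rule sums_le)
  have "\<bar>A$i$j\<bar> \<le> 1" "\<bar>Q$i$j\<bar> \<le> 1" for i j
    using psd_le_diag_one[of A Q] psd_le_diag_one[of Q Q] assms by auto
  then have bds: "\<bar>A$i$j\<bar> < 2" "\<bar>Q$i$j\<bar> < 2" for i j
    by (meson le_less_trans one_less_numeral_iff semiring_norm(76))+
  show "(\<lambda>n. (real (n + 1) * real (n + 2)) *
      (hadamard (outer (\<beta> (n + 2)) (\<beta> (n + 2))) (hadamard_power A n) \<bullet> W)) sums (xi'' \<beta> A \<bullet> W)"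
    and "(\<lambda>n. (real (n + 1) * real (n + 2)) *
      (hadamard (outer (\<beta> (n + 2)) (\<beta> (n + 2))) (hadamard_power Q n) \<bullet> W)) sums (xi'' \<beta> Q \<bullet> W)"
    using bds by (auto intro!: xi''_inner_eq_suminf[OF \<beta>, simplified])
  fix n
  have "0 \<le> hadamard (outer (\<beta> (n + 2)) (\<beta> (n + 2))) (hadamard_power Q n - hadamard_power A n) \<bullet> W"
    by (intro psd_inner_nonneg psd_hadamard psd_outer psd_hadamard_power_mono A Q W)
  also have "\<dots> = hadamard (outer (\<beta> (n + 2)) (\<beta> (n + 2))) (hadamard_power Q n) \<bullet> W
      - hadamard (outer (\<beta> (n + 2)) (\<beta> (n + 2))) (hadamard_power A n) \<bullet> W"
  proof -
    have "hadamard B (C - D) = hadamard B C - hadamard B D" for B C D :: "real^'n^'n"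
      by (simp add: hadamard_def vec_eq_iff algebra_simps)
    then show ?thesis by (simp add: inner_diff_left)
  qed
  finally show "(real (n + 1) * real (n + 2)) *
      (hadamard (outer (\<beta> (n + 2)) (\<beta> (n + 2))) (hadamard_power A n) \<bullet> W) \<le>
      (real (n + 1) * real (n + 2)) *
      (hadamard (outer (\<beta> (n + 2)) (\<beta> (n + 2))) (hadamard_power Q n) \<bullet> W)"
    by (intro mult_left_mono) auto
qed

subsection \<open>Order parameters and their support\<close>

lemma order_param_range: "order_param m x \<Longrightarrow> t \<in> {0..m} \<Longrightarrow> 0 \<le> x t \<and> x t \<le> 1"
  by (auto simp: order_param_def)

lemma order_param_mono: "order_param m x \<Longrightarrow> 0 \<le> s \<Longrightarrow> s \<le> t \<Longrightarrow> t \<le> m \<Longrightarrow> x s \<le> x t"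
  by (auto simp: order_param_def mono_on_def)

lemma param_cdf_mono:
  assumes "0 < m" "order_param m x" "a \<le> b"
  shows "param_cdf m x a \<le> param_cdf m x b"
  using assms order_param_mono[of m x "min a m" "min b m"] order_param_range[of m x "min b m"]
  by (auto simp: param_cdf_def)

lemma param_cdf_right_continuous:
  assumes m: "0 < m" and x: "order_param m x"
  shows "continuous (at_right a) (param_cdf m x)"
proof -
  consider "a < 0" | "a \<in> {0..<m}" | "m \<le> a" by fastforce
  then show ?thesis
  proof cases
    case 1
    have "\<forall>\<^sub>F t in at_right a. param_cdf m x t = 0"
      using 1 unfolding eventually_at_right_field
      by (intro exI[of _ 0]) (auto simp: param_cdf_def)
    then show ?thesis
      using 1 by (auto simp: continuous_within param_cdf_def[of _ _ a] intro: tendsto_eventually)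
  next
    case 2
    have "\<forall>\<^sub>F t in at_right a. param_cdf m x t = x t"
      using 2 unfolding eventually_at_right_field
      by (intro exI[of _ m]) (auto simp: param_cdf_def min_def)
    moreover have "(x \<longlongrightarrow> x a) (at_right a)"
      using 2 x by (auto simp: order_param_def continuous_within)
    moreover have "param_cdf m x a = x a" using 2 by (auto simp: param_cdf_def)
    ultimately show ?thesis
      by (simp add: continuous_within tendsto_cong)
  next
    case 3
    have "\<forall>\<^sub>F t in at_right a. param_cdf m x t = x m"
      using 3 m unfolding eventually_at_right_field
      by (intro exI[of _ "a + 1"]) (auto simp: param_cdf_def)
    moreover have "param_cdf m x a = x m" using 3 m by (auto simp: param_cdf_def)
    ultimately show ?thesis
      by (auto simp: continuous_within intro: tendsto_eventually)
  qed
qed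

lemma emeasure_parisi_Ioc:
  assumes "0 < m" "order_param m x" "a \<le> b"
  shows "emeasure (parisi_measure m x) {a<..b} = ennreal (param_cdf m x b - param_cdf m x a)"
  unfolding parisi_measure_def
  by (rule emeasure_interval_measure_Ioc[OF assms(3) param_cdf_mono[OF assms(1,2)]
        param_cdf_right_continuous[OF assms(1,2)]])

text \<open>In terms of increments of the distribution function the support can be followed through
  a change of time by mere composition.\<close>

lemma supp_parisi_iff:
  assumes "0 < m" "order_param m x"
  shows "t \<in> supp (parisi_measure m x) \<longleftrightarrow> (\<forall>a b. a < t \<and> t < b \<longrightarrow> param_cdf m x a < param_cdf m x b)"
proof (intro iffI allI impI)
  fix a b assume t: "t \<in> supp (parisi_measure m x)" "a < t \<and> t < b"
  then have "0 < emeasure (parisi_measure m x) {a<..<b}" by (auto simp: supp_def)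
  also have "\<dots> \<le> emeasure (parisi_measure m x) {a<..b}"
    by (intro emeasure_mono) (auto simp: parisi_measure_def)
  finally show "param_cdf m x a < param_cdf m x b"
    using t assms by (simp add: emeasure_parisi_Ioc)
next
  assume *: "\<forall>a b. a < t \<and> t < b \<longrightarrow> param_cdf m x a < param_cdf m x b"
  have "0 < emeasure (parisi_measure m x) U" if U: "open U" "t \<in> U" for U
  proof -
    obtain e where e: "0 < e" "ball t e \<subseteq> U" using U openE by blast
    have "param_cdf m x (t - e / 2) < param_cdf m x (t + e / 2)" using * e by simp
    then have "0 < emeasure (parisi_measure m x) {t - e / 2<..t + e / 2}"
      using assms e by (simp add: emeasure_parisi_Ioc)
    also have "\<dots> \<le> emeasure (parisi_measure m x) U"
      using e U by (intro emeasure_mono) (auto simp: parisi_measure_def ball_def dist_real_def subset_iff)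
    finally show ?thesis .
  qed
  then show "t \<in> supp (parisi_measure m x)" by (simp add: supp_def)
qed

lemma supp_parisi_subset:
  assumes "0 < m" "order_param m x" "t \<in> supp (parisi_measure m x)"
  shows "t \<in> {0..m}"
proof (rule ccontr)
  have *: "param_cdf m x a < param_cdf m x b" if "a < t" "t < b" for a b
    using assms that by (auto simp: supp_parisi_iff)
  assume "t \<notin> {0..m}"
  then consider "t < 0" | "m < t" by fastforce
  then show False
  proof cases
    case 1
    then show False using *[of "t - 1" "t / 2"] by (simp add: param_cdf_def)
  next
    case 2
    then show False using *[of "(m + t) / 2" "t + 1"] assms(1) by (simp add: param_cdf_def)
  qed
qed

text \<open>Right continuity of \<open>x\<close> puts the infimum into the set.\<close>

lemma order_param_t_top:
  assumes m: "0 < m" and x: "order_param m x"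
  shows "t_top m x \<in> {0..m}" and "x (t_top m x) = 1"
    and "\<And>t. t \<in> {0..m} \<Longrightarrow> x t = 1 \<longleftrightarrow> t_top m x \<le> t"
proof -
  define Z where "Z = {t\<in>{0..m}. x t = 1}"
  have t_top: "t_top m x = Inf Z" by (simp add: t_top_def Z_def)
  have Z: "m \<in> Z" "bdd_below Z" using m x by (auto simp: Z_def order_param_def bdd_below_def)
  show T: "t_top m x \<in> {0..m}"
    unfolding t_top using Z by (auto intro!: cInf_lower cInf_greatest simp: Z_def)
  have up: "x s = 1" if s: "t \<in> Z" "t \<le> s" "s \<le> m" for s t
    using order_param_mono[OF x, of t s] order_param_range[OF x, of s] s by (auto simp: Z_def)
  have above: "x s = 1" if s: "t_top m x < s" "s \<le> m" for s
  proof -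
    obtain t where "t \<in> Z" "t < s" using cInf_lessD[of Z s] s Z by (auto simp: t_top)
    then show ?thesis using up s by force
  qed
  show one: "x (t_top m x) = 1"
  proof (cases "t_top m x = m")
    case True then show ?thesis using x by (simp add: order_param_def)
  next
    case False
    then have lt: "t_top m x < m" using T by simp
    then have "(x \<longlongrightarrow> x (t_top m x)) (at_right (t_top m x))"
      using x T by (auto simp: order_param_def continuous_within)
    moreover have "(x \<longlongrightarrow> 1) (at_right (t_top m x))"
      by (rule tendsto_eventually, unfold eventually_at_right_field) (use lt above in \<open>auto intro!: exI[of _ m]\<close>)
    ultimately show ?thesis using tendsto_unique[of "at_right (t_top m x)"] by force
  qed
  fix t assume t: "t \<in> {0..m}"
  show "x t = 1 \<longleftrightarrow> t_top m x \<le> t"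
  proof
    assume "x t = 1"
    then have "t \<in> Z" using t by (simp add: Z_def)
    then show "t_top m x \<le> t" unfolding t_top using Z(2) by (rule cInf_lower)
  next
    assume "t_top m x \<le> t"
    then show "x t = 1" using above[of t] one t by (cases "t = t_top m x") auto
  qed
qed

lemma supp_parisi_le_t_top:
  assumes m: "0 < m" and x: "order_param m x" and t: "t \<in> supp (parisi_measure m x)"
  shows "t \<le> t_top m x"
proof (rule ccontr)
  assume lt: "\<not> t \<le> t_top m x"
  have "param_cdf m x s = 1" if "t_top m x \<le> s" for s
    using order_param_t_top[OF m x] that m by (auto simp: param_cdf_def)
  moreover have "param_cdf m x (t_top m x) < param_cdf m x (t + 1)"
    using t lt supp_parisi_iff[OF m x, of t] by simp
  ultimately show False using lt by simp
qed

text \<open>If \<open>x\<close> does not increase just to the right of \<open>u\<close>, right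
  continuity makes the distribution function constant from \<open>u\<close> to some later point. The
  increase forced by membership in the support then lies to the left, and left continuity, which is
  the absence of an atom, moves it strictly below \<open>u\<close>. The interval from
  \<open>d1\<close> to \<open>d2\<close> avoids \<open>u\<close>, which leaves room for a bump
  between.\<close>

lemma supp_parisi_no_atom:
  assumes m: "0 < m" and x: "order_param m x" and u: "u \<in> supp (parisi_measure m x)"
    and no_atom: "measure (parisi_measure m x) {u} = 0"
  obtains (right) "u < m" "\<And>s. u < s \<Longrightarrow> s \<le> m \<Longrightarrow> \<exists>d1 d2. u < d1 \<and> d1 < d2 \<and> d2 < s \<and> x d1 < x d2"
    | (left) "0 < u" "\<And>s. 0 \<le> s \<Longrightarrow> s < u \<Longrightarrow> \<exists>d1 d2. s < d1 \<and> d1 < d2 \<and> d2 < u \<and> x d1 < x d2"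
proof -
  let ?F = "param_cdf m x"
  have u01: "u \<in> {0..m}" by (rule supp_parisi_subset[OF m x u])
  have Fx: "?F t = x t" if "t \<in> {0..m}" for t using that by (simp add: param_cdf_def)
  have "finite_borel_measure (parisi_measure m x)"
  proof -
    interpret prob_space "parisi_measure m x" by (rule prob_space_parisi_measure[OF m x])
    show ?thesis by unfold_locales (simp add: parisi_measure_def)
  qed
  moreover have "cdf (parisi_measure m x) = ?F"
    unfolding parisi_measure_def
  proof (rule cdf_interval_measure[OF param_cdf_mono[OF m x] param_cdf_right_continuous[OF m x]])
    show "(?F \<longlongrightarrow> 0) at_bot"
      by (rule tendsto_eventually, unfold eventually_at_bot_dense)
        (auto simp: param_cdf_def intro!: exI[of _ 0])
  qed
  ultimately have "isCont ?F u" using no_atom finite_borel_measure.isCont_cdf by metis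
  then have left_cont: "(?F \<longlongrightarrow> ?F u) (at_left u)"
    by (simp add: isCont_def filterlim_at_split)
  have inc: "?F a < ?F b" if "a < u" "u < b" for a b using u that by (auto simp: supp_parisi_iff[OF m x])
  show ?thesis
  proof (cases "u < m \<and> (\<forall>s. u < s \<longrightarrow> s \<le> m \<longrightarrow> (\<exists>d1 d2. u < d1 \<and> d1 < d2 \<and> d2 < s \<and> x d1 < x d2))")
    case True
    then show ?thesis using right by blast
  next
    case False
    have "\<exists>b>u. ?F b = ?F u"
    proof (cases "u < m")
      case True
      then obtain s where s: "u < s" "s \<le> m" "\<And>d1 d2. u < d1 \<Longrightarrow> d1 < d2 \<Longrightarrow> d2 < s \<Longrightarrow> x d2 \<le> x d1"
        using False by (meson not_le)
      define b where "b = (u + s) / 2"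
      have b: "u < b" "b < s" using s by (auto simp: b_def)
      have "?F d = ?F b" if "u < d" "d < b" for d
      proof -
        have "x b \<le> x d" using s(3)[of d b] that b by simp
        moreover have "x d \<le> x b" using order_param_mono[OF x, of d b] that b u01 s(2) by simp
        ultimately show ?thesis using that b u01 s(2) Fx[of d] Fx[of b] by simp
      qed
      then have "\<forall>\<^sub>F d in at_right u. ?F d = ?F b"
        unfolding eventually_at_right_field using b by blast
      then have "(?F \<longlongrightarrow> ?F b) (at_right u)" by (rule tendsto_eventually)
      moreover have "(?F \<longlongrightarrow> ?F u) (at_right u)"
        using param_cdf_right_continuous[OF m x] by (simp add: continuous_within)
      ultimately have "?F b = ?F u" using tendsto_unique[of "at_right u"] by force
      then show ?thesis using b by blast
    next
      case False
      then show ?thesis using u01 m by (intro exI[of _ "u + 1"]) (auto simp: param_cdf_def)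
    qed
    then have below: "?F a < ?F u" if "a < u" for a using inc that by metis
    have left': "\<exists>d1 d2. s < d1 \<and> d1 < d2 \<and> d2 < u \<and> ?F d1 < ?F d2" if "s < u" for s
    proof -
      define d1 where "d1 = (s + u) / 2"
      have d1: "s < d1" "d1 < u" using that by (auto simp: d1_def)
      have "\<forall>\<^sub>F d in at_left u. ?F d1 < ?F d"
        using left_cont below[OF d1(2)] by (rule order_tendstoD)
      moreover have "\<forall>\<^sub>F d in at_left u. d1 < d \<and> d < u"
        using d1 unfolding eventually_at_left_field by blast
      ultimately have "\<forall>\<^sub>F d in at_left u. d1 < d \<and> d < u \<and> ?F d1 < ?F d"
        by eventually_elim auto
      then show ?thesis using d1 eventually_happens[of _ "at_left u"] by force
    qed
    have "0 < u"
    proof (rule ccontr)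
      assume "\<not> 0 < u"
      then have "u = 0" using u01 by simp
      then show False using left'[of "-1"] by (auto simp: param_cdf_def)
    qed
    moreover have "\<exists>d1 d2. s < d1 \<and> d1 < d2 \<and> d2 < u \<and> x d1 < x d2" if s: "0 \<le> s" "s < u" for s
    proof -
      obtain d1 d2 where "s < d1" "d1 < d2" "d2 < u" "?F d1 < ?F d2" using left'[OF s(2)] by blast
      then show ?thesis using u01 s(1) Fx[of d1] Fx[of d2] by auto
    qed
    ultimately show ?thesis using left by blast
  qed
qed

subsection \<open>Admissible pairs\<close>

lemma psd_has_integral:
  fixes f :: "real \<Rightarrow> real^'n^'n"
  assumes f: "(f has_integral A) S" and psd: "\<And>t. t \<in> S \<Longrightarrow> psd (f t)"
  shows "psd A"
proof -
  have "A$i$j = A$j$i" for i j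
  proof -
    have "((\<lambda>t. f t $ i $ j - f t $ j $ i) has_integral A$i$j - A$j$i) S"
      using has_integral_linear[OF f, of "\<lambda>A. A$i$j - A$j$i"]
      by (simp add: comp_def bounded_linear_sub
          bounded_linear_compose[OF bounded_linear_vec_nth bounded_linear_vec_nth])
    moreover have "((\<lambda>t. f t $ i $ j - f t $ j $ i) has_integral 0) S"
      by (rule has_integral_is_0) (use psd psd_entries_sym in force)
    ultimately have "A$i$j - A$j$i = 0" by (rule has_integral_unique)
    then show ?thesis by simp
  qed
  moreover have "0 \<le> v \<bullet> (A *v v)" for v
  proof -
    have "((\<lambda>t. outer v v \<bullet> f t) has_integral outer v v \<bullet> A) S"
      using has_integral_linear[OF f, of "\<lambda>A. outer v v \<bullet> A"]
      by (simp add: comp_def bounded_linear_inner_right)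
    then have "0 \<le> outer v v \<bullet> A"
      by (rule has_integral_nonneg) (use psd in \<open>auto simp: inner_outer psd_def\<close>)
    then show ?thesis by (simp add: inner_outer)
  qed
  ultimately show ?thesis by (auto simp: psd_def transpose_def vec_eq_iff)
qed

lemma psd_integral:
  fixes f :: "real \<Rightarrow> real^'n^'n"
  shows "f integrable_on S \<Longrightarrow> (\<And>t. t \<in> S \<Longrightarrow> psd (f t)) \<Longrightarrow> psd (integral S f)"
  using psd_has_integral integrable_integral by blast

lemma has_vector_derivative_matrixI:
  fixes f :: "real \<Rightarrow> real^'n^'n"
  assumes "\<And>i j. ((\<lambda>t. f t $ i $ j) has_real_derivative D $ i $ j) (at t within S)"
  shows "(f has_vector_derivative D) (at t within S)"
  unfolding has_vector_derivative_iff_slope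
proof (intro vec_tendstoI)
  fix i j
  show "((\<lambda>s. ((1 / (s - t)) *\<^sub>R (f s - f t)) $ i $ j) \<longlongrightarrow> D $ i $ j) (at t within S)"
    using assms[of i j]
    by (simp add: has_real_derivative_iff_has_vector_derivative has_vector_derivative_iff_slope)
qed

lemma has_real_derivative_matrix_entry:
  fixes f :: "real \<Rightarrow> real^'n^'n"
  assumes "(f has_vector_derivative D) (at t within S)"
  shows "((\<lambda>t. f t $ i $ j) has_real_derivative D $ i $ j) (at t within S)"
  unfolding has_real_derivative_iff_has_vector_derivative
  using bounded_linear.has_vector_derivative[OF bounded_linear_compose[OF bounded_linear_vec_nth bounded_linear_vec_nth] assms]
  by simp

section \<open>An admissible pair, its hat path and the field M\<close>

locale cs_pair =
  fixes \<beta> :: "nat \<Rightarrow> real^'n" and h :: "real^'n" and Q :: "real^'n^'n"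
    and x :: "real \<Rightarrow> real" and \<Phi> :: "real \<Rightarrow> real^'n^'n" and m T :: real
  assumes m_def: "m = real CARD('n)"
    and mix: "mixture \<beta>" and con: "constraint Q" and adm: "admissible Q x \<Phi>"
    and T: "t_top m x < T" "T < m" "0 < det (Q - \<Phi> T)"
begin

abbreviation "ttop \<equiv> t_top m x"

lemma m_pos: "0 < m" by (simp add: m_def)

lemma op: "order_param m x" using adm by (simp add: admissible_def m_def)

lemma x_mono: "mono_on {0..m} x" using op by (simp add: order_param_def)

lemma ttop_range: "ttop \<in> {0..m}" by (rule order_param_t_top[OF m_pos op])

lemma x_eq_1: "t \<in> {0..m} \<Longrightarrow> x t = 1 \<longleftrightarrow> ttop \<le> t"
  by (rule order_param_t_top[OF m_pos op])

lemma Phi_ends: "\<Phi> 0 = 0" "\<Phi> m = Q"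
  using adm by (auto simp: admissible_def m_def)

definition "D = path_deriv \<Phi>"

lemma Phi_deriv:
  assumes "t \<in> {0..m}"
  shows "(\<Phi> has_vector_derivative D t) (at t within {0..m})"
  using adm assms unfolding admissible_def admissible_path_def m_def D_def path_deriv_def
  by (auto simp: vector_derivative_works)

lemma Phi_mono: "0 \<le> s \<Longrightarrow> s \<le> t \<Longrightarrow> t \<le> m \<Longrightarrow> psd (\<Phi> t - \<Phi> s)"
  using adm by (auto simp: admissible_def admissible_path_def m_def)

lemma Phi_psd: "t \<in> {0..m} \<Longrightarrow> psd (\<Phi> t)"
  using adm by (auto simp: admissible_def admissible_path_def m_def)

lemma D_cont: "continuous_on {0..m} D"
  using adm by (auto simp: admissible_def admissible_path_def m_def D_def)

lemma D_lipschitz: obtains L where "L-lipschitz_on {0..m} D"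
  using adm by (auto simp: admissible_def admissible_path_def m_def D_def)

lemma Phi_cont: "continuous_on {0..m} \<Phi>"
  using Phi_deriv by (meson continuous_on_eq_continuous_within has_vector_derivative_continuous)

text \<open>Difference quotients of a monotone path, from either side, lie in the closed cone, and
  so does their limit.\<close>

lemma D_psd:
  assumes t: "t \<in> {0..m}"
  shows "psd (D t)"
proof -
  have "psd ((1 / (s - t)) *\<^sub>R (\<Phi> s - \<Phi> t))" if "s \<in> {0..m}" for s
  proof (cases "t \<le> s")
    case True
    then show ?thesis using that t by (intro psd_scaleR Phi_mono) auto
  next
    case False
    have "psd ((1 / (t - s)) *\<^sub>R (\<Phi> t - \<Phi> s))" using False that t by (intro psd_scaleR Phi_mono) auto
    also have "(1 / (t - s)) *\<^sub>R (\<Phi> t - \<Phi> s) = (1 / (s - t)) *\<^sub>R (\<Phi> s - \<Phi> t)"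
    proof -
      have "1 / (t - s) = - (1 / (s - t))" by (metis minus_diff_eq minus_divide_right)
      then show ?thesis by (simp only:) (simp add: scaleR_right_diff_distrib)
    qed
    finally show ?thesis .
  qed
  then have "\<forall>\<^sub>F s in at t within {0..m}. (1 / (s - t)) *\<^sub>R (\<Phi> s - \<Phi> t) \<in> Collect psd"
    by (auto simp: eventually_at_filter)
  moreover have "((\<lambda>s. (1 / (s - t)) *\<^sub>R (\<Phi> s - \<Phi> t)) \<longlongrightarrow> D t) (at t within {0..m})"
    using Phi_deriv[OF t] by (simp add: has_vector_derivative_iff_slope)
  moreover have "at t within {0..m} \<noteq> bot"
    using t m_pos by (simp add: trivial_limit_within connected_imp_perfect)
  ultimately show ?thesis using Lim_in_closed_set[OF closed_psd] by fastforce
qed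

lemma D_has_integral: "0 \<le> s \<Longrightarrow> s \<le> t \<Longrightarrow> t \<le> m \<Longrightarrow> (D has_integral \<Phi> t - \<Phi> s) {s..t}"
  by (intro fundamental_theorem_of_calculus) (auto intro: has_vector_derivative_within_subset[OF Phi_deriv])

definition "H = hat_path x \<Phi>"

lemma H_eq: "H t = integral {t..m} (\<lambda>s. x s *\<^sub>R D s)"
  by (simp add: H_def hat_path_def m_def D_def)

lemma xD_integrable: "0 \<le> s \<Longrightarrow> t \<le> m \<Longrightarrow> (\<lambda>r. x r *\<^sub>R D r) integrable_on {s..t}"
  by (rule integrable_subinterval_real[OF mono_scaleR_continuous_integrable[OF x_mono D_cont]]) auto

lemma H_cont: "continuous_on {0..m} H"
  unfolding H_eq[abs_def] by (rule integral_mono_weight_continuous[OF x_mono D_cont])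

lemma H_T: "H T = Q - \<Phi> T"
proof -
  have "H T = integral {T..m} D"
    unfolding H_eq
  proof (rule integral_cong)
    fix t assume "t \<in> {T..m}"
    then show "x t *\<^sub>R D t = D t" using x_eq_1[of t] T ttop_range by simp
  qed
  then show ?thesis using D_has_integral[of T m] T ttop_range Phi_ends by (auto intro: integral_unique)
qed

lemma H_antimono:
  assumes "0 \<le> s" "s \<le> t" "t \<le> m"
  shows "psd (H s - H t)"
proof -
  have "integral {s..t} (\<lambda>r. x r *\<^sub>R D r) + H t = H s"
    unfolding H_eq using assms xD_integrable
    by (intro Henstock_Kurzweil_Integration.integral_combine) auto
  then have "H s - H t = integral {s..t} (\<lambda>r. x r *\<^sub>R D r)" by (simp add: algebra_simps)
  moreover have "psd (x r *\<^sub>R D r)" if "r \<in> {s..t}" for r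
    using that assms order_param_range[OF op, of r] by (intro psd_scaleR D_psd) auto
  ultimately show ?thesis using psd_integral xD_integrable assms by force
qed

text \<open>\<open>Q - \<Phi> t - H t\<close> is the integral of \<open>(1 - x) \<Phi>'\<close>,
  which is positive, and so is \<open>\<Phi> t\<close>.\<close>

lemma H_le_Q:
  assumes "t \<in> {0..m}"
  shows "psd (Q - H t)"
proof -
  have int: "(\<lambda>r. D r - x r *\<^sub>R D r) integrable_on {t..m}"
    using D_has_integral[of t m] assms xD_integrable by (intro integrable_diff) auto
  have "integral {t..m} (\<lambda>r. D r - x r *\<^sub>R D r) = Q - \<Phi> t - H t"
    unfolding H_eq using D_has_integral[of t m] assms xD_integrable[of t m] Phi_ends
    by (subst integral_diff) (auto simp: integral_unique)
  moreover have "psd (D r - x r *\<^sub>R D r)" if "r \<in> {t..m}" for r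
  proof -
    have "D r - x r *\<^sub>R D r = (1 - x r) *\<^sub>R D r" by (simp add: scaleR_left_diff_distrib)
    then show ?thesis using that assms order_param_range[OF op, of r] by (auto intro!: psd_scaleR D_psd)
  qed
  ultimately have "psd (Q - \<Phi> t - H t)" using psd_integral[OF int] by force
  then have "psd (Q - \<Phi> t - H t + \<Phi> t)" by (rule psd_add[OF _ Phi_psd[OF assms]])
  then show ?thesis by (simp add: algebra_simps)
qed

text \<open>Up to the cutoff the hat path dominates \<open>H T = Q - \<Phi> T\<close>, which is
  invertible by the choice of \<open>T\<close>.\<close>

lemma H_posdef:
  assumes "t \<in> {0..T}"
  shows "psd (H t)" and "det (H t) \<noteq> 0"
proof -
  have "psd (H T)" using Phi_mono[of T m] T ttop_range Phi_ends by (simp add: H_T)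
  moreover have "det (H T) \<noteq> 0" using T by (simp add: H_T)
  moreover have "psd (H t - H T)" using assms T by (intro H_antimono) auto
  ultimately show "psd (H t)" "det (H t) \<noteq> 0" using posdef_mono by blast+
qed

definition "R t = matrix_inv (H t)"

lemma R_sym: "t \<in> {0..T} \<Longrightarrow> transpose (R t) = R t"
  unfolding R_def using H_posdef psd_symmetric by (intro transpose_matrix_inv) auto

lemma R_cont: "continuous_on {0..T} R"
  unfolding R_def using T by (intro continuous_on_matrix_inv continuous_on_subset[OF H_cont] H_posdef(2)) auto

lemma RDR_cont: "continuous_on {0..T} (\<lambda>t. R t ** D t ** R t)"
  using T by (intro continuous_intros R_cont continuous_on_subset[OF D_cont]) auto

definition "N t = integral {0..t} (\<lambda>s. R s ** D s ** R s)"

lemma N_deriv: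
  "t \<in> {0..T} \<Longrightarrow> (N has_vector_derivative R t ** D t ** R t) (at t within {0..T})"
  unfolding N_def by (rule integral_has_vector_derivative[OF RDR_cont])

lemma T_range: "0 \<le> T" "0 < T" using T ttop_range by auto

lemma x_discont: "countable {t\<in>{0..m}. \<not> continuous (at t within {0..m}) x}"
  by (rule mono_on_ctble_discont[OF x_mono])

lemma H_deriv:
  assumes "t \<in> {0<..<m}" "continuous (at t within {0..m}) x"
  shows "(H has_vector_derivative - (x t *\<^sub>R D t)) (at t)"
  unfolding H_eq[abs_def] by (rule integral_mono_weight_deriv[OF x_mono D_cont assms])

text \<open>Thus \<open>R' = x N'\<close> wherever \<open>x\<close> is continuous; this relation
  drives the later integration by parts.\<close>

lemma R_deriv:
  assumes "t \<in> {0<..<T}" "continuous (at t within {0..m}) x"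
  shows "(R has_vector_derivative x t *\<^sub>R (R t ** D t ** R t)) (at t)"
proof -
  have t: "at t within {0..T} = at t" using assms(1) by (intro at_within_interior) auto
  have "(R has_vector_derivative - (R t ** (- (x t *\<^sub>R D t)) ** R t)) (at t within {0..T})"
    unfolding R_def[abs_def]
  proof (rule has_vector_derivative_matrix_inv)
    show "(H has_vector_derivative - (x t *\<^sub>R D t)) (at t within {0..T})"
      using assms T by (intro has_vector_derivative_at_within[OF H_deriv]) auto
    show "continuous_on {0..T} H" using T by (intro continuous_on_subset[OF H_cont]) auto
  qed (use assms H_posdef in auto)
  then show ?thesis
    by (simp add: t bounded_bilinear.minus_left[OF bounded_bilinear_matrix_mult]
        bounded_bilinear.minus_right[OF bounded_bilinear_matrix_mult]
        bounded_bilinear.scaleR_left[OF bounded_bilinear_matrix_mult]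
        bounded_bilinear.scaleR_right[OF bounded_bilinear_matrix_mult])
qed

lemma entry_bound:
  assumes "psd A" "psd (Q - A)"
  shows "\<bar>A$i$j\<bar> \<le> 1"
  using psd_le_diag_one[OF assms] con by (simp add: constraint_def)

lemma Phi_entry: "t \<in> {0..m} \<Longrightarrow> \<bar>\<Phi> t $ i $ j\<bar> \<le> 1"
  using entry_bound[OF Phi_psd] Phi_mono[of t m] Phi_ends by auto

text \<open>Up to the factor \<open>-1/2\<close>, \<open>M\<close> is the density of the first variation in \<open>\<Phi>\<close> with respect
  to the Parisi measure; \<open>dM\<close> is its derivative.\<close>

definition "M t = xi' \<beta> (\<Phi> t) + outer h h - N t"

definition "dM t = hadamard (xi'' \<beta> (\<Phi> t)) (D t) - R t ** D t ** R t"

lemma dxi_Phi_deriv: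
  assumes "t \<in> {0..m}"
  shows "((\<lambda>t. xi' \<beta> (\<Phi> t)) has_vector_derivative hadamard (xi'' \<beta> (\<Phi> t)) (D t)) (at t within {0..m})"
proof (rule has_vector_derivative_matrixI)
  fix i j
  have lt2: "\<bar>\<Phi> s $ i $ j\<bar> < 2" if "s \<in> {0..m}" for s
    using Phi_entry[OF that, of i j] by linarith
  have "((\<lambda>t. dxi \<beta> i j (\<Phi> t $ i $ j)) has_real_derivative ddxi \<beta> i j (\<Phi> t $ i $ j) * D t $ i $ j)
      (at t within {0..m})"
    by (rule DERIV_chain'[OF has_real_derivative_matrix_entry[OF Phi_deriv[OF assms]]
        has_field_derivative_dxi[OF mix lt2[OF assms]]])
  then have "((\<lambda>t. xi' \<beta> (\<Phi> t) $ i $ j) has_real_derivative ddxi \<beta> i j (\<Phi> t $ i $ j) * D t $ i $ j)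
      (at t within {0..m})"
    by (rule has_field_derivative_transform_within[OF _ zero_less_one assms])
      (simp add: xi'_entry[OF mix lt2])
  then show "((\<lambda>t. xi' \<beta> (\<Phi> t) $ i $ j) has_real_derivative hadamard (xi'' \<beta> (\<Phi> t)) (D t) $ i $ j)
      (at t within {0..m})"
    by (simp add: hadamard_def xi''_entry[OF mix lt2[OF assms]])
qed

lemma M_deriv:
  assumes "t \<in> {0..T}"
  shows "(M has_vector_derivative dM t) (at t within {0..T})"
proof -
  have "((\<lambda>t. xi' \<beta> (\<Phi> t)) has_vector_derivative hadamard (xi'' \<beta> (\<Phi> t)) (D t)) (at t within {0..T})"
    using assms T by (intro has_vector_derivative_within_subset[OF dxi_Phi_deriv]) auto
  then show ?thesis
    unfolding M_def[abs_def] dM_def using N_deriv[OF assms] by (auto intro!: derivative_eq_intros)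
qed

lemma M_cont: "continuous_on {0..T} M"
  using M_deriv by (meson continuous_on_eq_continuous_within has_vector_derivative_continuous)

end

lemma lipschitz_on_bounded_scaleR:
  fixes f :: "'a::metric_space \<Rightarrow> real" and g :: "'a \<Rightarrow> 'b::real_normed_vector"
  assumes f: "A-lipschitz_on S f" "\<And>s. s \<in> S \<Longrightarrow> \<bar>f s\<bar> \<le> B"
    and g: "C-lipschitz_on S g" "\<And>s. s \<in> S \<Longrightarrow> norm (g s) \<le> E"
    and nn: "0 \<le> B" "0 \<le> E"
  shows "(A * E + B * C)-lipschitz_on S (\<lambda>s. f s *\<^sub>R g s)"
proof (rule lipschitz_onI)
  have AC: "0 \<le> A" "0 \<le> C" using f(1) g(1) lipschitz_on_nonneg by auto
  show "0 \<le> A * E + B * C" using AC nn by simp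
  fix s t assume st: "s \<in> S" "t \<in> S"
  have "f s *\<^sub>R g s - f t *\<^sub>R g t = (f s - f t) *\<^sub>R g s + f t *\<^sub>R (g s - g t)"
    by (simp add: algebra_simps)
  then have "norm (f s *\<^sub>R g s - f t *\<^sub>R g t) \<le> \<bar>f s - f t\<bar> * norm (g s) + \<bar>f t\<bar> * norm (g s - g t)"
    by (metis norm_scaleR norm_triangle_ineq)
  also have "\<dots> \<le> (A * dist s t) * E + B * (C * dist s t)"
    using lipschitz_onD[OF f(1) st] lipschitz_onD[OF g(1) st] f(2)[OF st(2)] g(2)[OF st(1)] AC nn
    by (intro add_mono mult_mono) (auto simp: dist_norm)
  finally show "dist (f s *\<^sub>R g s) (f t *\<^sub>R g t) \<le> (A * E + B * C) * dist s t"
    by (simp add: dist_norm algebra_simps)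
qed

lemma C1_imp_lipschitz:
  fixes f :: "real \<Rightarrow> 'a::real_normed_vector"
  assumes f: "\<And>t. t \<in> {a..b} \<Longrightarrow> (f has_vector_derivative f' t) (at t within {a..b})"
    and f': "continuous_on {a..b} f'"
  obtains L where "L-lipschitz_on {a..b} f"
proof -
  have "bounded (f' ` {a..b})" using f' by (intro compact_imp_bounded compact_continuous_image) auto
  then obtain B where B: "0 < B" "\<And>t. t \<in> {a..b} \<Longrightarrow> norm (f' t) \<le> B"
    by (metis bounded_pos image_eqI)
  have "B-lipschitz_on {a..b} f"
  proof (rule bounded_derivative_imp_lipschitz)
    show "(f has_derivative (\<lambda>h. h *\<^sub>R f' t)) (at t within {a..b})" if "t \<in> {a..b}" for t
      using f[OF that] by (simp add: has_vector_derivative_def)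
    show "onorm (\<lambda>h. h *\<^sub>R f' t) \<le> B" if "t \<in> {a..b}" for t
      using B(2)[OF that] by (intro onorm_le) (simp add: mult.commute[of B] mult_left_mono)
  qed (use B in auto)
  then show ?thesis using that by blast
qed

subsection \<open>Admissible variations\<close>

text \<open>A direction \<open>K\<close> for \<open>\<Phi>'\<close>. Moving along it destroys the normalisation of the trace on the
  support, which is restored by the change of time \<open>sig\<close> below; the functional does not see it.\<close>

locale cs_variation = cs_pair \<beta> h Q x \<Phi> m T
  for \<beta> :: "nat \<Rightarrow> real^'n" and h Q x \<Phi> m T +
  fixes K :: "real \<Rightarrow> real^'n^'n" and e0 L :: real
  assumes K_lip: "L-lipschitz_on UNIV K"
    and K_zero: "t \<notin> {0..ttop} \<Longrightarrow> K t = 0" and K_int: "integral {0..m} K = 0"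
    and e0: "0 < e0" and K_psd: "t \<in> {0..m} \<Longrightarrow> psd (D t + e0 *\<^sub>R K t)"
    and K_trace: "e0 * \<bar>trace (K t)\<bar> \<le> 1 / 2"
begin

lemma K_cont: "continuous_on S K"
  using lipschitz_on_continuous_on[OF K_lip] continuous_on_subset by blast

lemma K_integrable: "K integrable_on {a..b}"
  using K_cont integrable_continuous_real by blast

definition "Psi t = integral {0..t} K"

text \<open>Starting the integral to the left of \<open>0\<close> makes \<open>Psi\<close>
  differentiable from both sides on the whole line, where the change of time is to be
  inverted.\<close>

lemma Psi_eq_integral:
  assumes "a \<le> 0" "a \<le> t"
  shows "integral {a..t} K = Psi t"
proof (cases "0 \<le> t")
  case True
  have "integral {a..0} K + integral {0..t} K = integral {a..t} K"
    using assms True K_integrable by (intro Henstock_Kurzweil_Integration.integral_combine) auto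
  moreover have "integral {a..0} K = 0"
  proof -
    \<comment> \<open>\<open>K_zero\<close> is silent at the point \<open>0\<close> itself, hence
      the spike.\<close>
    have "(K has_integral 0) {a..0}"
      by (rule has_integral_spike[OF negligible_sing[of 0], of _ K "\<lambda>_. 0"]) (auto intro!: K_zero)
    then show ?thesis by (rule integral_unique)
  qed
  ultimately show ?thesis by (simp add: Psi_def)
next
  case False
  have "(K has_integral 0) {a..t}" by (rule has_integral_is_0) (use False in \<open>auto intro!: K_zero\<close>)
  then show ?thesis using False by (simp add: Psi_def integral_unique)
qed

lemma Psi_deriv: "(Psi has_vector_derivative K t) (at t within S)"
proof -
  define a where "a = min t 0 - 1"
  have "((\<lambda>u. integral {a..u} K) has_vector_derivative K t) (at t within {a..t + 1})"
    by (rule integral_has_vector_derivative[OF K_cont]) (auto simp: a_def)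
  moreover have "at t within {a..t + 1} = at t" by (rule at_within_interior) (auto simp: a_def)
  ultimately have "((\<lambda>u. integral {a..u} K) has_vector_derivative K t) (at t)" by simp
  then have "(Psi has_vector_derivative K t) (at t)"
    by (rule has_vector_derivative_transform_within_open[of _ _ _ "{a<..}"])
      (auto simp: a_def intro!: Psi_eq_integral)
  then show ?thesis by (rule has_vector_derivative_at_within)
qed

lemma Psi_cont: "continuous_on S Psi"
  using Psi_deriv by (meson continuous_on_eq_continuous_within has_vector_derivative_continuous)

text \<open>Past \<open>ttop\<close> nothing is added to the total integral, which is zero. So the
  perturbed path has the same ends and the same values at the cutoff.\<close>

lemma Psi_zero:
  assumes "t \<le> 0 \<or> ttop \<le> t"
  shows "Psi t = 0"
proof (cases "t \<le> 0")
  case True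
  then show ?thesis by (cases "t = 0") (auto simp: Psi_def)
next
  case False
  have above: "integral {s..u} K = 0" if "ttop \<le> s" for s u
  proof -
    have "(K has_integral 0) {s..u}"
      by (rule has_integral_spike[OF negligible_sing[of ttop], of _ K "\<lambda>_. 0"]) (use that in \<open>auto intro!: K_zero\<close>)
    then show ?thesis by (rule integral_unique)
  qed
  have "integral {0..ttop} K + integral {ttop..u} K = integral {0..u} K" if "ttop \<le> u" for u
    using that ttop_range K_integrable by (intro Henstock_Kurzweil_Integration.integral_combine) auto
  from this[of t] this[of m] show ?thesis
    using False assms ttop_range K_int by (simp add: above Psi_def)
qed

end

section \<open>The competitor of step e and its admissibility\<close>

locale cs_step = cs_variation \<beta> h Q x \<Phi> m T K e0 L
  for \<beta> :: "nat \<Rightarrow> real^'n" and h Q x \<Phi> m T K e0 L +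
  fixes e :: real
  assumes e: "0 \<le> e" "e \<le> e0"
begin

definition "Pe t = \<Phi> t + e *\<^sub>R Psi t"
definition "De t = D t + e *\<^sub>R K t"
text \<open>On the support of the Parisi measure \<open>trace (\<Phi> t) = t\<close>, so
  \<open>sig t\<close> is the trace of \<open>Pe t\<close> there. Running \<open>Pe\<close> and
  \<open>x\<close> at the inverse time \<open>tau\<close> makes the trace of \<open>Xi\<close> equal
  to the time again.\<close>

definition "sig t = t + e * trace (Psi t)"
definition "tau = inv sig"
definition "tau' t = inverse (1 + e * trace (K (tau t)))"
definition "y t = x (tau t)"
definition "Xi t = Pe (tau t)"

lemma trace_bound: "e * \<bar>trace (K t)\<bar> \<le> 1 / 2"
  using K_trace[of t] e mult_right_mono[OF e(2), of "\<bar>trace (K t)\<bar>"] by simp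

text \<open>The bound 1/2 in \<open>K_trace\<close> serves this: slope at least 1/2 makes
  \<open>sig\<close> invertible with a 2-Lipschitz inverse.\<close>

lemma sig'_pos: "1 / 2 \<le> 1 + e * trace (K t)"
proof -
  have "\<bar>e * trace (K t)\<bar> \<le> 1 / 2" using trace_bound e by (simp add: abs_mult)
  then show ?thesis by linarith
qed

lemma bounded_linear_trace: "bounded_linear (trace :: real^'n^'n \<Rightarrow> real)"
  unfolding trace_def[abs_def]
  by (intro bounded_linear_sum bounded_linear_compose[OF bounded_linear_vec_nth bounded_linear_vec_nth])

lemma sig_deriv: "(sig has_real_derivative 1 + e * trace (K t)) (at t)"
proof -
  have "((\<lambda>t. trace (Psi t)) has_real_derivative trace (K t)) (at t)"
    unfolding has_real_derivative_iff_has_vector_derivative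
    by (rule bounded_linear.has_vector_derivative[OF bounded_linear_trace Psi_deriv])
  then show ?thesis unfolding sig_def[abs_def] by (auto intro!: derivative_eq_intros)
qed

lemma sig_outside: "t \<le> 0 \<or> ttop \<le> t \<Longrightarrow> sig t = t"
  using Psi_zero[of t] linear_0[OF bounded_linear.linear[OF bounded_linear_trace]] by (simp add: sig_def)

lemma sig_expand: "s \<le> t \<Longrightarrow> (t - s) / 2 \<le> sig t - sig s"
proof -
  assume "s \<le> t"
  have "sig s - s / 2 \<le> sig t - t / 2"
  proof (rule DERIV_nonneg_imp_nondecreasing[OF \<open>s \<le> t\<close>])
    fix r
    have "((\<lambda>r. sig r - r / 2) has_real_derivative (1 + e * trace (K r)) - 1 / 2) (at r)"
      by (auto intro!: derivative_eq_intros sig_deriv)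
    then show "\<exists>d. ((\<lambda>r. sig r - r / 2) has_real_derivative d) (at r) \<and> 0 \<le> d"
      using sig'_pos[of r] by (metis diff_ge_0_iff_ge)
  qed
  then show ?thesis by (simp add: field_simps)
qed

lemma sig_strict_mono: "strict_mono sig"
proof (rule strict_monoI)
  fix s t :: real assume "s < t"
  then show "sig s < sig t" using sig_expand[of s t] by simp
qed

lemma sig_surj: "\<exists>s. sig s = t"
proof (cases "t \<in> {0..m}")
  case True
  have "continuous_on {0..m} sig"
    using sig_deriv by (meson DERIV_continuous_on has_field_derivative_at_within)
  then have "\<exists>s\<ge>0. s \<le> m \<and> sig s = t"
    using IVT'[of sig 0 t m] True sig_outside[of 0] sig_outside[of m] ttop_range m_pos by auto
  then show ?thesis by blast
next
  case False
  then have "t \<le> 0 \<or> ttop \<le> t" using ttop_range by auto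
  then show ?thesis using sig_outside by blast
qed

lemma sig_tau [simp]: "sig (tau t) = t"
  unfolding tau_def by (rule f_inv_into_f) (metis sig_surj rangeI)

lemma tau_sig [simp]: "tau (sig t) = t"
  unfolding tau_def by (rule inv_f_f) (rule strict_mono_imp_inj_on[OF sig_strict_mono])

lemma tau_strict_mono: "s < t \<Longrightarrow> tau s < tau t"
  using strict_mono_less[OF sig_strict_mono, of "tau s" "tau t"] by simp

lemma tau_mono: "s \<le> t \<Longrightarrow> tau s \<le> tau t"
  using tau_strict_mono[of s t] by (cases "s = t") auto

lemma tau_less_iff: "tau s < tau t \<longleftrightarrow> s < t"
  using strict_mono_less[OF sig_strict_mono, of "tau s" "tau t"] by simp

lemma tau_outside: "t \<le> 0 \<or> ttop \<le> t \<Longrightarrow> tau t = t"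
  by (metis sig_outside tau_sig)

lemma tau_lipschitz: "2-lipschitz_on S tau"
proof (rule lipschitz_onI)
  have *: "tau t - tau s \<le> 2 * (t - s)" if "s \<le> t" for s t
    using sig_expand[OF tau_mono[OF that]] by simp
  fix s t
  show "dist (tau s) (tau t) \<le> 2 * dist s t"
    using *[of s t] *[of t s] tau_mono[of s t] tau_mono[of t s]
    by (cases "s \<le> t") (auto simp: dist_real_def abs_if)
qed simp

lemma tau_deriv: "(tau has_real_derivative tau' t) (at t)"
  unfolding tau'_def
proof (rule DERIV_inverse_function[where f = sig and a = "t - 1" and b = "t + 1"])
  show "isCont tau t"
    using lipschitz_on_continuous_on[OF tau_lipschitz, of UNIV] by (simp add: continuous_on_eq_continuous_at)
  show "1 + e * trace (K (tau t)) \<noteq> 0" using sig'_pos[of "tau t"] by linarith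
qed (auto intro: sig_deriv)

lemma tau'_pos: "0 < tau' t" "\<bar>tau' t\<bar> \<le> 2"
proof -
  have "1 / 2 \<le> 1 + e * trace (K (tau t))" by (rule sig'_pos)
  then show "0 < tau' t" "\<bar>tau' t\<bar> \<le> 2"
    by (auto simp: tau'_def field_simps abs_if)
qed

lemma tau_range: "t \<in> {0..m} \<Longrightarrow> tau t \<in> {0..m}"
  using tau_mono[of 0 t] tau_mono[of t m] tau_outside[of 0] tau_outside[of m] ttop_range by auto

lemma tau_image: "tau ` {0..m} = {0..m}"
proof
  show "{0..m} \<subseteq> tau ` {0..m}"
  proof
    fix t assume "t \<in> {0..m}"
    then have "sig t \<in> {0..m}"
      using strict_mono_less_eq[OF sig_strict_mono, of 0 t] strict_mono_less_eq[OF sig_strict_mono, of t m]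
        sig_outside[of 0] sig_outside[of m] ttop_range by auto
    then show "t \<in> tau ` {0..m}" by (metis image_eqI tau_sig)
  qed
qed (use tau_range in auto)

lemma tau'_lipschitz: obtains C where "C-lipschitz_on S tau'"
proof -
  obtain B where B: "\<And>A :: real^'n^'n. norm (trace A) \<le> norm A * B" "0 < B"
    using bounded_linear.pos_bounded[OF bounded_linear_trace] by blast
  \<comment> \<open>The 4 bounds the product of the two reciprocals, the last 2 is the Lipschitz
    constant of \<open>tau\<close>, and \<open>B\<close> is a norm bound for the trace.\<close>
  have "(4 * (e * B * L * 2))-lipschitz_on S tau'"
  proof (rule lipschitz_onI)
    have L: "0 \<le> L" by (rule lipschitz_on_nonneg[OF K_lip])
    then show "0 \<le> 4 * (e * B * L * 2)" using e B by simp
    fix s t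
    define p q where "p = 1 + e * trace (K (tau s))" and "q = 1 + e * trace (K (tau t))"
    have pq: "1 / 2 \<le> p" "1 / 2 \<le> q" unfolding p_def q_def by (rule sig'_pos)+
    have "\<bar>q - p\<bar> = e * \<bar>trace (K (tau t) - K (tau s))\<bar>"
      using e by (simp add: p_def q_def linear_diff[OF bounded_linear.linear[OF bounded_linear_trace]]
        flip: right_diff_distrib) (simp add: abs_mult)
    also have "\<dots> \<le> e * (norm (K (tau t) - K (tau s)) * B)"
      using B(1)[of "K (tau t) - K (tau s)"] e by (intro mult_left_mono) auto
    also have "\<dots> \<le> e * ((L * (2 * dist s t)) * B)"
    proof (intro mult_left_mono mult_right_mono)
      have "norm (K (tau t) - K (tau s)) \<le> L * dist (tau s) (tau t)"
        using lipschitz_onD[OF K_lip, of "tau t" "tau s"] by (metis UNIV_I dist_commute dist_norm)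
      also have "\<dots> \<le> L * (2 * dist s t)"
        using lipschitz_onD[OF tau_lipschitz, of s UNIV t] L by (intro mult_left_mono) auto
      finally show "norm (K (tau t) - K (tau s)) \<le> L * (2 * dist s t)" .
    qed (use B e in auto)
    finally have 1: "\<bar>q - p\<bar> \<le> e * ((L * (2 * dist s t)) * B)" .
    have "inverse p - inverse q = (q - p) * (inverse p * inverse q)"
      using pq by (simp add: field_simps)
    then have "\<bar>inverse p - inverse q\<bar> = \<bar>q - p\<bar> * (inverse p * inverse q)"
      using pq by (simp add: abs_mult)
    also have "\<dots> \<le> \<bar>q - p\<bar> * (2 * 2)"
      using pq by (intro mult_left_mono mult_mono) (auto simp: field_simps)
    also have "\<dots> \<le> (e * ((L * (2 * dist s t)) * B)) * (2 * 2)" using 1 by (intro mult_right_mono) auto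
    finally show "dist (tau' s) (tau' t) \<le> 4 * (e * B * L * 2) * dist s t"
      by (simp add: tau'_def dist_real_def p_def q_def mult_ac)
  qed
  then show ?thesis using that by blast
qed

lemma Pe_deriv: "t \<in> {0..m} \<Longrightarrow> (Pe has_vector_derivative De t) (at t within {0..m})"
  unfolding Pe_def[abs_def] De_def by (auto intro!: derivative_eq_intros Phi_deriv Psi_deriv)

lemma De_cont: "continuous_on {0..m} De"
  unfolding De_def[abs_def] by (intro continuous_intros D_cont K_cont)

lemma De_psd:
  assumes "t \<in> {0..m}"
  shows "psd (De t)"
proof -
  \<comment> \<open>Convex combination of the two end points of the segment from step 0 to step
    \<open>e0\<close>.\<close>
  have "De t = (1 - e / e0) *\<^sub>R D t + (e / e0) *\<^sub>R (D t + e0 *\<^sub>R K t)"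
    using e0 by (simp add: De_def algebra_simps)
  moreover have "0 \<le> 1 - e / e0" "0 \<le> e / e0" using e e0 by auto
  ultimately show ?thesis using D_psd[OF assms] K_psd[OF assms] by (simp add: psd_add psd_scaleR)
qed

lemma Pe_mono:
  assumes "0 \<le> s" "s \<le> t" "t \<le> m"
  shows "psd (Pe t - Pe s)"
proof (rule psd_has_integral)
  show "(De has_integral Pe t - Pe s) {s..t}"
    using assms by (intro fundamental_theorem_of_calculus)
      (auto intro: has_vector_derivative_within_subset[OF Pe_deriv])
qed (use assms De_psd in auto)

lemma Pe_outside: "t \<le> 0 \<or> ttop \<le> t \<Longrightarrow> Pe t = \<Phi> t"
  using Psi_zero by (simp add: Pe_def)

lemma Pe_psd: "t \<in> {0..m} \<Longrightarrow> psd (Pe t)"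
  using Pe_mono[of 0 t] Pe_outside[of 0] Phi_ends by simp

lemma Xi_deriv:
  assumes "t \<in> {0..m}"
  shows "(Xi has_vector_derivative tau' t *\<^sub>R De (tau t)) (at t within {0..m})"
proof -
  have "(tau has_vector_derivative tau' t) (at t within {0..m})"
    using tau_deriv by (simp add: has_real_derivative_iff_has_vector_derivative has_vector_derivative_at_within)
  moreover have "(Pe has_vector_derivative De (tau t)) (at (tau t) within tau ` {0..m})"
    unfolding tau_image using assms by (intro Pe_deriv tau_range)
  ultimately show ?thesis
    using vector_diff_chain_within[of tau "tau' t" t "{0..m}" Pe] by (simp add: Xi_def[abs_def] comp_def)
qed

lemma path_deriv_Xi:
  assumes "t \<in> {0..m}"
  shows "path_deriv Xi t = tau' t *\<^sub>R De (tau t)"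
  unfolding path_deriv_def m_def[symmetric]
  by (rule vector_derivative_within_closed_interval[OF m_pos assms Xi_deriv[OF assms]])

lemma De_lipschitz: obtains C where "C-lipschitz_on {0..m} De"
proof -
  obtain L' where "L'-lipschitz_on {0..m} D" using D_lipschitz .
  then have "(L' + \<bar>e\<bar> * L)-lipschitz_on {0..m} De"
    unfolding De_def[abs_def]
    by (intro lipschitz_on_add lipschitz_on_cmult lipschitz_on_subset[OF K_lip]) auto
  then show ?thesis using that by blast
qed

lemma path_deriv_Xi_lipschitz: obtains C where "C-lipschitz_on {0..m} (path_deriv Xi)"
proof -
  obtain A where A: "A-lipschitz_on {0..m} tau'" using tau'_lipschitz .
  obtain C where C: "C-lipschitz_on {0..m} De" using De_lipschitz .
  then have C': "(C * 2)-lipschitz_on {0..m} (\<lambda>t. De (tau t))"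
    by (intro lipschitz_on_compose2[OF tau_lipschitz]) (simp add: tau_image)
  have "bounded (De ` {0..m})" using De_cont by (intro compact_imp_bounded compact_continuous_image) auto
  then obtain E where E: "0 < E" "\<And>t. t \<in> {0..m} \<Longrightarrow> norm (De t) \<le> E"
    by (metis bounded_pos image_eqI)
  have "(A * E + 2 * (C * 2))-lipschitz_on {0..m} (\<lambda>t. tau' t *\<^sub>R De (tau t))"
    using E by (intro lipschitz_on_bounded_scaleR A C' E(2) tau_range tau'_pos(2)) auto
  then have "(A * E + 2 * (C * 2))-lipschitz_on {0..m} (path_deriv Xi)"
    by (rule lipschitz_on_transform) (simp add: path_deriv_Xi)
  then show ?thesis using that by blast
qed

lemma admissible_path_Xi: "admissible_path Xi"
  unfolding admissible_path_def m_def[symmetric]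
proof (intro conjI ballI impI)
  obtain C where C: "C-lipschitz_on {0..m} (path_deriv Xi)" using path_deriv_Xi_lipschitz .
  then show "\<exists>L. L-lipschitz_on {0..m} (path_deriv Xi)" by blast
  show cont: "continuous_on {0..m} (path_deriv Xi)" by (rule lipschitz_on_continuous_on[OF C])
  show "\<exists>L. L-lipschitz_on {0..m} Xi"
    using C1_imp_lipschitz[of 0 m Xi "path_deriv Xi"] cont Xi_deriv by (metis path_deriv_Xi)
  show "Xi differentiable at t within {0..m}" if "t \<in> {0..m}" for t
    using Xi_deriv[OF that] by (auto simp: has_vector_derivative_def differentiable_def)
  show "psd (Xi t)" if "t \<in> {0..m}" for t using that Pe_psd tau_range by (simp add: Xi_def)
  show "psd (Xi t - Xi s)" if "s \<in> {0..m}" "t \<in> {0..m}" "s \<le> t" for s t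
    using that tau_range[of s] tau_range[of t] tau_mono by (auto simp: Xi_def intro!: Pe_mono)
qed

lemma order_param_y: "order_param m y"
  unfolding order_param_def
proof (intro conjI ballI)
  show "y t \<in> {0..1}" if "t \<in> {0..m}" for t
    using order_param_range[OF op tau_range[OF that]] by (simp add: y_def)
  show "mono_on {0..m} y"
  proof (rule mono_onI)
    fix s t assume "s \<in> {0..m}" "t \<in> {0..m}" "s \<le> t"
    then show "y s \<le> y t"
      unfolding y_def using tau_range[of s] tau_range[of t] tau_mono by (intro order_param_mono[OF op]) auto
  qed
  show "y m = 1" using op tau_outside[of m] ttop_range by (simp add: y_def order_param_def)
  fix t assume t: "t \<in> {0..<m}"
  \<comment> \<open>Continuity of \<open>x\<close> is available only from the right, so
    \<open>tau\<close> must approach \<open>tau t\<close> strictly from above.\<close>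
  have "filterlim tau (at_right (tau t)) (at_right t)"
    unfolding filterlim_at
  proof
    have "isCont tau t" using tau_deriv DERIV_isCont by blast
    then show "(tau \<longlongrightarrow> tau t) (at_right t)" by (simp add: isCont_def filterlim_at_split)
    show "\<forall>\<^sub>F s in at_right t. tau s \<in> {tau t<..} \<and> tau s \<noteq> tau t"
      unfolding eventually_at_filter by (simp add: tau_strict_mono less_imp_neq[symmetric])
  qed
  moreover have "tau t \<in> {0..<m}"
    using t tau_range[of t] tau_strict_mono[of t m] tau_outside[of m] ttop_range by auto
  then have "(x \<longlongrightarrow> x (tau t)) (at_right (tau t))"
    using op by (auto simp: order_param_def continuous_within)
  ultimately show "continuous (at_right t) y"
    unfolding continuous_within y_def[abs_def] by (rule filterlim_compose[rotated])
qed

lemma y_eq_1: "t \<in> {0..m} \<Longrightarrow> y t = 1 \<longleftrightarrow> x t = 1"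
  using x_eq_1[OF tau_range] x_eq_1[of t] tau_less_iff[of t ttop] tau_outside[of ttop]
  by (simp add: y_def) (metis not_le)

lemma t_top_y: "t_top m y = ttop"
  unfolding t_top_def by (rule arg_cong[of _ _ Inf]) (use y_eq_1 in auto)

lemma supp_y:
  assumes "t \<in> supp (parisi_measure m y)"
  shows "tau t \<in> supp (parisi_measure m x)"
  unfolding supp_parisi_iff[OF m_pos op]
proof (intro allI impI)
  fix a b assume ab: "a < tau t \<and> tau t < b"
  have cdf: "param_cdf m y s = param_cdf m x (tau s)" for s
  proof -
    have "tau s < 0 \<longleftrightarrow> s < 0" using tau_less_iff[of s 0] tau_outside[of 0] by simp
    moreover have "min (tau s) m = tau (min s m)"
      using tau_outside[of m] ttop_range tau_mono[of s m] tau_mono[of m s]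
      by (auto simp: min_def)
    ultimately show ?thesis by (simp add: param_cdf_def y_def)
  qed
  have "sig a < t" "t < sig b" using ab strict_mono_less[OF sig_strict_mono] by (metis sig_tau)+
  then have "param_cdf m y (sig a) < param_cdf m y (sig b)"
    using assms by (simp add: supp_parisi_iff[OF m_pos order_param_y])
  then show "param_cdf m x a < param_cdf m x b" by (simp add: cdf)
qed

lemma admissible_y_Xi: "admissible Q y Xi"
  unfolding admissible_def m_def[symmetric]
proof (intro conjI ballI)
  show "Xi 0 = 0" "Xi m = Q"
    using tau_outside[of 0] tau_outside[of m] Pe_outside[of 0] Pe_outside[of m] Phi_ends ttop_range
    by (auto simp: Xi_def)
  have "Xi ttop = \<Phi> ttop" using tau_outside[of ttop] Pe_outside[of ttop] by (simp add: Xi_def)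
  then show "0 < det (Q - Xi (t_top m y))" using adm[unfolded admissible_def m_def[symmetric]] by (simp add: t_top_y)
  fix t assume "t \<in> supp (parisi_measure m y)"
  then have "trace (\<Phi> (tau t)) = tau t" using supp_y adm by (auto simp: admissible_def m_def)
  then have "trace (Xi t) = sig (tau t)"
    by (simp add: Xi_def Pe_def sig_def linear_add[OF bounded_linear.linear[OF bounded_linear_trace]]
       linear_scale[OF bounded_linear.linear[OF bounded_linear_trace]])
  then show "trace (Xi t) = t" by simp
qed (rule order_param_y admissible_path_Xi)+

end

section \<open>The functional along a variation\<close>

lemma continuous_on_matrixI:
  fixes f :: "'a::topological_space \<Rightarrow> real^'n^'n"
  assumes "\<And>i j. continuous_on S (\<lambda>s. f s $ i $ j)"
  shows "continuous_on S f"
proof -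
  have "continuous_on S (\<lambda>s. \<chi> i j. f s $ i $ j)" by (intro continuous_on_vec_lambda assms)
  then show ?thesis by simp
qed

lemma continuous_on_hadamard [continuous_intros]:
  fixes f g :: "'a::topological_space \<Rightarrow> real^'n^'n"
  shows "continuous_on S f \<Longrightarrow> continuous_on S g \<Longrightarrow> continuous_on S (\<lambda>s. hadamard (f s) (g s))"
  by (rule continuous_on_matrixI) (auto simp: hadamard_def intro!: continuous_intros)

lemma continuous_on_xi:
  fixes f :: "'a::topological_space \<Rightarrow> real^'n^'n"
  assumes \<beta>: "mixture \<beta>" and f: "continuous_on S f" and bd: "\<And>s i j. s \<in> S \<Longrightarrow> \<bar>f s $ i $ j\<bar> < 2"
  shows "continuous_on S (\<lambda>s. xi' \<beta> (f s))" "continuous_on S (\<lambda>s. xi'' \<beta> (f s))"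
proof -
  have d: "isCont (dxi \<beta> i j) a" if "\<bar>a\<bar> < 2" for i j a
    using has_field_derivative_dxi[OF \<beta> that] by (rule DERIV_isCont)
  have fij: "continuous_on S (\<lambda>s. f s $ i $ j)" for i j by (intro continuous_intros f)
  have "continuous_on S (\<lambda>s. dxi \<beta> i j (f s $ i $ j))" for i j
    by (rule continuous_on_compose2[OF _ fij, of "{a. \<bar>a\<bar> < 2}"])
      (use d bd in \<open>auto intro!: continuous_at_imp_continuous_on\<close>)
  then have "continuous_on S (\<lambda>s. xi' \<beta> (f s) $ i $ j)" for i j
    by (rule continuous_on_eq) (simp add: xi'_entry[OF \<beta> bd])
  then show "continuous_on S (\<lambda>s. xi' \<beta> (f s))" by (rule continuous_on_matrixI)
  have "continuous_on S (\<lambda>s. ddxi \<beta> i j (f s $ i $ j))" for i j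
    by (rule continuous_on_compose2[OF _ fij, of "{a. \<bar>a\<bar> < 2}"])
      (use isCont_ddxi[OF \<beta>] bd in \<open>auto intro!: continuous_at_imp_continuous_on\<close>)
  then have "continuous_on S (\<lambda>s. xi'' \<beta> (f s) $ i $ j)" for i j
    by (rule continuous_on_eq) (simp add: xi''_entry[OF \<beta> bd])
  then show "continuous_on S (\<lambda>s. xi'' \<beta> (f s))" by (rule continuous_on_matrixI)
qed

lemma continuous_on_slice:
  assumes "continuous_on (A \<times> B) (\<lambda>p. f (fst p) (snd p))" "e \<in> A"
  shows "continuous_on B (f e)"
proof -
  have "continuous_on B (Pair e)" by (intro continuous_intros)
  then show ?thesis using continuous_on_compose2[OF assms(1), of B "Pair e"] assms(2) by auto
qed

lemma frob_scaleR_right: "frob A (c *\<^sub>R B) = c * frob A B"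
  by (simp add: frob_eq_inner transpose_def inner_matrix_entries sum_distrib_left mult_ac)

lemma hadamard_inner_commute: "hadamard A B \<bullet> C = hadamard A C \<bullet> B" for A :: "real^'n^'n"
  by (simp add: inner_matrix_entries hadamard_def mult_ac)

context cs_variation
begin

text \<open>The hat path is linear in \<open>\<Phi>'\<close>, so a step \<open>e\<close> changes it
  by \<open>e\<close> times \<open>HK\<close>.\<close>

definition "HK t = integral {t..m} (\<lambda>s. x s *\<^sub>R K s)"

definition "J1 e = integral {0..m} (\<lambda>t. x t * ((xi' \<beta> (\<Phi> t + e *\<^sub>R Psi t) + outer h h) \<bullet> (D t + e *\<^sub>R K t)))"

text \<open>The factor \<open>1\<close> fills the weight slot of
  \<open>weighted_leibniz_rule\<close>.\<close>

definition "J3 e = integral {0..T} (\<lambda>t. 1 * (matrix_inv (H t + e *\<^sub>R HK t) \<bullet> (D t + e *\<^sub>R K t)))"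

definition "J e = 1 / 2 * (J1 e + ln (det (Q - \<Phi> T)) + J3 e)"

lemma HK_cont: "continuous_on {0..m} HK"
  unfolding HK_def[abs_def] by (rule integral_mono_weight_continuous[OF x_mono K_cont])

end

context cs_step
begin

lemma De_sym: "t \<in> {0..m} \<Longrightarrow> transpose (De t) = De t"
  using De_psd psd_symmetric by blast

lemma Pe_entry: "t \<in> {0..m} \<Longrightarrow> \<bar>Pe t $ i $ j\<bar> < 2"
  using entry_bound[OF Pe_psd, of t i j] Pe_mono[of t m] Pe_outside[of m] Phi_ends ttop_range by auto

lemma Pe_cont: "continuous_on {0..m} Pe"
  unfolding Pe_def[abs_def] by (intro continuous_intros Phi_cont Psi_cont)

lemma He_eq:
  assumes "t \<in> {0..m}"
  shows "integral {t..m} (\<lambda>s. x s *\<^sub>R De s) = H t + e *\<^sub>R HK t"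
proof -
  have K: "(\<lambda>s. x s *\<^sub>R K s) integrable_on {t..m}"
    using assms by (intro integrable_subinterval_real[OF mono_scaleR_continuous_integrable[OF x_mono K_cont]]) auto
  have "(\<lambda>s. x s *\<^sub>R De s) = (\<lambda>s. x s *\<^sub>R D s + e *\<^sub>R (x s *\<^sub>R K s))"
    by (simp add: De_def fun_eq_iff algebra_simps)
  then show ?thesis
    using assms integrable_cmul[OF K, of e] xD_integrable[of t m]
    by (simp only: H_eq HK_def Henstock_Kurzweil_Integration.integral_add integral_cmul atLeastAtMost_iff)
qed

text \<open>\<open>Pe\<close> agrees with \<open>\<Phi>\<close> at \<open>T\<close> and at
  \<open>m\<close>, so the perturbed hat path still dominates \<open>Q - \<Phi> T\<close>.\<close>

lemma He_posdef:
  assumes "t \<in> {0..T}"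
  shows "det (H t + e *\<^sub>R HK t) \<noteq> 0"
proof -
  have int: "(\<lambda>s. x s *\<^sub>R De s) integrable_on {u..v}" if "0 \<le> u" "v \<le> m" for u v
    using that by (intro integrable_subinterval_real[OF mono_scaleR_continuous_integrable[OF x_mono De_cont]]) auto
  define He where "He t = integral {t..m} (\<lambda>s. x s *\<^sub>R De s)" for t
  have "He T = integral {T..m} De"
    unfolding He_def
  proof (rule integral_cong)
    fix t assume "t \<in> {T..m}"
    then show "x t *\<^sub>R De t = De t" using x_eq_1[of t] T ttop_range by simp
  qed
  also have "\<dots> = Pe m - Pe T"
    using T T_range by (intro integral_unique fundamental_theorem_of_calculus)
      (auto intro: has_vector_derivative_within_subset[OF Pe_deriv])
  also have "\<dots> = Q - \<Phi> T" using Pe_outside[of m] Pe_outside[of T] T Phi_ends by simp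
  finally have HT: "He T = Q - \<Phi> T" .
  have "integral {t..T} (\<lambda>s. x s *\<^sub>R De s) + He T = He t"
    unfolding He_def using assms T by (intro Henstock_Kurzweil_Integration.integral_combine int) auto
  then have "He t - He T = integral {t..T} (\<lambda>s. x s *\<^sub>R De s)" by (simp add: algebra_simps)
  moreover have "psd (integral {t..T} (\<lambda>s. x s *\<^sub>R De s))"
  proof (rule psd_integral[OF int])
    fix r assume "r \<in> {t..T}"
    then have "r \<in> {0..m}" using assms T by simp
    then show "psd (x r *\<^sub>R De r)" using order_param_range[OF op] by (intro psd_scaleR De_psd) auto
  qed (use assms T in auto)
  ultimately have "psd (He t - He T)" by simp
  moreover have "psd (He T)" using Phi_mono[of T m] T T_range Phi_ends by (simp add: HT)
  ultimately have "det (He t) \<noteq> 0" using posdef_mono(2)[of "He T" "He t"] T by (simp add: HT)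
  then show ?thesis using He_eq[of t] assms T by (simp add: He_def)
qed

text \<open>The chain rule gives the derivative of \<open>Xi\<close> the factor \<open>tau'\<close>,
  which is the Jacobian. Integrands linear in the derivative of the path are therefore insensitive
  to the change of time.\<close>

lemma integral_change_time:
  fixes f :: "real \<Rightarrow> 'a::euclidean_space"
  assumes "f absolutely_integrable_on {tau a..tau b}" "a \<le> b"
    and "\<And>t. t \<in> {a..b} \<Longrightarrow> g t = tau' t *\<^sub>R f (tau t)"
  shows "integral {a..b} g = integral {tau a..tau b} f"
proof -
  have "integral {a..b} g = integral {a..b} (\<lambda>t. tau' t *\<^sub>R f (tau t))"
    by (rule integral_cong) (rule assms(3))
  then show ?thesis
    using integral_substitution_increasing[OF assms(1) tau_deriv tau'_pos(1) assms(2)] by simp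
qed

lemma tau_m: "tau m = m" and tau_0: "tau 0 = 0" and tau_T: "tau T = T"
  using tau_outside[of m] tau_outside[of 0] tau_outside[of T] ttop_range T by auto

lemma hat_path_y:
  assumes "t \<in> {0..m}"
  shows "hat_path y Xi t = H (tau t) + e *\<^sub>R HK (tau t)"
proof -
  have "hat_path y Xi t = integral {tau t..tau m} (\<lambda>s. x s *\<^sub>R De s)"
    unfolding hat_path_def m_def[symmetric]
  proof (rule integral_change_time)
    show "(\<lambda>s. x s *\<^sub>R De s) absolutely_integrable_on {tau t..tau m}"
      using tau_range[OF assms] tau_m x_mono
      by (intro mono_scaleR_continuous_absolutely_integrable continuous_on_subset[OF De_cont])
        (auto simp: mono_on_def)
    show "y s *\<^sub>R path_deriv Xi s = tau' s *\<^sub>R x (tau s) *\<^sub>R De (tau s)" if "s \<in> {t..m}" for s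
      using that assms by (simp add: path_deriv_Xi y_def mult.commute)
  qed (use assms in auto)
  then show ?thesis using He_eq[OF tau_range[OF assms]] tau_m by simp
qed

lemma J1_eq: "J1 e = integral {0..m} (\<lambda>t. x t * ((xi' \<beta> (Pe t) + outer h h) \<bullet> De t))"
  by (simp add: J1_def Pe_def De_def)

lemma crisanti_sommers_at_y: "crisanti_sommers_at T \<beta> h y Xi = J e"
proof -
  have 1: "integral {0..m} (\<lambda>t. y t * frob (xi' \<beta> (Xi t) + outer h h) (path_deriv Xi t)) = J1 e"
  proof -
    have c: "continuous_on {0..m} (\<lambda>t. (xi' \<beta> (Pe t) + outer h h) \<bullet> De t)"
      by (intro continuous_intros De_cont continuous_on_xi mix Pe_entry Pe_cont)
    have "integral {0..m} (\<lambda>t. y t * frob (xi' \<beta> (Xi t) + outer h h) (path_deriv Xi t)) =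
        integral {tau 0..tau m} (\<lambda>t. x t * ((xi' \<beta> (Pe t) + outer h h) \<bullet> De t))"
    proof (rule integral_change_time)
      show "(\<lambda>t. x t * ((xi' \<beta> (Pe t) + outer h h) \<bullet> De t)) absolutely_integrable_on {tau 0..tau m}"
        using mono_scaleR_continuous_absolutely_integrable[OF x_mono c] by (simp add: tau_0 tau_m)
      show "y s * frob (xi' \<beta> (Xi s) + outer h h) (path_deriv Xi s) =
          tau' s *\<^sub>R (x (tau s) * ((xi' \<beta> (Pe (tau s)) + outer h h) \<bullet> De (tau s)))"
        if "s \<in> {0..m}" for s
        using that tau_range[OF that]
        by (simp add: path_deriv_Xi y_def Xi_def frob_scaleR_right frob_symmetric_eq_inner[OF De_sym])
    qed (use m_pos in auto)
    then show ?thesis by (simp add: J1_eq tau_0 tau_m)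
  qed
  have 3: "integral {0..T} (\<lambda>t. frob (matrix_inv (hat_path y Xi t)) (path_deriv Xi t)) = J3 e"
  proof -
    have c: "continuous_on {0..T} (\<lambda>t. matrix_inv (H t + e *\<^sub>R HK t) \<bullet> De t)"
      using T by (intro continuous_intros continuous_on_matrix_inv He_posdef continuous_on_subset[OF H_cont]
          continuous_on_subset[OF HK_cont] continuous_on_subset[OF De_cont]) auto
    have "integral {0..T} (\<lambda>t. frob (matrix_inv (hat_path y Xi t)) (path_deriv Xi t)) =
        integral {tau 0..tau T} (\<lambda>t. matrix_inv (H t + e *\<^sub>R HK t) \<bullet> De t)"
    proof (rule integral_change_time)
      show "(\<lambda>t. matrix_inv (H t + e *\<^sub>R HK t) \<bullet> De t) absolutely_integrable_on {tau 0..tau T}"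
        using c by (simp add: tau_0 tau_T absolutely_integrable_continuous_real)
      show "frob (matrix_inv (hat_path y Xi s)) (path_deriv Xi s) =
          tau' s *\<^sub>R (matrix_inv (H (tau s) + e *\<^sub>R HK (tau s)) \<bullet> De (tau s))"
        if "s \<in> {0..T}" for s
      proof -
        have "s \<in> {0..m}" using that T by simp
        then show ?thesis using tau_range[of s]
          by (simp add: path_deriv_Xi hat_path_y frob_scaleR_right frob_symmetric_eq_inner[OF De_sym])
      qed
    qed (use T_range in auto)
    then show ?thesis by (simp add: J3_def De_def tau_0 tau_T)
  qed
  have "Xi m - Xi T = Q - \<Phi> T"
    using Pe_outside[of m] Pe_outside[of T] T Phi_ends by (simp add: Xi_def tau_m tau_T)
  then show ?thesis
    unfolding crisanti_sommers_at_def m_def[symmetric] by (simp add: 1 3 J_def)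
qed

text \<open>The functional takes its cutoff by Hilbert choice. Equivalent predicates mean equal
  choices, so both pairs are evaluated at the same \<open>T\<close>.\<close>

lemma cutoff_choice_eq:
  "(T' \<in> {t_top m y<..<m} \<and> det (Xi m - Xi T') > 0) \<longleftrightarrow> (T' \<in> {ttop<..<m} \<and> det (\<Phi> m - \<Phi> T') > 0)"
  using Pe_outside[of m] Pe_outside[of T'] tau_outside[of T'] T by (auto simp: Xi_def tau_m t_top_y)

end

context cs_variation
begin

lemma crisanti_sommers_at_x: "crisanti_sommers_at T \<beta> h x \<Phi> = J 0"
proof -
  have "frob A (D t) = A \<bullet> D t" if "t \<in> {0..m}" for A t
    by (rule frob_symmetric_eq_inner[OF psd_symmetric[OF D_psd[OF that]]])
  then have "integral {0..m} (\<lambda>t. x t * frob (xi' \<beta> (\<Phi> t) + outer h h) (D t)) = J1 0"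
    "integral {0..T} (\<lambda>t. frob (matrix_inv (H t)) (D t)) = J3 0"
    unfolding J1_def J3_def using T by (auto intro!: integral_cong)
  then show ?thesis
    unfolding crisanti_sommers_at_def m_def[symmetric] D_def[symmetric] H_def[symmetric]
    by (simp add: J_def Phi_ends)
qed

lemma J_min:
  assumes min: "cs_minimizer \<beta> h Q x \<Phi>"
    and T_choice: "T = (SOME T'. T' \<in> {ttop<..<m} \<and> det (\<Phi> m - \<Phi> T') > 0)"
    and e: "0 \<le> e" "e \<le> e0"
  shows "J 0 \<le> J e"
proof -
  interpret s: cs_step \<beta> h Q x \<Phi> m T K e0 L e by unfold_locales (use e in auto)
  have "crisanti_sommers \<beta> h x \<Phi> = J 0"
    unfolding crisanti_sommers_def m_def[symmetric] T_choice[symmetric] by (rule crisanti_sommers_at_x)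
  moreover have "crisanti_sommers \<beta> h s.y s.Xi = J e"
    unfolding crisanti_sommers_def m_def[symmetric] s.cutoff_choice_eq T_choice[symmetric]
    by (rule s.crisanti_sommers_at_y)
  moreover have "crisanti_sommers \<beta> h x \<Phi> \<le> crisanti_sommers \<beta> h s.y s.Xi"
    using min s.admissible_y_Xi by (simp add: cs_minimizer_def)
  ultimately show ?thesis by simp
qed


section \<open>The first variation\<close>

lemma J1_deriv:
  "(J1 has_real_derivative integral {0..m} (\<lambda>t. x t *
      (hadamard (xi'' \<beta> (\<Phi> t)) (Psi t) \<bullet> D t + (xi' \<beta> (\<Phi> t) + outer h h) \<bullet> K t))) (at 0 within {0..e0})"
proof -
  define P where "P e t = \<Phi> t + e *\<^sub>R Psi t" for e t
  define a where "a e t = (xi' \<beta> (P e t) + outer h h) \<bullet> (D t + e *\<^sub>R K t)" for e t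
  define a' where "a' e t = hadamard (xi'' \<beta> (P e t)) (Psi t) \<bullet> (D t + e *\<^sub>R K t)
      + (xi' \<beta> (P e t) + outer h h) \<bullet> K t" for e t
  have P_bd: "\<bar>P e t $ i $ j\<bar> < 2" if "e \<in> {0..e0}" "t \<in> {0..m}" for e t i j
  proof -
    interpret s: cs_step \<beta> h Q x \<Phi> m T K e0 L e by unfold_locales (use that in auto)
    show ?thesis using s.Pe_entry[OF that(2)] by (simp add: s.Pe_def P_def)
  qed
  have snd: "continuous_on ({0..e0} \<times> {0..m}) (\<lambda>p. f (snd p))" if "continuous_on {0..m} f"
    for f :: "real \<Rightarrow> real^'n^'n"
    by (rule continuous_on_compose2[OF that]) (auto intro!: continuous_intros)
  have P_cont: "continuous_on ({0..e0} \<times> {0..m}) (\<lambda>p. P (fst p) (snd p))"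
    unfolding P_def by (intro continuous_intros snd Phi_cont Psi_cont)
  have xi_cont: "continuous_on ({0..e0} \<times> {0..m}) (\<lambda>p. xi' \<beta> (P (fst p) (snd p)))"
    "continuous_on ({0..e0} \<times> {0..m}) (\<lambda>p. xi'' \<beta> (P (fst p) (snd p)))"
    by (rule continuous_on_xi[OF mix P_cont]; use P_bd in auto)+
  have a'_cont: "continuous_on ({0..e0} \<times> {0..m}) (\<lambda>p. a' (fst p) (snd p))"
    unfolding a'_def by (intro continuous_intros snd xi_cont Psi_cont D_cont K_cont)
  have a_cont: "continuous_on ({0..e0} \<times> {0..m}) (\<lambda>p. a (fst p) (snd p))"
    unfolding a_def by (intro continuous_intros snd xi_cont D_cont K_cont)
  have deriv: "((\<lambda>e. a e t) has_real_derivative a' e t) (at e within {0..e0})"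
    if "e \<in> {0..e0}" "t \<in> {0..m}" for e t
  proof -
    have Pd: "((\<lambda>e. P e t) has_vector_derivative Psi t) (at e within {0..e0})"
      unfolding P_def by (auto intro!: derivative_eq_intros)
    have "((\<lambda>e. xi' \<beta> (P e t)) has_vector_derivative hadamard (xi'' \<beta> (P e t)) (Psi t)) (at e within {0..e0})"
    proof (rule has_vector_derivative_matrixI)
      fix i j
      have "((\<lambda>e. dxi \<beta> i j (P e t $ i $ j)) has_real_derivative ddxi \<beta> i j (P e t $ i $ j) * Psi t $ i $ j)
          (at e within {0..e0})"
        by (rule DERIV_chain'[OF has_real_derivative_matrix_entry[OF Pd]
              has_field_derivative_dxi[OF mix P_bd[OF that]]])
      then have "((\<lambda>e. xi' \<beta> (P e t) $ i $ j) has_real_derivative ddxi \<beta> i j (P e t $ i $ j) * Psi t $ i $ j)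
          (at e within {0..e0})"
        by (rule has_field_derivative_transform_within[OF _ zero_less_one that(1)])
          (simp add: xi'_entry[OF mix P_bd[OF _ that(2)]])
      then show "((\<lambda>e. xi' \<beta> (P e t) $ i $ j) has_real_derivative hadamard (xi'' \<beta> (P e t)) (Psi t) $ i $ j)
          (at e within {0..e0})"
        by (simp add: hadamard_def xi''_entry[OF mix P_bd[OF that]])
    qed
    moreover have "((\<lambda>e. D t + e *\<^sub>R K t) has_vector_derivative K t) (at e within {0..e0})"
      by (auto intro!: derivative_eq_intros)
    ultimately have "((\<lambda>e. (xi' \<beta> (P e t) + outer h h) \<bullet> (D t + e *\<^sub>R K t)) has_vector_derivative
       (xi' \<beta> (P e t) + outer h h) \<bullet> K t + (hadamard (xi'' \<beta> (P e t)) (Psi t) + 0) \<bullet> (D t + e *\<^sub>R K t)) (at e within {0..e0})"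
      by (intro bounded_bilinear.has_vector_derivative[OF bounded_bilinear_inner] has_vector_derivative_add
          has_vector_derivative_const)
    then show ?thesis
      by (simp add: a_def a'_def has_real_derivative_iff_has_vector_derivative add.commute)
  qed
  have "((\<lambda>e. integral {0..m} (\<lambda>t. x t * a e t)) has_real_derivative integral {0..m} (\<lambda>t. x t * a' 0 t)) (at 0 within {0..e0})"
  proof (rule weighted_leibniz_rule[OF e0])
    show "continuous_on ({0..e0} \<times> {0..m}) (\<lambda>(e, t). a' e t)" using a'_cont by (simp add: case_prod_unfold)
    show "\<bar>x t\<bar> \<le> 1" if "t \<in> {0..m}" for t using order_param_range[OF op that] by simp
  qed (use m_pos deriv continuous_on_slice[OF a_cont] continuous_on_slice[OF a'_cont] e0 in \<open>auto intro!: mono_mult_continuous_integrable[OF x_mono]\<close>)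
  then show ?thesis
    unfolding J1_def[abs_def] by (simp add: a_def a'_def P_def)
qed

lemma J3_deriv:
  "(J3 has_real_derivative integral {0..T} (\<lambda>t. R t \<bullet> K t - (R t ** HK t ** R t) \<bullet> D t)) (at 0 within {0..e0})"
proof -
  define He where "He e t = H t + e *\<^sub>R HK t" for e t
  define a where "a e t = matrix_inv (He e t) \<bullet> (D t + e *\<^sub>R K t)" for e t
  define a' where "a' e t = matrix_inv (He e t) \<bullet> K t
    + (- (matrix_inv (He e t) ** HK t ** matrix_inv (He e t))) \<bullet> (D t + e *\<^sub>R K t)" for e t
  have det: "det (He e t) \<noteq> 0" if "e \<in> {0..e0}" "t \<in> {0..T}" for e t
  proof -
    interpret s: cs_step \<beta> h Q x \<Phi> m T K e0 L e by unfold_locales (use that in auto)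
    show ?thesis using s.He_posdef[OF that(2)] by (simp add: He_def)
  qed
  have snd: "continuous_on ({0..e0} \<times> {0..T}) (\<lambda>p. f (snd p))" if "continuous_on {0..m} f"
    for f :: "real \<Rightarrow> real^'n^'n"
    by (rule continuous_on_compose2[OF that]) (use T in \<open>auto intro!: continuous_intros\<close>)
  have inv_cont: "continuous_on ({0..e0} \<times> {0..T}) (\<lambda>p. matrix_inv (He (fst p) (snd p)))"
  proof (rule continuous_on_matrix_inv)
    show "continuous_on ({0..e0} \<times> {0..T}) (\<lambda>p. He (fst p) (snd p))"
      unfolding He_def by (intro continuous_intros snd H_cont HK_cont)
  qed (use det in auto)
  have a'_cont: "continuous_on ({0..e0} \<times> {0..T}) (\<lambda>p. a' (fst p) (snd p))"
    unfolding a'_def by (intro continuous_intros snd inv_cont HK_cont D_cont K_cont)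
  have a_cont: "continuous_on ({0..e0} \<times> {0..T}) (\<lambda>p. a (fst p) (snd p))"
    unfolding a_def by (intro continuous_intros snd inv_cont D_cont K_cont)
  have deriv: "((\<lambda>e. a e t) has_real_derivative a' e t) (at e within {0..e0})"
    if "e \<in> {0..e0}" "t \<in> {0..T}" for e t
  proof -
    have "((\<lambda>e. He e t) has_vector_derivative HK t) (at e within {0..e0})"
      unfolding He_def by (auto intro!: derivative_eq_intros)
    then have "((\<lambda>e. matrix_inv (He e t)) has_vector_derivative
        - (matrix_inv (He e t) ** HK t ** matrix_inv (He e t))) (at e within {0..e0})"
      by (rule has_vector_derivative_matrix_inv)
        (use det that in \<open>auto simp: He_def intro!: continuous_intros\<close>)
    moreover have "((\<lambda>e. D t + e *\<^sub>R K t) has_vector_derivative K t) (at e within {0..e0})"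
      by (auto intro!: derivative_eq_intros)
    ultimately show ?thesis
      unfolding a_def a'_def has_real_derivative_iff_has_vector_derivative
      by (rule bounded_bilinear.has_vector_derivative[OF bounded_bilinear_inner])
  qed
  have "((\<lambda>e. integral {0..T} (\<lambda>t. 1 * a e t)) has_real_derivative integral {0..T} (\<lambda>t. 1 * a' 0 t)) (at 0 within {0..e0})"
  proof (rule weighted_leibniz_rule[OF e0])
    show "continuous_on ({0..e0} \<times> {0..T}) (\<lambda>(e, t). a' e t)" using a'_cont by (simp add: case_prod_unfold)
  qed (use T_range deriv continuous_on_slice[OF a_cont] continuous_on_slice[OF a'_cont] e0 in \<open>auto intro!: integrable_continuous_real\<close>)
  then show ?thesis
    unfolding J3_def[abs_def] by (simp add: a_def a'_def He_def R_def)
qed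

lemma HK_deriv:
  assumes "t \<in> {0<..<m}" "continuous (at t within {0..m}) x"
  shows "(HK has_vector_derivative - (x t *\<^sub>R K t)) (at t)"
  unfolding HK_def[abs_def] by (rule integral_mono_weight_deriv[OF x_mono K_cont assms])

lemma HK_T: "HK T = 0"
proof -
  have "((\<lambda>s. x s *\<^sub>R K s) has_integral 0) {T..m}"
    by (rule has_integral_is_0) (use T K_zero in auto)
  then show ?thesis unfolding HK_def by (rule integral_unique)
qed

lemma N_cont: "continuous_on {0..T} N"
  using N_deriv by (meson continuous_on_eq_continuous_within has_vector_derivative_continuous)

text \<open>Integration by parts: the function \<open>R \<bullet> Psi - N \<bullet> HK\<close> vanishes at both ends.\<close>

lemma J3_deriv_by_parts:
  "integral {0..T} (\<lambda>t. R t \<bullet> K t - (R t ** HK t ** R t) \<bullet> D t) =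
   - integral {0..T} (\<lambda>t. x t * ((R t ** D t ** R t) \<bullet> Psi t + N t \<bullet> K t))"
proof -
  define S where "S t = R t \<bullet> Psi t - N t \<bullet> HK t" for t
  define u where "u t = R t \<bullet> K t - (R t ** D t ** R t) \<bullet> HK t" for t
  define v where "v t = (R t ** D t ** R t) \<bullet> Psi t + N t \<bullet> K t" for t
  define Z where "Z = {t\<in>{0..m}. \<not> continuous (at t within {0..m}) x}"
  have HKT: "continuous_on {0..T} HK" using T by (intro continuous_on_subset[OF HK_cont]) auto
  have u: "continuous_on {0..T} u"
    unfolding u_def by (intro continuous_intros R_cont K_cont RDR_cont HKT)
  have v: "continuous_on {0..T} v"
    unfolding v_def by (intro continuous_intros K_cont RDR_cont Psi_cont N_cont)
  have xT: "mono_on {0..T} x" using x_mono T by (auto simp: mono_on_def)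
  have iu: "u integrable_on {0..T}" and iv: "(\<lambda>t. x t * v t) integrable_on {0..T}"
    using u v xT by (auto intro: integrable_continuous_real mono_mult_continuous_integrable)
  have "integral {0..T} (\<lambda>t. u t + x t * v t) = S T - S 0"
  proof (rule integral_deriv_off_countable)
    show "countable Z" unfolding Z_def by (rule x_discont)
    show "continuous_on {0..T} S"
      unfolding S_def by (intro continuous_intros R_cont Psi_cont N_cont HKT)
    fix t assume "t \<in> {0<..<T} - Z"
    then have t: "t \<in> {0<..<T}" "t \<in> {0<..<m}" and c: "continuous (at t within {0..m}) x"
      using T by (auto simp: Z_def)
    have int: "at t within {0..T} = at t" "at t within {0..m} = at t" using t by (auto intro!: at_within_interior)
    have Nd: "(N has_vector_derivative R t ** D t ** R t) (at t)"
      using N_deriv[of t] t by (simp add: int)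
    \<comment> \<open>The product rule with \<open>R' = x N'\<close> and \<open>HK' = - x K\<close>:
      the terms free of \<open>x\<close> form \<open>u\<close>, those with \<open>x\<close> form
      \<open>v\<close>.\<close>
    have "(S has_vector_derivative
        (R t \<bullet> K t + (x t *\<^sub>R (R t ** D t ** R t)) \<bullet> Psi t) -
        (N t \<bullet> (- (x t *\<^sub>R K t)) + (R t ** D t ** R t) \<bullet> HK t)) (at t)"
      unfolding S_def
      by (intro has_vector_derivative_diff bounded_bilinear.has_vector_derivative[OF bounded_bilinear_inner]
          R_deriv[OF t(1) c] HK_deriv[OF t(2) c] Nd Psi_deriv)
    then show "(S has_real_derivative u t + x t * v t) (at t)"
      by (simp add: has_real_derivative_iff_has_vector_derivative u_def v_def algebra_simps)
    have "isCont u t" "isCont v t"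
      using u v t int(1) by (auto simp: continuous_on_eq_continuous_within) (metis atLeastAtMost_iff less_imp_le)+
    moreover have "isCont x t" using c by (simp add: int)
    ultimately show "isCont (\<lambda>t. u t + x t * v t) t" by (intro continuous_intros)
  qed (use T_range iu iv in \<open>auto intro: integrable_add\<close>)
  also have "S T = 0" using Psi_zero[of T] T HK_T by (simp add: S_def)
  also have "S 0 = 0" using Psi_zero[of 0] by (simp add: S_def N_def)
  finally have "integral {0..T} u + integral {0..T} (\<lambda>t. x t * v t) = 0"
    using iu iv by (simp add: Henstock_Kurzweil_Integration.integral_add)
  moreover have "integral {0..T} (\<lambda>t. R t \<bullet> K t - (R t ** HK t ** R t) \<bullet> D t) = integral {0..T} u"
  proof (rule integral_cong)
    fix t assume t: "t \<in> {0..T}"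
    \<comment> \<open>Moving the symmetric \<open>R\<close> through the trace exchanges
      \<open>HK\<close> and \<open>D\<close>.\<close>
    have "(R t ** HK t ** R t) \<bullet> D t = (R t ** D t ** R t) \<bullet> HK t"
      using inner_matrix_mult_sym[OF R_sym[OF t]] by (metis inner_commute matrix_mul_assoc)
    then show "R t \<bullet> K t - (R t ** HK t ** R t) \<bullet> D t = u t" by (simp add: u_def)
  qed
  ultimately show ?thesis by (simp add: v_def)
qed

text \<open>Difference quotients of \<open>J\<close> at a minimum are nonnegative from the right,
  the only side on which competitors exist.\<close>

lemma first_variation_nonneg:
  assumes min: "cs_minimizer \<beta> h Q x \<Phi>"
    and T_choice: "T = (SOME T'. T' \<in> {ttop<..<m} \<and> det (\<Phi> m - \<Phi> T') > 0)"
  shows "0 \<le> integral {0..m} (\<lambda>t. x t * (dM t \<bullet> Psi t + M t \<bullet> K t))"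
proof -
  define g1 where "g1 t = hadamard (xi'' \<beta> (\<Phi> t)) (Psi t) \<bullet> D t + (xi' \<beta> (\<Phi> t) + outer h h) \<bullet> K t" for t
  define v where "v t = (R t ** D t ** R t) \<bullet> Psi t + N t \<bullet> K t" for t
  define I where "I = integral {0..m} (\<lambda>t. x t * g1 t) - integral {0..T} (\<lambda>t. x t * v t)"
  have "(J has_real_derivative 1 / 2 * I) (at 0 within {0..e0})"
    unfolding J_def[abs_def] I_def g1_def v_def
    using J1_deriv J3_deriv unfolding J3_deriv_by_parts
    by (auto intro!: derivative_eq_intros)
  then have lim: "((\<lambda>e. (J e - J 0) / (e - 0)) \<longlongrightarrow> 1 / 2 * I) (at 0 within {0..e0})"
    by (simp add: has_field_derivative_iff)
  have "\<forall>\<^sub>F e in at 0 within {0..e0}. 0 \<le> (J e - J 0) / (e - 0)"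
    unfolding eventually_at_filter
    by (intro always_eventually allI impI) (use J_min[OF min T_choice] in auto)
  moreover have "at 0 within {0..e0} \<noteq> bot" using e0 by (simp add: trivial_limit_within)
  ultimately have "0 \<le> 1 / 2 * I" using lim tendsto_lowerbound by blast
  \<comment> \<open>Past \<open>T\<close> both \<open>Psi\<close> and \<open>K\<close> vanish, so
    the integral extends to \<open>m\<close> although the hat path may be singular there.\<close>
  moreover have "integral {0..T} (\<lambda>t. x t * v t) = integral {0..m} (\<lambda>t. x t * v t)"
    and v: "(\<lambda>t. x t * v t) integrable_on {0..m}"
  proof -
    have xT: "mono_on {0..T} x" using x_mono T by (auto simp: mono_on_def)
    have "continuous_on {0..T} v"
      unfolding v_def by (intro continuous_intros K_cont RDR_cont Psi_cont N_cont)
    then have 1: "((\<lambda>t. x t * v t) has_integral integral {0..T} (\<lambda>t. x t * v t)) {0..T}"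
      by (intro integrable_integral mono_mult_continuous_integrable xT)
    have 2: "((\<lambda>t. x t * v t) has_integral 0) {T..m}"
      by (rule has_integral_is_0) (use T K_zero Psi_zero in \<open>auto simp: v_def\<close>)
    have "((\<lambda>t. x t * v t) has_integral integral {0..T} (\<lambda>t. x t * v t) + 0) {0..m}"
      using T T_range by (intro has_integral_combine[OF _ _ 1 2]) auto
    then show "integral {0..T} (\<lambda>t. x t * v t) = integral {0..m} (\<lambda>t. x t * v t)"
      "(\<lambda>t. x t * v t) integrable_on {0..m}" by (auto simp: integral_unique)
  qed
  moreover have "(\<lambda>t. x t * g1 t) integrable_on {0..m}"
  proof (rule mono_mult_continuous_integrable[OF x_mono])
    have "\<bar>\<Phi> t $ i $ j\<bar> < 2" if "t \<in> {0..m}" for t i j using Phi_entry[OF that, of i j] by linarith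
    then show "continuous_on {0..m} g1"
      unfolding g1_def by (intro continuous_intros continuous_on_xi[OF mix Phi_cont] Psi_cont D_cont K_cont) auto
  qed
  ultimately have "0 \<le> integral {0..m} (\<lambda>t. x t * g1 t - x t * v t)"
    unfolding I_def by (simp add: Henstock_Kurzweil_Integration.integral_diff)
  \<comment> \<open>The integrand is \<open>x\<close> times the derivative of
    \<open>M t \<bullet> Psi t\<close>; symmetry of the Hadamard pairing exchanges
    \<open>Psi\<close> and \<open>D\<close> in the second-derivative term.\<close>
  also have "(\<lambda>t. x t * g1 t - x t * v t) = (\<lambda>t. x t * (dM t \<bullet> Psi t + M t \<bullet> K t))"
    by (simp add: fun_eq_iff g1_def v_def dM_def M_def inner_diff_left inner_add_left hadamard_inner_commute
        algebra_simps)
  finally show ?thesis .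
qed

end

subsection \<open>Transporting increments of the path\<close>

text \<open>A tent divided by its integral. It enters the derivative of the competitor, hence the
  Lipschitz bound.\<close>

lemma lipschitz_bump:
  fixes p q :: real
  assumes "p < q"
  obtains f L where "L-lipschitz_on UNIV f" "\<And>t. 0 \<le> f t" "\<And>t. t \<notin> {p<..<q} \<Longrightarrow> f t = 0"
    "\<And>u v. u \<le> p \<Longrightarrow> q \<le> v \<Longrightarrow> (f has_integral (1::real)) {u..v}"
proof -
  define g where "g t = max 0 (min (t - p) (q - t))" for t
  have g_lip: "1-lipschitz_on UNIV g"
    by (rule lipschitz_onI) (auto simp: g_def dist_real_def max_def min_def abs_if)
  have g_nn: "0 \<le> g t" and g_out: "t \<notin> {p<..<q} \<Longrightarrow> g t = 0" for t
    by (auto simp: g_def max_def min_def)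
  have gc: "continuous_on {p..q} g"
    using lipschitz_on_continuous_on[OF g_lip] continuous_on_subset by blast
  define c where "c = integral {p..q} g"
  have "c \<noteq> 0"
  proof
    assume "c = 0"
    then have "\<forall>t\<in>{p..q}. g t = 0"
      using integral_eq_0_iff[OF gc assms] g_nn by (auto simp: c_def)
    then have "g ((p + q) / 2) = 0" using assms by simp
    then show False using assms by (simp add: g_def max_def min_def split: if_splits)
  qed
  moreover have "0 \<le> c" unfolding c_def using gc g_nn by (intro integral_nonneg integrable_continuous_real) auto
  ultimately have c: "0 < c" by simp
  have "(g has_integral c) {u..v}" if "u \<le> p" "q \<le> v" for u v
  proof (rule has_integral_on_superset[of _ _ "{p..q}"])
    show "(g has_integral c) {p..q}" unfolding c_def using gc by (intro integrable_integral integrable_continuous_real)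
  qed (use that g_out in auto)
  then have int: "((\<lambda>t. (1 / c) * g t) has_integral 1) {u..v}" if "u \<le> p" "q \<le> v" for u v
    using has_integral_mult_right[of g c "{u..v}" "1 / c"] that c by simp
  show ?thesis
  proof (rule that)
    show "(\<bar>1 / c\<bar> * 1)-lipschitz_on UNIV (\<lambda>t. (1 / c) * g t)"
      using lipschitz_on_cmult_real[OF g_lip, of "1 / c"] c by simp
  qed (use int c g_nn g_out in auto)
qed

lemma continuous_on_Icc_norm_bound:
  fixes f :: "real \<Rightarrow> 'a::real_normed_vector"
  assumes "continuous_on {a..b} f"
  obtains B where "0 \<le> B" "\<And>t. t \<in> {a..b} \<Longrightarrow> norm (f t) \<le> B"
proof -
  have "bounded (f ` {a..b})" using assms by (intro compact_imp_bounded compact_continuous_image) auto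
  then obtain B where "0 < B" "\<forall>y\<in>f ` {a..b}. norm y \<le> B" unfolding bounded_pos by blast
  then show ?thesis using that[of B] by auto
qed

lemma weighted_integral_bounds:
  fixes \<theta> f :: "real \<Rightarrow> real"
  assumes \<theta>: "\<And>t. t \<in> {u..v} \<Longrightarrow> 0 \<le> \<theta> t" "continuous_on {u..v} \<theta>" and f: "continuous_on {u..v} f"
    and lower: "\<And>t. t \<in> {u..v} \<Longrightarrow> \<theta> t \<noteq> 0 \<Longrightarrow> l \<le> f t"
  shows "l * integral {u..v} \<theta> \<le> integral {u..v} (\<lambda>t. \<theta> t * f t)"
proof -
  have "integral {u..v} (\<lambda>t. l * \<theta> t) \<le> integral {u..v} (\<lambda>t. \<theta> t * f t)"
  proof (rule integral_le)
    fix t assume t: "t \<in> {u..v}"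
    show "l * \<theta> t \<le> \<theta> t * f t"
      using lower[OF t] \<theta>(1)[OF t] by (cases "\<theta> t = 0") (auto simp: mult.commute intro!: mult_left_mono)
  qed (auto intro!: integrable_continuous_real continuous_intros \<theta> f)
  then show ?thesis by simp
qed

text \<open>\<open>T\<close> is now the cutoff selected by the functional itself, which lets
  minimality be read off from values at one common cutoff.\<close>

locale cs_min_pair = cs_pair \<beta> h Q x \<Phi> m T
  for \<beta> :: "nat \<Rightarrow> real^'n" and h Q x \<Phi> m T +
  assumes min: "cs_minimizer \<beta> h Q x \<Phi>"
    and T_choice: "T = (SOME T'. T' \<in> {ttop<..<m} \<and> det (\<Phi> m - \<Phi> T') > 0)"
begin

text \<open>The increments \<open>\<theta> t *\<^sub>R D t\<close> are removed and their sum
  \<open>C\<close> is inserted with profile \<open>b\<close>; \<open>P\<close> is the resulting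
  change of the path. The first variation is the integral of \<open>x\<close> times the derivative
  of \<open>M t \<bullet> P t\<close>: nonnegative by minimality and at most
  \<open>\<eta> - (x d2 - x d1) * \<kappa>\<close> by
  \<open>mono_weight_integral_upper\<close>.\<close>

lemma transport_bound:
  fixes \<theta> b :: "real \<Rightarrow> real"
  assumes \<theta>: "A-lipschitz_on UNIV \<theta>" "\<And>t. 0 \<le> \<theta> t" "\<And>t. t \<notin> {0<..<ttop} \<Longrightarrow> \<theta> t = 0"
    and b: "B-lipschitz_on UNIV b" "\<And>t. 0 \<le> b t" "\<And>t. t \<notin> {0<..<ttop} \<Longrightarrow> b t = 0" "(b has_integral 1) {0..m}"
  defines "C \<equiv> integral {0..m} (\<lambda>t. \<theta> t *\<^sub>R D t)"
  defines "P \<equiv> \<lambda>t. integral {0..t} b *\<^sub>R C - integral {0..t} (\<lambda>s. \<theta> s *\<^sub>R D s)"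
  assumes d: "0 \<le> d1" "d1 \<le> d2" "d2 \<le> m" and \<eta>: "0 \<le> \<eta>"
    and lower: "\<And>t. t \<in> {0..m} \<Longrightarrow> - \<eta> \<le> M t \<bullet> P t" and lower': "\<And>t. t \<in> {d1..d2} \<Longrightarrow> \<kappa> \<le> M t \<bullet> P t"
  shows "(x d2 - x d1) * \<kappa> \<le> \<eta>"
proof -
  define K where "K t = b t *\<^sub>R C - \<theta> t *\<^sub>R D t" for t
  have \<theta>c: "continuous_on S \<theta>" and bc: "continuous_on S b" for S
    using lipschitz_on_continuous_on[OF \<theta>(1)] lipschitz_on_continuous_on[OF b(1)] continuous_on_subset by blast+
  have \<theta>D_cont: "continuous_on {0..m} (\<lambda>t. \<theta> t *\<^sub>R D t)" by (intro continuous_intros \<theta>c D_cont)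
  have \<theta>D_int: "(\<lambda>t. \<theta> t *\<^sub>R D t) integrable_on {0..t}" if "t \<le> m" for t
    using that by (intro integrable_continuous_real continuous_on_subset[OF \<theta>D_cont]) auto
  have C: "psd C" unfolding C_def by (intro psd_integral \<theta>D_int psd_scaleR D_psd \<theta>(2)) auto
  obtain B\<theta> where B\<theta>0: "0 \<le> B\<theta>" and B\<theta>: "\<And>t. t \<in> {0..m} \<Longrightarrow> \<bar>\<theta> t\<bar> \<le> B\<theta>"
    using continuous_on_Icc_norm_bound[OF \<theta>c] by (metis real_norm_def)
  obtain BD where BD0: "0 \<le> BD" and BD: "\<And>t. t \<in> {0..m} \<Longrightarrow> norm (D t) \<le> BD"
    using continuous_on_Icc_norm_bound[OF D_cont] by blast
  \<comment> \<open>\<open>D\<close> is controlled only on \<open>[0,m]\<close>, but the direction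
    has to be Lipschitz on the line. Clamping the time changes nothing, as \<open>\<theta>\<close>
    vanishes outside.\<close>
  define cl where "cl t = max 0 (min m t)" for t
  have cl: "1-lipschitz_on UNIV cl" "cl t \<in> {0..m}" for t
    using m_pos by (auto intro!: lipschitz_onI simp: cl_def dist_real_def max_def min_def abs_if)
  obtain LD where LD: "LD-lipschitz_on {0..m} D" using D_lipschitz .
  have "(A * BD + B\<theta> * LD)-lipschitz_on {0..m} (\<lambda>t. \<theta> t *\<^sub>R D t)"
    using B\<theta> BD B\<theta>0 BD0 by (intro lipschitz_on_bounded_scaleR lipschitz_on_subset[OF \<theta>(1)] LD) auto
  then have "((A * BD + B\<theta> * LD) * 1)-lipschitz_on UNIV (\<lambda>t. \<theta> (cl t) *\<^sub>R D (cl t))"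
    by (intro lipschitz_on_compose2[OF cl(1), of _ "\<lambda>t. \<theta> t *\<^sub>R D t"]) (rule lipschitz_on_subset, use cl(2) in auto)
  moreover have "\<theta> (cl t) *\<^sub>R D (cl t) = \<theta> t *\<^sub>R D t" for t
    using \<theta>(3)[of t] \<theta>(3)[of "cl t"] ttop_range T by (cases "t \<in> {0..m}") (auto simp: cl_def max_def min_def)
  ultimately have "((A * BD + B\<theta> * LD) * 1)-lipschitz_on UNIV (\<lambda>t. \<theta> t *\<^sub>R D t)" by simp
  moreover have "(B * norm C + norm C * 0)-lipschitz_on UNIV (\<lambda>t. b t *\<^sub>R C)"
  proof (rule lipschitz_onI)
    show "0 \<le> B * norm C + norm C * 0" using lipschitz_on_nonneg[OF b(1)] by simp
    fix s t :: real
    have "dist (b s *\<^sub>R C) (b t *\<^sub>R C) = dist (b s) (b t) * norm C"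
      by (simp add: dist_norm flip: scaleR_left_diff_distrib)
    also have "\<dots> \<le> (B * dist s t) * norm C"
      by (intro mult_right_mono lipschitz_onD[OF b(1)]) auto
    finally show "dist (b s *\<^sub>R C) (b t *\<^sub>R C) \<le> (B * norm C + norm C * 0) * dist s t" by (simp add: mult_ac)
  qed
  ultimately obtain LK where LK: "LK-lipschitz_on UNIV K"
    unfolding K_def[abs_def] using lipschitz_on_diff by blast
  have "continuous_on {0..m} (\<lambda>t. trace (K t))"
    using lipschitz_on_continuous_on[OF LK] continuous_on_subset
    unfolding trace_def by (auto intro!: continuous_intros)
  then obtain BK where BK0: "0 \<le> BK" and BK: "\<And>t. t \<in> {0..m} \<Longrightarrow> \<bar>trace (K t)\<bar> \<le> BK"
    using continuous_on_Icc_norm_bound[of 0 m "\<lambda>t. trace (K t)"] by (metis real_norm_def)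
  \<comment> \<open>The first bound keeps \<open>1 - e0 * \<theta> t\<close> nonnegative, the second
    yields the trace condition; the added 1 avoids division by zero.\<close>
  define e0 where "e0 = Min {1 / (B\<theta> + 1), 1 / (2 * (BK + 1))}"
  have e0: "0 < e0" "e0 \<le> 1 / (B\<theta> + 1)" "e0 \<le> 1 / (2 * (BK + 1))" using B\<theta>0 BK0 by (auto simp: e0_def)
  have K_out: "K t = 0" if "t \<notin> {0<..<ttop}" for t using that \<theta>(3) b(3) by (simp add: K_def)
  have P_eq: "integral {0..t} K = P t" if "t \<le> m" for t
  proof -
    have "((\<lambda>s. b s *\<^sub>R C) has_integral integral {0..t} b *\<^sub>R C) {0..t}"
      using has_integral_linear[OF integrable_integral bounded_linear_scaleR_left, of b "{0..t}" C] bc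
      by (auto simp: comp_def integrable_continuous_real)
    then show ?thesis
      unfolding K_def P_def using \<theta>D_int[OF that] by (intro integral_unique has_integral_diff integrable_integral)
  qed
  interpret v: cs_variation \<beta> h Q x \<Phi> m T K e0 LK
  proof unfold_locales
    show "LK-lipschitz_on UNIV K" by (rule LK)
    show "K t = 0" if "t \<notin> {0..ttop}" for t using K_out[of t] that by auto
    show "integral {0..m} K = 0"
      using P_eq[of m] integral_unique[OF b(4)] by (simp add: P_def C_def)
    show "0 < e0" by (rule e0)
    show "psd (D t + e0 *\<^sub>R K t)" if t: "t \<in> {0..m}" for t
    proof -
      have "D t + e0 *\<^sub>R K t = (1 - e0 * \<theta> t) *\<^sub>R D t + (e0 * b t) *\<^sub>R C"
        by (simp add: K_def algebra_simps)
      moreover have "e0 * \<theta> t \<le> 1 / (B\<theta> + 1) * B\<theta>"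
        using e0 B\<theta>[OF t] \<theta>(2)[of t] B\<theta>0 by (intro mult_mono) auto
      moreover have "1 / (B\<theta> + 1) * B\<theta> \<le> 1" using B\<theta>0 by (simp add: divide_le_eq)
      ultimately show ?thesis
        using e0 b(2) C D_psd[OF t] by (auto intro!: psd_add psd_scaleR)
    qed
    show "e0 * \<bar>trace (K t)\<bar> \<le> 1 / 2" for t
    proof (cases "t \<in> {0..m}")
      case True
      have "e0 * \<bar>trace (K t)\<bar> \<le> 1 / (2 * (BK + 1)) * BK"
        using e0 BK[OF True] BK0 by (intro mult_mono) auto
      also have "\<dots> \<le> 1 / 2" using BK0 by (simp add: field_simps)
      finally show ?thesis .
    next
      case False
      then have "K t = 0" using K_out[of t] ttop_range by auto
      then show ?thesis by (simp add: trace_def)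
    qed
  qed
  have Psi: "v.Psi t = P t" if "t \<le> m" for t using P_eq[OF that] by (simp add: v.Psi_def)
  define F where "F t = M t \<bullet> v.Psi t" for t
  define F' where "F' t = dM t \<bullet> v.Psi t + M t \<bullet> K t" for t
  \<comment> \<open>\<open>M\<close> is differentiated only up to \<open>T\<close>; from
    \<open>T\<close> on \<open>F\<close> is identically zero, as \<open>Psi\<close> vanishes above
    \<open>ttop < T\<close>.\<close>
  have F_deriv: "(F has_vector_derivative F' t) (at t within {0..m})" if t: "t \<in> {0..m}" for t
  proof (cases "t < T")
    case True
    have "(F has_vector_derivative M t \<bullet> K t + dM t \<bullet> v.Psi t) (at t within {0..T})"
      unfolding F_def[abs_def] using t True
      by (intro bounded_bilinear.has_vector_derivative[OF bounded_bilinear_inner] M_deriv v.Psi_deriv) auto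
    moreover have "at t within {0..T} = at t within {0..m}"
      using True t T by (intro at_within_nhd[of _ "{..<T}"]) auto
    ultimately show ?thesis by (simp add: F'_def add.commute)
  next
    case False
    then have "F' t = 0" using v.Psi_zero[of t] K_out[of t] T by (simp add: F'_def)
    moreover have "(F has_vector_derivative 0) (at t)"
    proof (rule has_vector_derivative_transform_within_open[of "\<lambda>_. 0" _ _ "{ttop<..}"])
      show "0 = F s" if "s \<in> {ttop<..}" for s using that v.Psi_zero[of s] by (simp add: F_def)
    qed (use False T in auto)
    ultimately show ?thesis by (simp add: has_vector_derivative_at_within)
  qed
  have F'_cont: "continuous_on {0..m} F'"
  proof -
    have "continuous_on ({0..T} \<union> {T..m}) F'"
    proof (rule continuous_on_closed_Un)
      show "continuous_on {0..T} F'"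
      proof -
        have "\<bar>\<Phi> t $ i $ j\<bar> < 2" if "t \<in> {0..T}" for t i j
          using Phi_entry[of t i j] that T by auto
        then have "continuous_on {0..T} dM"
          unfolding dM_def using T
          by (intro continuous_intros RDR_cont continuous_on_xi[OF mix] continuous_on_subset[OF Phi_cont]
             continuous_on_subset[OF D_cont]) auto
        then show ?thesis unfolding F'_def by (intro continuous_intros M_cont v.Psi_cont v.K_cont)
      qed
      have "continuous_on {T..m} (\<lambda>_. 0 :: real)" by simp
      then show "continuous_on {T..m} F'"
        by (rule continuous_on_eq) (use v.Psi_zero K_out T in \<open>auto simp: F'_def\<close>)
    qed auto
    moreover have "{0..T} \<union> {T..m} = {0..m}" using T T_range by auto
    ultimately show ?thesis by simp
  qed
  have "integral {0..m} (\<lambda>t. x t * F' t) \<le> \<eta> - (x d2 - x d1) * \<kappa>"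
  proof (rule mono_weight_integral_upper[OF x_mono _ _ F_deriv F'_cont _ _ d _ _ \<eta>])
    show "0 \<le> x 0" "x m \<le> 1" using order_param_range[OF op] m_pos by auto
    show "F 0 = 0" "F m = 0" using v.Psi_zero[of 0] v.Psi_zero[of m] ttop_range by (auto simp: F_def)
    show "- \<eta> \<le> F t" if "t \<in> {0..m}" for t using lower[OF that] Psi that by (simp add: F_def)
    show "\<kappa> \<le> F t" if "t \<in> {d1..d2}" for t using lower'[OF that] Psi that d by (simp add: F_def)
  qed
  moreover have "0 \<le> integral {0..m} (\<lambda>t. x t * F' t)"
    unfolding F'_def by (rule v.first_variation_nonneg[OF min T_choice])
  ultimately show ?thesis by simp
qed

lemma inner_integral_weight:
  assumes "continuous_on UNIV \<theta>" "0 \<le> u" "v \<le> m"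
  shows "A \<bullet> integral {u..v} (\<lambda>r. \<theta> r *\<^sub>R D r) = integral {u..v} (\<lambda>r. \<theta> r * (A \<bullet> D r))"
proof -
  have "(\<lambda>r. \<theta> r *\<^sub>R D r) integrable_on {u..v}"
    using assms by (intro integrable_continuous_real continuous_intros continuous_on_subset[OF D_cont]
      continuous_on_subset[OF assms(1)]) auto
  from integral_linear[OF this bounded_linear_inner_right, of A] show ?thesis by (simp add: comp_def)
qed

lemma inner_D_cont: "0 \<le> u \<Longrightarrow> v \<le> m \<Longrightarrow> continuous_on {u..v} (\<lambda>r. A \<bullet> D r)"
  by (intro continuous_intros continuous_on_subset[OF D_cont]) auto

lemma unit_weight_integral:
  fixes b :: "real \<Rightarrow> real"
  assumes b: "\<And>t. 0 \<le> b t" "(b has_integral 1) {0..m}" and "0 \<le> u" "v \<le> m"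
  shows "0 \<le> integral {u..v} b" "integral {u..v} b \<le> 1"
proof -
  have int: "b integrable_on {0..m}" using b(2) by blast
  then have i: "b integrable_on {u..v}" by (rule integrable_subinterval_real) (use assms in auto)
  then show "0 \<le> integral {u..v} b" using b(1) by (intro integral_nonneg) auto
  have "integral {u..v} b \<le> integral {0..m} b"
    using assms by (intro integral_subset_le i int) auto
  then show "integral {u..v} b \<le> 1" using b(2) by (simp add: integral_unique)
qed

lemma integral_zero_outside:
  fixes f :: "real \<Rightarrow> 'a::banach"
  shows "(\<And>t. t \<in> S \<Longrightarrow> f t = 0) \<Longrightarrow> integral S f = 0"
  by (intro integral_unique has_integral_is_0)

text \<open>Increments of \<open>\<Phi>\<close> near \<open>q\<close> are removed and inserted again near \<open>p\<close>, which raises the path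
  in between; \<open>transport_to_right\<close> does the opposite.\<close>

lemma transport_to_left:
  assumes p: "0 \<le> p" "p < d1" "d1 < d2" "d2 \<le> r0" "r0 < q" "q \<le> ttop" and \<eta>: "0 \<le> \<eta>"
    and lower: "\<And>t r. t \<in> {p..q} \<Longrightarrow> r \<in> {r0..q} \<Longrightarrow> - \<eta> \<le> M t \<bullet> D r"
    and lower': "\<And>t r. t \<in> {d1..d2} \<Longrightarrow> r \<in> {r0..q} \<Longrightarrow> \<kappa> \<le> M t \<bullet> D r"
  shows "(x d2 - x d1) * \<kappa> \<le> \<eta>"
proof -
  have qm: "q < m" using p T by simp
  obtain b B where b: "B-lipschitz_on UNIV b" "\<And>t. 0 \<le> b t" "\<And>t. t \<notin> {p<..<d1} \<Longrightarrow> b t = 0"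
    "\<And>u v. u \<le> p \<Longrightarrow> d1 \<le> v \<Longrightarrow> (b has_integral (1::real)) {u..v}" by (rule lipschitz_bump[OF p(2)]) blast
  obtain \<theta> A where \<theta>: "A-lipschitz_on UNIV \<theta>" "\<And>t. 0 \<le> \<theta> t" "\<And>t. t \<notin> {r0<..<q} \<Longrightarrow> \<theta> t = 0"
    "\<And>u v. u \<le> r0 \<Longrightarrow> q \<le> v \<Longrightarrow> (\<theta> has_integral (1::real)) {u..v}" by (rule lipschitz_bump[OF p(5)]) blast
  have \<theta>c: "continuous_on UNIV \<theta>" by (rule lipschitz_on_continuous_on[OF \<theta>(1)])
  define C where "C = integral {0..m} (\<lambda>t. \<theta> t *\<^sub>R D t)"
  define P where "P t = integral {0..t} b *\<^sub>R C - integral {0..t} (\<lambda>s. \<theta> s *\<^sub>R D s)" for t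
  have \<theta>1: "(\<theta> has_integral 1) {0..m}" using \<theta>(4) p qm by simp
  have b1: "(b has_integral 1) {0..m}" using b(4) p qm by simp
  have MC: "l * integral {u..m} \<theta> \<le> M t \<bullet> integral {u..m} (\<lambda>t. \<theta> t *\<^sub>R D t)"
    if "\<And>r. r \<in> {r0..q} \<Longrightarrow> l \<le> M t \<bullet> D r" "0 \<le> u" for l t u
  proof -
    have "l * integral {u..m} \<theta> \<le> integral {u..m} (\<lambda>r. \<theta> r * (M t \<bullet> D r))"
      using that \<theta>(2) \<theta>(3) continuous_on_subset[OF \<theta>c]
      by (intro weighted_integral_bounds inner_D_cont) (auto, metis \<theta>(3) atLeastAtMost_iff greaterThanLessThan_iff less_imp_le)
    then show ?thesis using inner_integral_weight[OF \<theta>c that(2) order_refl] by simp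
  qed
  \<comment> \<open>Before \<open>r0\<close> nothing has been removed, so \<open>P\<close> is the
    part of \<open>C\<close> inserted so far.\<close>
  have left: "M t \<bullet> P t = integral {0..t} b * (M t \<bullet> C)" if "t \<le> r0" for t
  proof -
    have "integral {0..t} (\<lambda>s. \<theta> s *\<^sub>R D s) = 0"
      by (rule integral_zero_outside) (use that \<theta>(3) in auto)
    then show ?thesis by (simp add: P_def)
  qed
  \<comment> \<open>From \<open>r0\<close> on \<open>C\<close> is fully inserted, and
    \<open>P\<close> is what remains to be removed.\<close>
  have right: "P t = integral {t..m} (\<lambda>s. \<theta> s *\<^sub>R D s)" if "r0 \<le> t" "t \<le> m" for t
  proof -
    have "integral {0..t} b = 1" using b(4)[of 0 t] p that by (auto intro: integral_unique)
    moreover have "integral {0..t} (\<lambda>s. \<theta> s *\<^sub>R D s) + integral {t..m} (\<lambda>s. \<theta> s *\<^sub>R D s) = C"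
      unfolding C_def using that p
      by (intro Henstock_Kurzweil_Integration.integral_combine integrable_continuous_real continuous_intros D_cont
          continuous_on_subset[OF \<theta>c]) auto
    ultimately show ?thesis by (simp add: P_def algebra_simps)
  qed
  show ?thesis
  proof (rule transport_bound[of A \<theta> B b d1 d2 \<eta> \<kappa>, folded C_def, folded P_def])
    show "\<theta> t = 0" if "t \<notin> {0<..<ttop}" for t using \<theta>(3)[of t] that p by auto
    show "b t = 0" if "t \<notin> {0<..<ttop}" for t using b(3)[of t] that p by auto
    show "\<kappa> \<le> M t \<bullet> P t" if t: "t \<in> {d1..d2}" for t
    proof -
      have "integral {0..t} b = 1" using b(4)[of 0 t] p t by (auto intro: integral_unique)
      then show ?thesis
        using left[of t] MC[of \<kappa> t 0] lower'[OF t] t p integral_unique[OF \<theta>1] by (simp add: C_def)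
    qed
    show "- \<eta> \<le> M t \<bullet> P t" if t: "t \<in> {0..m}" for t
    proof -
      consider "t < p" | "t \<in> {p..r0}" | "t \<in> {r0..q}" | "q < t" using t by fastforce
      then show ?thesis
      proof cases
        case 1
        then have "integral {0..t} b = 0" by (intro integral_zero_outside) (use b(3) in auto)
        then show ?thesis using left[of t] 1 p \<eta> by simp
      next
        case 2
        have B: "0 \<le> integral {0..t} b" "integral {0..t} b \<le> 1"
          using unit_weight_integral[OF b(2) b1, of 0 t] t by auto
        have "- \<eta> \<le> M t \<bullet> C"
          using MC[of "- \<eta>" t 0] lower[of t] 2 p integral_unique[OF \<theta>1] by (simp add: C_def)
        then have "integral {0..t} b * - \<eta> \<le> M t \<bullet> P t"
          using left[of t] 2 B by (simp only: atLeastAtMost_iff) (intro mult_left_mono; simp)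
        moreover have "integral {0..t} b * \<eta> \<le> 1 * \<eta>" using B \<eta> by (intro mult_right_mono)
        ultimately show ?thesis by simp
      next
        case 3
        have B: "0 \<le> integral {t..m} \<theta>" "integral {t..m} \<theta> \<le> 1"
          using unit_weight_integral[OF \<theta>(2) \<theta>1, of t m] t by auto
        have "- \<eta> * integral {t..m} \<theta> \<le> M t \<bullet> P t"
          using MC[of "- \<eta>" t t] lower[of t] right[of t] 3 p qm by simp
        moreover have "\<eta> * integral {t..m} \<theta> \<le> \<eta> * 1" using B \<eta> by (intro mult_left_mono)
        ultimately show ?thesis by simp
      next
        case 4
        then have "integral {t..m} (\<lambda>s. \<theta> s *\<^sub>R D s) = 0" by (intro integral_zero_outside) (use \<theta>(3) in auto)
        then show ?thesis using right[of t] 4 t p \<eta> by simp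
      qed
    qed
  qed (use p qm \<eta> \<theta> b b1 in auto)
qed

lemma transport_to_right:
  assumes p: "0 \<le> p" "p < r0" "r0 \<le> d1" "d1 < d2" "d2 < q" "q \<le> ttop" and \<eta>: "0 \<le> \<eta>"
    and upper: "\<And>t r. t \<in> {p..q} \<Longrightarrow> r \<in> {p..r0} \<Longrightarrow> M t \<bullet> D r \<le> \<eta>"
    and upper': "\<And>t r. t \<in> {d1..d2} \<Longrightarrow> r \<in> {p..r0} \<Longrightarrow> M t \<bullet> D r \<le> - \<kappa>"
  shows "(x d2 - x d1) * \<kappa> \<le> \<eta>"
proof -
  have qm: "q < m" using p T by simp
  obtain b B where b: "B-lipschitz_on UNIV b" "\<And>t. 0 \<le> b t" "\<And>t. t \<notin> {d2<..<q} \<Longrightarrow> b t = 0"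
    "\<And>u v. u \<le> d2 \<Longrightarrow> q \<le> v \<Longrightarrow> (b has_integral (1::real)) {u..v}" by (rule lipschitz_bump[OF p(5)]) blast
  obtain \<theta> A where \<theta>: "A-lipschitz_on UNIV \<theta>" "\<And>t. 0 \<le> \<theta> t" "\<And>t. t \<notin> {p<..<r0} \<Longrightarrow> \<theta> t = 0"
    "\<And>u v. u \<le> p \<Longrightarrow> r0 \<le> v \<Longrightarrow> (\<theta> has_integral (1::real)) {u..v}" by (rule lipschitz_bump[OF p(2)]) blast
  have \<theta>c: "continuous_on UNIV \<theta>" by (rule lipschitz_on_continuous_on[OF \<theta>(1)])
  define C where "C = integral {0..m} (\<lambda>t. \<theta> t *\<^sub>R D t)"
  define P where "P t = integral {0..t} b *\<^sub>R C - integral {0..t} (\<lambda>s. \<theta> s *\<^sub>R D s)" for t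
  have \<theta>1: "(\<theta> has_integral 1) {0..m}" using \<theta>(4) p qm by simp
  have b1: "(b has_integral 1) {0..m}" using b(4) p qm by simp
  have MC: "l * integral {0..v} \<theta> \<le> - (M t \<bullet> integral {0..v} (\<lambda>t. \<theta> t *\<^sub>R D t))"
    if "\<And>r. r \<in> {p..r0} \<Longrightarrow> M t \<bullet> D r \<le> - l" "v \<le> m" for l t v
  proof -
    have "l * integral {0..v} \<theta> \<le> integral {0..v} (\<lambda>r. \<theta> r * ((- M t) \<bullet> D r))"
    proof (intro weighted_integral_bounds inner_D_cont)
      fix r assume "\<theta> r \<noteq> 0"
      then have "r \<in> {p..r0}" using \<theta>(3)[of r] by fastforce
      then show "l \<le> - M t \<bullet> D r" using that(1)[of r] by simp
    qed (use that \<theta>(2) continuous_on_subset[OF \<theta>c] in auto)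
    then show ?thesis using inner_integral_weight[OF \<theta>c order_refl that(2), of "- M t"] by simp
  qed
  \<comment> \<open>Up to \<open>d2\<close> nothing has been put back, so \<open>P\<close> is minus
    the amount removed; hence upper bounds on \<open>M t \<bullet> D r\<close> are the relevant
    ones.\<close>
  have left: "P t = - integral {0..t} (\<lambda>s. \<theta> s *\<^sub>R D s)" if "t \<le> d2" for t
  proof -
    have "integral {0..t} b = 0" by (rule integral_zero_outside) (use that b(3) in auto)
    then show ?thesis by (simp add: P_def)
  qed
  \<comment> \<open>From \<open>r0\<close> on all of \<open>C\<close> has been removed, and the part
    inserted so far is compensated.\<close>
  have right: "M t \<bullet> P t = (1 - integral {0..t} b) * - (M t \<bullet> C)" if "r0 \<le> t" "t \<le> m" for t
  proof -
    have "integral {t..m} (\<lambda>s. \<theta> s *\<^sub>R D s) = 0"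
      by (rule integral_zero_outside) (use that \<theta>(3) in auto)
    moreover have "integral {0..t} (\<lambda>s. \<theta> s *\<^sub>R D s) + integral {t..m} (\<lambda>s. \<theta> s *\<^sub>R D s) = C"
      unfolding C_def using that p
      by (intro Henstock_Kurzweil_Integration.integral_combine integrable_continuous_real continuous_intros D_cont
          continuous_on_subset[OF \<theta>c]) auto
    ultimately show ?thesis by (simp add: P_def inner_diff_right algebra_simps)
  qed
  show ?thesis
  proof (rule transport_bound[of A \<theta> B b d1 d2 \<eta> \<kappa>, folded C_def, folded P_def])
    show "\<theta> t = 0" if "t \<notin> {0<..<ttop}" for t using \<theta>(3)[of t] that p by auto
    show "b t = 0" if "t \<notin> {0<..<ttop}" for t using b(3)[of t] that p by auto
    show "\<kappa> \<le> M t \<bullet> P t" if t: "t \<in> {d1..d2}" for t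
    proof -
      have "integral {0..t} \<theta> = 1" using \<theta>(4)[of 0 t] p t by (auto intro: integral_unique)
      then show ?thesis
        using left[of t] MC[of t \<kappa> t] upper'[OF t] t p qm by simp
    qed
    show "- \<eta> \<le> M t \<bullet> P t" if t: "t \<in> {0..m}" for t
    proof -
      consider "t < p" | "t \<in> {p..d2}" | "t \<in> {d2..q}" | "q < t" using t by fastforce
      then show ?thesis
      proof cases
        case 1
        then have "integral {0..t} (\<lambda>s. \<theta> s *\<^sub>R D s) = 0" by (intro integral_zero_outside) (use \<theta>(3) in auto)
        then show ?thesis using left[of t] 1 p \<eta> by simp
      next
        case 2
        have B: "0 \<le> integral {0..t} \<theta>" "integral {0..t} \<theta> \<le> 1"
          using unit_weight_integral[OF \<theta>(2) \<theta>1, of 0 t] t by auto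
        have "- \<eta> * integral {0..t} \<theta> \<le> M t \<bullet> P t"
          using MC[of t "- \<eta>" t] upper[of t] left[of t] 2 t p by simp
        moreover have "\<eta> * integral {0..t} \<theta> \<le> \<eta> * 1" using B \<eta> by (intro mult_left_mono)
        ultimately show ?thesis by simp
      next
        case 3
        have B: "0 \<le> integral {0..t} b" "integral {0..t} b \<le> 1"
          using unit_weight_integral[OF b(2) b1, of 0 t] t by auto
        have "- \<eta> \<le> - (M t \<bullet> C)"
          using MC[of t "- \<eta>" m] upper[of t] 3 p integral_unique[OF \<theta>1] by (simp add: C_def)
        then have "(1 - integral {0..t} b) * - \<eta> \<le> M t \<bullet> P t"
        proof -
          have "M t \<bullet> P t = (1 - integral {0..t} b) * - (M t \<bullet> C)" using right[of t] 3 p t by simp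
          then show ?thesis using \<open>- \<eta> \<le> - (M t \<bullet> C)\<close> B by (simp only:) (intro mult_left_mono; simp)
        qed
        moreover have "(1 - integral {0..t} b) * \<eta> \<le> 1 * \<eta>" using B \<eta> by (intro mult_right_mono) auto
        ultimately show ?thesis by simp
      next
        case 4
        have "integral {0..t} b = 1" using b(4)[of 0 t] p 4 by (auto intro: integral_unique)
        then show ?thesis using right[of t] 4 t p \<eta> by simp
      qed
    qed
  qed (use p qm \<eta> \<theta> b b1 in auto)
qed

end

subsection \<open>The second-order condition\<close>

context cs_min_pair
begin

lemma dM_inner_D_neg:
  assumes u: "u \<in> {0..T}"
    and less: "frob (xi'' \<beta> Q) (hadamard_power (D u) 2) < frob (matrix_inv Q ** D u) (matrix_inv Q ** D u)"
  shows "dM u \<bullet> D u < 0"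
proof -
  have um: "u \<in> {0..m}" using u T by simp
  have D: "psd (D u)" "transpose (D u) = D u" using D_psd[OF um] psd_symmetric by auto
  have Q: "psd Q" "Q $ i $ i = 1" for i using con by (auto simp: constraint_def)
  have W: "psd (hadamard_power (D u) 2)" by (rule psd_hadamard_power[OF D(1)])
  have "hadamard (xi'' \<beta> (\<Phi> u)) (D u) \<bullet> D u = xi'' \<beta> (\<Phi> u) \<bullet> hadamard_power (D u) 2"
    by (simp add: inner_matrix_entries hadamard_def hadamard_power_def power2_eq_square mult_ac)
  also have "\<dots> \<le> xi'' \<beta> Q \<bullet> hadamard_power (D u) 2"
    using Phi_psd[OF um] Phi_mono[of u m] um Phi_ends by (intro xi''_inner_mono[OF mix] Q W) auto
  also have "\<dots> = frob (xi'' \<beta> Q) (hadamard_power (D u) 2)"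
    by (simp add: frob_symmetric_eq_inner[OF psd_symmetric[OF W]])
  also have "\<dots> < frob (matrix_inv Q ** D u) (matrix_inv Q ** D u)" by (rule less)
  also have "\<dots> = (matrix_inv Q ** D u ** matrix_inv Q) \<bullet> D u"
    by (simp add: frob_def matrix_mul_assoc flip: frob_symmetric_eq_inner[OF D(2)])
  also have "\<dots> \<le> (R u ** D u ** R u) \<bullet> D u"
    unfolding R_def by (rule inverse_form_antimono[OF H_posdef[OF u] H_le_Q[OF um] D(2)])
  finally show ?thesis by (simp add: dM_def inner_diff_left)
qed

text \<open>The bound is uniform in \<open>t\<close>, as \<open>M\<close> is bounded on
  \<open>[0,T]\<close>: only the removed increments have to sit near \<open>u\<close>, not the times
  at which \<open>M\<close> is evaluated.\<close>

lemma inner_D_close: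
  assumes "u \<in> {0..T}" "0 < e"
  obtains \<delta> where "0 < \<delta>"
    "\<And>t r. t \<in> {0..T} \<Longrightarrow> r \<in> {0..T} \<Longrightarrow> \<bar>r - u\<bar> < \<delta> \<Longrightarrow> \<bar>M t \<bullet> D r - M t \<bullet> D u\<bar> < e"
proof -
  obtain B where B: "0 \<le> B" "\<And>t. t \<in> {0..T} \<Longrightarrow> norm (M t) \<le> B"
    using continuous_on_Icc_norm_bound[OF M_cont] by blast
  have "0 < e / (B + 1)" using B assms by simp
  moreover have "continuous_on {0..T} D" using T by (intro continuous_on_subset[OF D_cont]) auto
  ultimately obtain \<delta> where \<delta>: "0 < \<delta>" "\<And>r. r \<in> {0..T} \<Longrightarrow> dist r u < \<delta> \<Longrightarrow> dist (D r) (D u) < e / (B + 1)"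
    using assms(1) unfolding continuous_on_iff by metis
  show ?thesis
  proof (rule that[OF \<delta>(1)])
    fix t r assume *: "t \<in> {0..T}" "r \<in> {0..T}" "\<bar>r - u\<bar> < \<delta>"
    have "\<bar>M t \<bullet> D r - M t \<bullet> D u\<bar> \<le> norm (M t) * norm (D r - D u)"
      by (simp add: Cauchy_Schwarz_ineq2 flip: inner_diff_right)
    also have "\<dots> \<le> B * (e / (B + 1))"
      using B(2)[OF *(1)] \<delta>(2)[of r] * B(1) by (intro mult_mono) (auto simp: dist_norm)
    also have "\<dots> < e" using B(1) assms(2) by (simp add: field_simps)
    finally show "\<bar>M t \<bullet> D r - M t \<bullet> D u\<bar> < e" .
  qed
qed

lemma inner_M_close:
  assumes "u \<in> {0..T}" "0 < e"
  obtains \<delta> where "0 < \<delta>"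
    "\<And>t. t \<in> {0..T} \<Longrightarrow> \<bar>t - u\<bar> < \<delta> \<Longrightarrow> \<bar>M t \<bullet> D u - M u \<bullet> D u\<bar> < e"
proof -
  have "continuous_on {0..T} (\<lambda>t. M t \<bullet> D u)" by (intro continuous_intros M_cont)
  then show ?thesis
    using that assms unfolding continuous_on_iff dist_real_def by metis
qed

lemma inner_M_D_close:
  assumes "u \<in> {0..T}" "0 < e"
  obtains \<delta> where "0 < \<delta>"
    "\<And>t r. t \<in> {0..T} \<Longrightarrow> r \<in> {0..T} \<Longrightarrow> \<bar>t - u\<bar> < \<delta> \<Longrightarrow> \<bar>r - u\<bar> < \<delta> \<Longrightarrow> \<bar>M t \<bullet> D r - M u \<bullet> D u\<bar> < e"
proof -
  obtain \<delta>1 where \<delta>1: "0 < \<delta>1"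
    "\<And>t r. t \<in> {0..T} \<Longrightarrow> r \<in> {0..T} \<Longrightarrow> \<bar>r - u\<bar> < \<delta>1 \<Longrightarrow> \<bar>M t \<bullet> D r - M t \<bullet> D u\<bar> < e / 2"
    using inner_D_close[OF assms(1), of "e / 2"] assms(2) by auto
  obtain \<delta>2 where \<delta>2: "0 < \<delta>2" "\<And>t. t \<in> {0..T} \<Longrightarrow> \<bar>t - u\<bar> < \<delta>2 \<Longrightarrow> \<bar>M t \<bullet> D u - M u \<bullet> D u\<bar> < e / 2"
    using inner_M_close[OF assms(1), of "e / 2"] assms(2) by auto
  show ?thesis
  proof (rule that[of "min \<delta>1 \<delta>2"])
    fix t r assume *: "t \<in> {0..T}" "r \<in> {0..T}" "\<bar>t - u\<bar> < min \<delta>1 \<delta>2" "\<bar>r - u\<bar> < min \<delta>1 \<delta>2"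
    show "\<bar>M t \<bullet> D r - M u \<bullet> D u\<bar> < e"
    proof -
      have "\<bar>M t \<bullet> D r - M t \<bullet> D u\<bar> < e / 2" "\<bar>M t \<bullet> D u - M u \<bullet> D u\<bar> < e / 2"
        using \<delta>1(2)[of t r] \<delta>2(2)[of t] * by auto
      then show ?thesis by linarith
    qed
  qed (use \<delta>1 \<delta>2 in auto)
qed

lemma strict_decrease:
  assumes "u \<in> {0..T}" "dM u \<bullet> D u < 0"
  obtains \<delta> where "0 < \<delta>"
    "\<And>t. t \<in> {0..T} \<Longrightarrow> \<bar>t - u\<bar> < \<delta> \<Longrightarrow> u < t \<Longrightarrow> M t \<bullet> D u < M u \<bullet> D u"
    "\<And>t. t \<in> {0..T} \<Longrightarrow> \<bar>t - u\<bar> < \<delta> \<Longrightarrow> t < u \<Longrightarrow> M u \<bullet> D u < M t \<bullet> D u"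
proof -
  have "((\<lambda>t. M t \<bullet> D u) has_vector_derivative M u \<bullet> 0 + dM u \<bullet> D u) (at u within {0..T})"
    by (intro bounded_bilinear.has_vector_derivative[OF bounded_bilinear_inner] M_deriv assms has_vector_derivative_const)
  then have "((\<lambda>t. (M t \<bullet> D u - M u \<bullet> D u) / (t - u)) \<longlongrightarrow> dM u \<bullet> D u) (at u within {0..T})"
    by (simp add: has_vector_derivative_iff_slope divide_inverse mult.commute)
  then have "\<forall>\<^sub>F t in at u within {0..T}. (M t \<bullet> D u - M u \<bullet> D u) / (t - u) < 0"
    using assms(2) by (rule order_tendstoD)
  then obtain \<delta> where \<delta>: "0 < \<delta>"
    "\<And>t. t \<in> {0..T} \<Longrightarrow> t \<noteq> u \<Longrightarrow> dist t u < \<delta> \<Longrightarrow> (M t \<bullet> D u - M u \<bullet> D u) / (t - u) < 0"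
    unfolding eventually_at by blast
  show ?thesis
  proof (rule that[OF \<delta>(1)])
    fix t assume "t \<in> {0..T}" "\<bar>t - u\<bar> < \<delta>"
    then have *: "t \<noteq> u \<Longrightarrow> (M t \<bullet> D u - M u \<bullet> D u) / (t - u) < 0" using \<delta>(2)[of t] by (simp add: dist_real_def)
    show "u < t \<Longrightarrow> M t \<bullet> D u < M u \<bullet> D u" "t < u \<Longrightarrow> M u \<bullet> D u < M t \<bullet> D u"
      using * by (auto simp: divide_less_0_iff)
  qed
qed

lemma sign_margin:
  fixes g :: "real \<Rightarrow> real"
  assumes "continuous_on {a..b} g" "a \<le> b" "\<And>t. t \<in> {a..b} \<Longrightarrow> 0 < g t"
  shows "\<exists>k>0. \<forall>t\<in>{a..b}. k \<le> g t"
proof -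
  obtain t0 where "t0 \<in> {a..b}" "\<forall>t\<in>{a..b}. g t0 \<le> g t"
    using continuous_attains_inf[of "{a..b}" g] assms by auto
  then show ?thesis using assms(3) by blast
qed

lemma inner_M_cont: "0 \<le> a \<Longrightarrow> b \<le> T \<Longrightarrow> continuous_on {a..b} (\<lambda>t. M t \<bullet> A)"
  by (intro continuous_intros continuous_on_subset[OF M_cont]) auto

lemma no_right_accumulation:
  assumes u: "0 \<le> u" "u < ttop" and neg: "dM u \<bullet> D u < 0"
    and acc: "\<And>s. u < s \<Longrightarrow> s \<le> m \<Longrightarrow> \<exists>d1 d2. u < d1 \<and> d1 < d2 \<and> d2 < s \<and> x d1 < x d2"
  shows False
proof -
  have uT: "u \<in> {0..T}" using u T by simp
  \<comment> \<open>Otherwise taking increments slightly after \<open>u\<close> and inserting them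
    nearer to \<open>u\<close> would lower the functional to first order.\<close>
  have le: "M u \<bullet> D u \<le> 0"
  proof (rule ccontr)
    assume "\<not> M u \<bullet> D u \<le> 0"
    then have pos: "0 < M u \<bullet> D u" by simp
    then obtain \<delta> where \<delta>: "0 < \<delta>"
      "\<And>t r. t \<in> {0..T} \<Longrightarrow> r \<in> {0..T} \<Longrightarrow> \<bar>t - u\<bar> < \<delta> \<Longrightarrow> \<bar>r - u\<bar> < \<delta> \<Longrightarrow>
        \<bar>M t \<bullet> D r - M u \<bullet> D u\<bar> < (M u \<bullet> D u) / 2"
      using inner_M_D_close[OF uT, of "(M u \<bullet> D u) / 2"] by auto
    define q where "q = min ttop (u + \<delta> / 2)"
    have q: "u < q" "q \<le> ttop" "q - u < \<delta>" using \<delta>(1) u by (auto simp: q_def min_def)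
    obtain d1 d2 where d: "u < d1" "d1 < d2" "d2 < q" "x d1 < x d2" using acc[of q] q ttop_range by auto
    have *: "(M u \<bullet> D u) / 2 \<le> M t \<bullet> D r" if "t \<in> {u..q}" "r \<in> {u..q}" for t r
    proof -
      have "\<bar>M t \<bullet> D r - M u \<bullet> D u\<bar> < (M u \<bullet> D u) / 2"
        using that q u T by (intro \<delta>(2)) auto
      then show ?thesis by linarith
    qed
    \<comment> \<open>No error occurs here: near \<open>u\<close> all the pairings exceed half of
      \<open>M u \<bullet> D u\<close>.\<close>
    have "(x d2 - x d1) * ((M u \<bullet> D u) / 2) \<le> 0"
    proof (rule transport_to_left[of u d1 d2 d2 q])
      show "- 0 \<le> M t \<bullet> D r" if "t \<in> {u..q}" "r \<in> {d2..q}" for t r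
        using *[of t r] that d pos by auto
      show "(M u \<bullet> D u) / 2 \<le> M t \<bullet> D r" if "t \<in> {d1..d2}" "r \<in> {d2..q}" for t r
        using *[of t r] that d by auto
    qed (use u q d in auto)
    then show False using pos d by (simp add: mult_le_0_iff)
  qed
  obtain \<delta> where \<delta>: "0 < \<delta>" "\<And>t. t \<in> {0..T} \<Longrightarrow> \<bar>t - u\<bar> < \<delta> \<Longrightarrow> u < t \<Longrightarrow> M t \<bullet> D u < M u \<bullet> D u"
    using strict_decrease[OF uT neg] by metis
  define q where "q = min ttop (u + \<delta> / 2)"
  have q: "u < q" "q \<le> ttop" "q - u < \<delta>" using \<delta>(1) u by (auto simp: q_def min_def)
  have sgn: "M t \<bullet> D u < 0" if "u < t" "t \<le> q" for t using \<delta>(2)[of t] that q u T le by auto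
  obtain d1 d2 where d: "u < d1" "d1 < d2" "d2 < q" "x d1 < x d2" using acc[of q] q ttop_range by auto
  have cont: "continuous_on {d1..d2} (\<lambda>t. - (M t \<bullet> D u))"
    using d q u T by (intro continuous_on_minus inner_M_cont) auto
  have pos: "0 < - (M t \<bullet> D u)" if "t \<in> {d1..d2}" for t using sgn[of t] that d by auto
  obtain k where k: "0 < k" "\<And>t. t \<in> {d1..d2} \<Longrightarrow> k \<le> - (M t \<bullet> D u)"
    using sign_margin[OF cont less_imp_le[OF d(2)] pos] by auto
  \<comment> \<open>\<open>\<eta> \<le> k / 2\<close> leaves the margin \<open>k / 2\<close> when
    \<open>D u\<close> is replaced by \<open>D r\<close>; the factor 1/4 puts \<open>\<eta>\<close>
    below \<open>(x d2 - x d1) * (k / 2)\<close>, against the transport bound.\<close>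
  define \<eta> where "\<eta> = min (k / 2) ((x d2 - x d1) * k / 4)"
  have \<eta>: "0 < \<eta>" "\<eta> \<le> k / 2" "\<eta> < (x d2 - x d1) * (k / 2)"
  proof -
    have "0 < (x d2 - x d1) * k" using k d by (intro mult_pos_pos) auto
    then show "0 < \<eta>" "\<eta> \<le> k / 2" "\<eta> < (x d2 - x d1) * (k / 2)" using k(1) by (auto simp: \<eta>_def)
  qed
  obtain \<epsilon> where \<epsilon>: "0 < \<epsilon>"
    "\<And>t r. t \<in> {0..T} \<Longrightarrow> r \<in> {0..T} \<Longrightarrow> \<bar>r - u\<bar> < \<epsilon> \<Longrightarrow> \<bar>M t \<bullet> D r - M t \<bullet> D u\<bar> < \<eta>"
    using inner_D_close[OF uT \<eta>(1)] by blast
  \<comment> \<open>Removal is confined so close to \<open>u\<close> that \<open>D r\<close> may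
    stand for \<open>D u\<close>, with \<open>d1\<close>, \<open>d2\<close> and \<open>k\<close>
    already fixed.\<close>
  define r0 where "r0 = min d1 (u + \<epsilon> / 2)"
  have r0: "u < r0" "r0 \<le> d1" "r0 - u < \<epsilon>" using \<epsilon>(1) d by (auto simp: r0_def min_def)
  have close: "M t \<bullet> D r \<le> M t \<bullet> D u + \<eta>" if "t \<in> {u..q}" "r \<in> {u..r0}" for t r
  proof -
    have "\<bar>M t \<bullet> D r - M t \<bullet> D u\<bar> < \<eta>" using that q u T r0 d by (intro \<epsilon>(2)) auto
    then show ?thesis by linarith
  qed
  \<comment> \<open>Now increments just after \<open>u\<close> are postponed beyond
    \<open>d2\<close>, in the direction favoured by the negative sign of
    \<open>M t \<bullet> D u\<close>.\<close>
  have "(x d2 - x d1) * (k / 2) \<le> \<eta>"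
  proof (rule transport_to_right[of u r0 d1 d2 q])
    show "M t \<bullet> D r \<le> \<eta>" if "t \<in> {u..q}" "r \<in> {u..r0}" for t r
    proof -
      have "M t \<bullet> D u \<le> 0" using sgn[of t] le that by (cases "t = u") auto
      then show ?thesis using close[OF that] by simp
    qed
    show "M t \<bullet> D r \<le> - (k / 2)" if "t \<in> {d1..d2}" "r \<in> {u..r0}" for t r
    proof -
      have "M t \<bullet> D r \<le> M t \<bullet> D u + \<eta>" using that d q by (intro close) auto
      then show ?thesis using k(2)[OF that(1)] \<eta>(2) by simp
    qed
  qed (use u q d r0 \<eta> in auto)
  then show False using \<eta>(3) by simp
qed

lemma no_left_accumulation:
  assumes u: "0 < u" "u \<le> ttop" and neg: "dM u \<bullet> D u < 0"
    and acc: "\<And>s. 0 \<le> s \<Longrightarrow> s < u \<Longrightarrow> \<exists>d1 d2. s < d1 \<and> d1 < d2 \<and> d2 < u \<and> x d1 < x d2"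
  shows False
proof -
  have uT: "u \<in> {0..T}" using u T by simp
  \<comment> \<open>Otherwise postponing increments within a small interval before \<open>u\<close>
    would lower the functional.\<close>
  have ge: "0 \<le> M u \<bullet> D u"
  proof (rule ccontr)
    assume "\<not> 0 \<le> M u \<bullet> D u"
    then have pos: "0 < - (M u \<bullet> D u)" by simp
    then obtain \<delta> where \<delta>: "0 < \<delta>"
      "\<And>t r. t \<in> {0..T} \<Longrightarrow> r \<in> {0..T} \<Longrightarrow> \<bar>t - u\<bar> < \<delta> \<Longrightarrow> \<bar>r - u\<bar> < \<delta> \<Longrightarrow>
        \<bar>M t \<bullet> D r - M u \<bullet> D u\<bar> < - (M u \<bullet> D u) / 2"
      using inner_M_D_close[OF uT, of "- (M u \<bullet> D u) / 2"] by auto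
    define p where "p = max 0 (u - \<delta> / 2)"
    have p: "0 \<le> p" "p < u" "u - p < \<delta>" using \<delta>(1) u by (auto simp: p_def max_def)
    obtain d1 d2 where d: "p < d1" "d1 < d2" "d2 < u" "x d1 < x d2" using acc[of p] p by auto
    have *: "M t \<bullet> D r \<le> - (- (M u \<bullet> D u) / 2)" if "t \<in> {p..u}" "r \<in> {p..u}" for t r
    proof -
      have "\<bar>M t \<bullet> D r - M u \<bullet> D u\<bar> < - (M u \<bullet> D u) / 2"
        using that p u T by (intro \<delta>(2)) auto
      then show ?thesis by linarith
    qed
    have "(x d2 - x d1) * (- (M u \<bullet> D u) / 2) \<le> 0"
    proof (rule transport_to_right[of p d1 d1 d2 u])
      show "M t \<bullet> D r \<le> 0" if "t \<in> {p..u}" "r \<in> {p..d1}" for t r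
        using *[of t r] that d pos by auto
      show "M t \<bullet> D r \<le> - (- (M u \<bullet> D u) / 2)" if "t \<in> {d1..d2}" "r \<in> {p..d1}" for t r
        using *[of t r] that d by auto
    qed (use u p d in auto)
    moreover have "0 < (x d2 - x d1) * (- (M u \<bullet> D u) / 2)" using pos d by (intro mult_pos_pos) auto
    ultimately show False by linarith
  qed
  obtain \<delta> where \<delta>: "0 < \<delta>" "\<And>t. t \<in> {0..T} \<Longrightarrow> \<bar>t - u\<bar> < \<delta> \<Longrightarrow> t < u \<Longrightarrow> M u \<bullet> D u < M t \<bullet> D u"
    using strict_decrease[OF uT neg] by metis
  define p where "p = max 0 (u - \<delta> / 2)"
  have p: "0 \<le> p" "p < u" "u - p < \<delta>" using \<delta>(1) u by (auto simp: p_def max_def)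
  have sgn: "0 < M t \<bullet> D u" if "p \<le> t" "t < u" for t using \<delta>(2)[of t] that p u T ge by auto
  obtain d1 d2 where d: "p < d1" "d1 < d2" "d2 < u" "x d1 < x d2" using acc[of p] p by auto
  have cont: "continuous_on {d1..d2} (\<lambda>t. M t \<bullet> D u)"
    using d p u T by (intro inner_M_cont) auto
  have pos: "0 < M t \<bullet> D u" if "t \<in> {d1..d2}" for t using sgn[of t] that d by auto
  obtain k where k: "0 < k" "\<And>t. t \<in> {d1..d2} \<Longrightarrow> k \<le> M t \<bullet> D u"
    using sign_margin[OF cont less_imp_le[OF d(2)] pos] by auto
  define \<eta> where "\<eta> = min (k / 2) ((x d2 - x d1) * k / 4)"
  have \<eta>: "0 < \<eta>" "\<eta> \<le> k / 2" "\<eta> < (x d2 - x d1) * (k / 2)"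
  proof -
    have "0 < (x d2 - x d1) * k" using k d by (intro mult_pos_pos) auto
    then show "0 < \<eta>" "\<eta> \<le> k / 2" "\<eta> < (x d2 - x d1) * (k / 2)" using k(1) by (auto simp: \<eta>_def)
  qed
  obtain \<epsilon> where \<epsilon>: "0 < \<epsilon>"
    "\<And>t r. t \<in> {0..T} \<Longrightarrow> r \<in> {0..T} \<Longrightarrow> \<bar>r - u\<bar> < \<epsilon> \<Longrightarrow> \<bar>M t \<bullet> D r - M t \<bullet> D u\<bar> < \<eta>"
    using inner_D_close[OF uT \<eta>(1)] by blast
  define r0 where "r0 = max d2 (u - \<epsilon> / 2)"
  have r0: "r0 < u" "d2 \<le> r0" "u - r0 < \<epsilon>" using \<epsilon>(1) d by (auto simp: r0_def max_def)
  have close: "M t \<bullet> D u - \<eta> \<le> M t \<bullet> D r" if "t \<in> {p..u}" "r \<in> {r0..u}" for t r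
  proof -
    have "\<bar>M t \<bullet> D r - M t \<bullet> D u\<bar> < \<eta>" using that p u T r0 d by (intro \<epsilon>(2)) auto
    then show ?thesis by linarith
  qed
  \<comment> \<open>Increments just before \<open>u\<close> are advanced to times before
    \<open>d1\<close>; as \<open>M t \<bullet> D u\<close> decreases through a nonnegative value, it
    is positive on the way.\<close>
  have "(x d2 - x d1) * (k / 2) \<le> \<eta>"
  proof (rule transport_to_left[of p d1 d2 r0 u])
    show "- \<eta> \<le> M t \<bullet> D r" if "t \<in> {p..u}" "r \<in> {r0..u}" for t r
    proof -
      have "0 \<le> M t \<bullet> D u" using sgn[of t] ge that by (cases "t = u") auto
      then show ?thesis using close[OF that] by simp
    qed
    show "k / 2 \<le> M t \<bullet> D r" if "t \<in> {d1..d2}" "r \<in> {r0..u}" for t r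
    proof -
      have "M t \<bullet> D u - \<eta> \<le> M t \<bullet> D r" using that d p by (intro close) auto
      then show ?thesis using k(2)[OF that(1)] \<eta>(2) by simp
    qed
  qed (use u p d r0 \<eta> in auto)
  then show False using \<eta>(3) by simp
qed

lemma atom_of_neg_second_variation:
  assumes u: "u \<in> supp (parisi_measure m x)" and neg: "dM u \<bullet> D u < 0"
  shows "measure (parisi_measure m x) {u} > 0"
proof (rule ccontr)
  assume "\<not> ?thesis"
  then have "measure (parisi_measure m x) {u} = 0" by (simp add: not_less measure_le_0_iff)
  then show False
  proof (rule supp_parisi_no_atom[OF m_pos op u])
    have u0: "0 \<le> u" using supp_parisi_subset[OF m_pos op u] by simp
    {
      assume "u < m" and acc: "\<And>s. u < s \<Longrightarrow> s \<le> m \<Longrightarrow> \<exists>d1 d2. u < d1 \<and> d1 < d2 \<and> d2 < s \<and> x d1 < x d2"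
      obtain d1 d2 where d: "u < d1" "d1 < d2" "d2 < m" "x d1 < x d2" using acc[of m] \<open>u < m\<close> by auto
      \<comment> \<open>\<open>x\<close> still increases after \<open>d1\<close>, so
        \<open>d1\<close> lies below \<open>ttop\<close>, and hence so does
        \<open>u\<close>.\<close>
      then have "x d1 \<noteq> 1" using order_param_range[OF op, of d2] u0 by auto
      then have "u < ttop" using x_eq_1[of d1] d u0 by auto
      then show False by (rule no_right_accumulation[OF u0 _ neg acc])
    next
      assume "0 < u" "\<And>s. 0 \<le> s \<Longrightarrow> s < u \<Longrightarrow> \<exists>d1 d2. s < d1 \<and> d1 < d2 \<and> d2 < u \<and> x d1 < x d2"
      then show False by (rule no_left_accumulation[OF _ supp_parisi_le_t_top[OF m_pos op u] neg])
    }
  qed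
qed

end

theorem proposition17:
  fixes \<beta> :: "nat \<Rightarrow> real^'n" and h :: "real^'n" and Q :: "real^'n^'n"
    and x :: "real \<Rightarrow> real" and \<Phi> :: "real \<Rightarrow> real^'n^'n" and u\<^sub>0 :: real
  assumes "mixture \<beta>"
    and "constraint Q"
    and "cs_minimizer \<beta> h Q x \<Phi>"
    and "u\<^sub>0 \<in> supp (parisi_measure (real CARD('n)) x)"
    and "frob (xi'' \<beta> Q) (hadamard_power (path_deriv \<Phi> u\<^sub>0) 2)
         < frob (matrix_inv Q ** path_deriv \<Phi> u\<^sub>0) (matrix_inv Q ** path_deriv \<Phi> u\<^sub>0)"
  shows "measure (parisi_measure (real CARD('n)) x) {u\<^sub>0} > 0"
proof -
  define m where "m = real CARD('n)"
  have m: "0 < m" by (simp add: m_def)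
  have adm: "admissible Q x \<Phi>" using assms(3) by (simp add: cs_minimizer_def)
  then have op: "order_param m x" and ends: "\<Phi> m = Q" and det: "0 < det (Q - \<Phi> (t_top m x))"
    by (auto simp: admissible_def m_def)
  have top: "t_top m x \<in> {0..m}" by (rule order_param_t_top[OF m op])
  have cont: "continuous_on {0..m} \<Phi>"
    using adm by (auto simp: admissible_def admissible_path_def m_def continuous_on_eq_continuous_within
      intro!: differentiable_imp_continuous_within)
  have "\<exists>T. T \<in> {t_top m x<..<m} \<and> 0 < det (\<Phi> m - \<Phi> T)"
  proof -
    \<comment> \<open>The index type is nonempty, so the vector \<open>1\<close> is nonzero and
      shows that the zero matrix is not definite.\<close>
    have "det (0 :: real^'n^'n) = 0"
      using posdef_iff[of "0 :: real^'n^'n"] by (auto dest: spec[of _ 1])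
    then have "det (Q - \<Phi> m) = 0" by (simp add: ends)
    then have lt: "t_top m x < m" using det top by (cases "t_top m x = m") auto
    have "continuous_on {t_top m x..m} (\<lambda>t. det (Q - \<Phi> t))"
      using top by (intro continuous_intros continuous_on_subset[OF cont]) auto
    then have "((\<lambda>t. det (Q - \<Phi> t)) \<longlongrightarrow> det (Q - \<Phi> (t_top m x))) (at_right (t_top m x))"
      using lt by (simp add: continuous_on_def flip: at_within_Icc_at_right[OF lt])
    then have "\<forall>\<^sub>F t in at_right (t_top m x). 0 < det (Q - \<Phi> t)" using det by (rule order_tendstoD)
    then obtain b where b: "t_top m x < b" "\<And>t. t_top m x < t \<Longrightarrow> t < b \<Longrightarrow> 0 < det (Q - \<Phi> t)"
      unfolding eventually_at_right_field by blast
    then have "0 < det (Q - \<Phi> ((t_top m x + min b m) / 2))" using lt by (intro b(2)) (auto simp: min_def)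
    then show ?thesis using b lt ends by (intro exI[of _ "(t_top m x + min b m) / 2"]) (auto simp: min_def)
  qed
  define T where "T = (SOME T. T \<in> {t_top m x<..<m} \<and> 0 < det (\<Phi> m - \<Phi> T))"
  have T: "T \<in> {t_top m x<..<m} \<and> 0 < det (\<Phi> m - \<Phi> T)"
    unfolding T_def by (rule someI_ex) fact
  interpret cs_min_pair \<beta> h Q x \<Phi> m T
    using assms(1-3) adm T ends by unfold_locales (auto simp: m_def T_def)
  have "u\<^sub>0 \<in> {0..T}"
    using supp_parisi_subset[OF m op] supp_parisi_le_t_top[OF m op] assms(4) T by (fastforce simp: m_def)
  then have "dM u\<^sub>0 \<bullet> D u\<^sub>0 < 0" using dM_inner_D_neg assms(5) by (simp add: D_def)
  then show ?thesis using atom_of_neg_second_variation assms(4) by (simp add: m_def)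
qed

end
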